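(* Let $\mathsf{T}$ be a big tensor-triangulated category which is canonically stratified (by a graded commutative Noetherian ring $R$). Let $L$ be a smashing localisation on $\mathsf{T}$. Then the category of $L$-local objects $L\mathsf{T}$ is a definable subcategory of $\mathsf{T}$ with the property that $L\mathsf{T}=(L\mathsf{T})^{d}$.
   Context: A big tensor-triangulated category is a compactly generated triangulated category $\mathsf{T}$ with a compatible closed symmetric monoidal structure (product $\otimes$, unit $\mathbb{1}$, internal hom $F$) whose compact objects $\mathsf{T}^{\mathrm{c}}$ coincide with its rigid objects ($X$ is rigid if $F(X,\mathbb{1})\otimes Y\to F(X,Y)$ is an isomorphism for all $Y$). A localising $\otimes$-ideal is a triangulated subcategory closed under coproducts and under $X\otimes-$ for all $X\in\mathsf{T}$. A localisation is an exact functor $L\colon\mathsf{T}\to\mathsf{T}$ with a natural transformation $\eta\colon\mathrm{Id}\to L$ such that $L\eta$ is invertible, $L\eta=\eta L$, and $\ker(L)$ is a $\otimes$-ideal; it is smashing if it preserves coproducts (equivalently $L\mathbb{1}\otimes X\to LX$ is an isomorphism for all $X$). $X$ is $L$-local if $\eta_X$ is an isomorphism; $L\mathsf{T}$ is the full subcategory of $L$-local objects. Stratification (Benson--Iyengar--Krause): a graded commutative Noetherian ring $R$ acts canonically on $\mathsf{T}$ if there is a graded ring map $R\to\mathrm{End}^*_{\mathsf{T}}(\mathbb{1})$, inducing compatible maps $R\to\mathrm{End}^*_{\mathsf{T}}(X)$ via $-\otimes X$. $\mathrm{Spec}(R)$ is the set of homogeneous prime ideals. For $\mathcal{V}\subseteq\mathrm{Spec}(R)$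 specialization closed, let $\mathsf{T}_{\mathcal{V}}=\{X:\mathrm{Hom}^*_{\mathsf{T}}(C,X)_{\mathfrak{p}}=0\ \forall C\in\mathsf{T}^{\mathrm{c}},\mathfrak{p}\notin\mathcal{V}\}$; this localising subcategory gives functorial triangles $\Gamma_{\mathcal{V}}X\to X\to L_{\mathcal{V}}X\to\Sigma\Gamma_{\mathcal{V}}X$ with $\Gamma_{\mathcal{V}}X\in\mathsf{T}_{\mathcal{V}}$ and $L_{\mathcal{V}}X$ right orthogonal to $\mathsf{T}_{\mathcal{V}}$. For $\mathfrak{p}\in\mathrm{Spec}(R)$ set $\Gamma_{\mathfrak{p}}=\Gamma_{\mathcal{V}(\mathfrak{p})}L_{\mathcal{Z}(\mathfrak{p})}$ with $\mathcal{V}(\mathfrak{p})=\{\mathfrak{q}\supseteq\mathfrak{p}\}$, $\mathcal{Z}(\mathfrak{p})=\{\mathfrak{q}\not\subseteq\mathfrak{p}\}$. $\mathrm{supp}(X)=\{\mathfrak{p}:\Gamma_{\mathfrak{p}}X\not\simeq0\}$; $\mathrm{supp}$ of a subcategory is the union over its objects. $\mathsf{T}$ is canonically stratified by $R$ if for each $\mathfrak{p}$, $\Gamma_{\mathfrak{p}}\mathsf{T}$ contains no non-zero proper localising $\otimes$-ideals; equivalently $\mathrm{supp}$ is a bijection from localising $\otimes$-ideals of $\mathsf{T}$ to subsets of $\mathrm{supp}(\mathsf{T})$. A class $\mathcal{D}\subseteq\mathsf{T}$ is definable if there is a set of maps $f_i$ in $\mathsf{T}^{\mathrm{c}}$ with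 $\mathcal{D}=\{X:\mathrm{Hom}_{\mathsf{T}}(f_i,X)\text{ is surjective for all }i\}$. $(\mathsf{T}^{\mathrm{c}},\mathbf{Ab})^{\mathrm{fp}}$ is the category of finitely presented functors $G=\mathrm{coker}(\mathrm{Hom}_{\mathsf{T}}(f,-)|_{\mathsf{T}^{\mathrm{c}}})$, $f$ a map in $\mathsf{T}^{\mathrm{c}}$; $\widetilde{G}\colon\mathsf{T}\to\mathbf{Ab}$ is the same cokernel computed on $\mathsf{T}$. With $D=F(-,\mathbb{1})$, put $\mathcal{S}_{\mathcal{D}}=\{G:\widetilde{G}(X)=0\ \forall X\in\mathcal{D}\}$ and $(\delta G)(Y)=\mathrm{Hom}_{(\mathsf{T}^{\mathrm{c}},\mathbf{Ab})}(G,\mathrm{Hom}_{\mathsf{T}}(DY,-))$, an exact contravariant autoequivalence of $(\mathsf{T}^{\mathrm{c}},\mathbf{Ab})^{\mathrm{fp}}$. The dual definable category of $\mathcal{D}$ is $\mathcal{D}^{d}=\{Y\in\mathsf{T}:\widetilde{H}(Y)=0\ \forall H\in\delta\mathcal{S}_{\mathcal{D}}\}$. *)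

theory Defs
  imports "HOL-Algebra.Product_Groups" "HOL-Algebra.Ring_Divisibility" "HOL-Library.Equipollence"
begin

section \<open>Smallness\<close>

text \<open>
  ``Set'' in the phrases ``set of compact generators'', ``coproducts indexed by a set'', ``set of
  maps'' means ``small set''. A set is small if it is strictly smaller than a fixed set \<open>U\<close> whose
  cardinality is uncountable and strongly inaccessible, as for a Grothendieck universe. Closure of
  the small cardinals under power sets is forced anyway by a non-zero object in a category with
  small coproducts and small hom-sets.
\<close>

definition universe :: "'u set \<Rightarrow> bool" where
  "universe U \<longleftrightarrow>
     (UNIV :: nat set) \<prec> U \<and>
     (\<forall>A. A \<subseteq> U \<and> A \<prec> U \<longrightarrow> Pow A \<prec> U) \<and>
     (\<forall>I A. I \<subseteq> U \<and> I \<prec> U \<and> (\<forall>i\<in>I. A i \<subseteq> U \<and> A i \<prec> U) \<longrightarrow> (\<Union>i\<in>I. A i) \<prec> U)"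


section \<open>Triangulated categories with a closed symmetric monoidal structure\<close>

text \<open>
  Every element of \<open>'o\<close> is an object and every element of \<open>'m\<close> is an arrow. The arrow \<open>g \<cdot> f\<close>
  (first \<open>f\<close>, then \<open>g\<close>) is meaningful only if the target of \<open>f\<close> is the source of \<open>g\<close>, and
  \<open>f \<boxplus> g\<close> only if \<open>f\<close> and \<open>g\<close> are parallel. A triangle \<open>X \<rightarrow> Y \<rightarrow> Z \<rightarrow> \<Sigma>X\<close> is the triple of
  its arrows. The structure isomorphisms are
  \<open>assoc X Y Z : (X \<boxtimes> Y) \<boxtimes> Z \<rightarrow> X \<boxtimes> (Y \<boxtimes> Z)\<close>, \<open>lunit X : \<one> \<boxtimes> X \<rightarrow> X\<close>,
  \<open>runit X : X \<boxtimes> \<one> \<rightarrow> X\<close>, \<open>braid X Y : X \<boxtimes> Y \<rightarrow> Y \<boxtimes> X\<close>,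
  \<open>tshift X Y : \<Sigma>X \<boxtimes> Y \<rightarrow> \<Sigma>(X \<boxtimes> Y)\<close>, and \<open>eval X Y : F(X,Y) \<boxtimes> X \<rightarrow> Y\<close> is the counit of the
  internal hom, where \<open>ihom X Y\<close> is \<open>F(X,Y)\<close>.
\<close>

record ('o, 'm) tt_data =
  src :: "'m \<Rightarrow> 'o"
  tgt :: "'m \<Rightarrow> 'o"
  ident :: "'o \<Rightarrow> 'm"
  cmp :: "'m \<Rightarrow> 'm \<Rightarrow> 'm" (infixr "\<cdot>\<index>" 70)
  plus_arr :: "'m \<Rightarrow> 'm \<Rightarrow> 'm" (infixl "\<boxplus>\<index>" 65)
  zero_arr :: "'o \<Rightarrow> 'o \<Rightarrow> 'm"
  shift :: "'o \<Rightarrow> 'o"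
  shift_arr :: "'m \<Rightarrow> 'm"
  triangles :: "('m \<times> 'm \<times> 'm) set"
  tensor :: "'o \<Rightarrow> 'o \<Rightarrow> 'o" (infixr "\<boxtimes>\<index>" 75)
  tensor_arr :: "'m \<Rightarrow> 'm \<Rightarrow> 'm" (infixr "\<boxtimes>\<^sub>a\<index>" 75)
  unit_obj :: 'o
  assoc :: "'o \<Rightarrow> 'o \<Rightarrow> 'o \<Rightarrow> 'm"
  lunit :: "'o \<Rightarrow> 'm"
  runit :: "'o \<Rightarrow> 'm"
  braid :: "'o \<Rightarrow> 'o \<Rightarrow> 'm"
  tshift :: "'o \<Rightarrow> 'o \<Rightarrow> 'm"
  ihom :: "'o \<Rightarrow> 'o \<Rightarrow> 'o"
  eval :: "'o \<Rightarrow> 'o \<Rightarrow> 'm"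

definition int_iter :: "('a \<Rightarrow> 'a) \<Rightarrow> int \<Rightarrow> 'a \<Rightarrow> 'a" where
  "int_iter f n = (if n \<ge> 0 then f ^^ nat n else inv_into UNIV f ^^ nat (- n))"

context
  fixes T :: "('o, 'm) tt_data" (structure)
begin

definition Hom :: "'o \<Rightarrow> 'o \<Rightarrow> 'm set" where
  "Hom X Y = {f. src T f = X \<and> tgt T f = Y}"

text \<open>The group law is addition of arrows, although \<open>monoid\<close> writes it multiplicatively.\<close>

definition homgrp :: "'o \<Rightarrow> 'o \<Rightarrow> 'm monoid" where
  "homgrp X Y = \<lparr>carrier = Hom X Y, monoid.mult = plus_arr T, one = zero_arr T X Y\<rparr>"

definition neg_arr :: "'m \<Rightarrow> 'm" where
  "neg_arr f = m_inv (homgrp (src T f) (tgt T f)) f"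

definition is_iso :: "'m \<Rightarrow> bool" where
  "is_iso f \<longleftrightarrow> (\<exists>g \<in> Hom (tgt T f) (src T f).
     g \<cdot> f = ident T (src T f) \<and> f \<cdot> g = ident T (tgt T f))"

definition inv_arr :: "'m \<Rightarrow> 'm" where
  "inv_arr f = (THE g. g \<in> Hom (tgt T f) (src T f) \<and>
     g \<cdot> f = ident T (src T f) \<and> f \<cdot> g = ident T (tgt T f))"

definition isomorphic :: "'o \<Rightarrow> 'o \<Rightarrow> bool" where
  "isomorphic X Y \<longleftrightarrow> (\<exists>f \<in> Hom X Y. is_iso f)"

definition is_zero :: "'o \<Rightarrow> bool" where
  "is_zero X \<longleftrightarrow> (\<forall>Y. Hom X Y = {zero_arr T X Y} \<and> Hom Y X = {zero_arr T Y X})"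

definition coproduct :: "'i set \<Rightarrow> ('i \<Rightarrow> 'o) \<Rightarrow> 'o \<Rightarrow> ('i \<Rightarrow> 'm) \<Rightarrow> bool" where
  "coproduct I X P \<iota> \<longleftrightarrow>
     (\<forall>i\<in>I. \<iota> i \<in> Hom (X i) P) \<and>
     (\<forall>Y g. (\<forall>i\<in>I. g i \<in> Hom (X i) Y) \<longrightarrow>
        (\<exists>!h. h \<in> Hom P Y \<and> (\<forall>i\<in>I. h \<cdot> \<iota> i = g i)))"

text \<open>\<open>C\<close> is compact if \<open>Hom(C,-)\<close> preserves small coproducts.\<close>

definition compact_obj :: "'u set \<Rightarrow> 'o \<Rightarrow> bool" where
  "compact_obj U C \<longleftrightarrow>
     (\<forall>I X P \<iota>. I \<subseteq> U \<and> I \<prec> U \<and> coproduct I X P \<iota> \<longrightarrow>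
        (\<lambda>x. finprod (homgrp C P) (\<lambda>i. \<iota> i \<cdot> x i) {i \<in> I. x i \<noteq> zero_arr T C (X i)})
          \<in> iso (sum_group I (\<lambda>i. homgrp C (X i))) (homgrp C P))"

definition compacts :: "'u set \<Rightarrow> 'o set" where
  "compacts U = {C. compact_obj U C}"

definition shiftn :: "int \<Rightarrow> 'o \<Rightarrow> 'o" where
  "shiftn = int_iter (shift T)"

definition shiftn_arr :: "int \<Rightarrow> 'm \<Rightarrow> 'm" where
  "shiftn_arr = int_iter (shift_arr T)"

text \<open>The arrow \<open>\<Sigma>\<^sup>nX \<boxtimes> Y \<rightarrow> \<Sigma>\<^sup>n(X \<boxtimes> Y)\<close>, for \<open>n \<ge> 0\<close> and then for all integers \<open>n\<close>.\<close>

primrec tshift_nat :: "nat \<Rightarrow> 'o \<Rightarrow> 'o \<Rightarrow> 'm" where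
  "tshift_nat 0 X Y = ident T (X \<boxtimes> Y)"
| "tshift_nat (Suc n) X Y = shift_arr T (tshift_nat n X Y) \<cdot> tshift T (shiftn (int n) X) Y"

definition tshiftn :: "int \<Rightarrow> 'o \<Rightarrow> 'o \<Rightarrow> 'm" where
  "tshiftn n X Y =
     (if n \<ge> 0 then tshift_nat (nat n) X Y
      else inv_arr (shiftn_arr n (tshift_nat (nat (- n)) (shiftn n X) Y)))"

text \<open>The arrow \<open>X \<boxtimes> \<Sigma>Y \<rightarrow> \<Sigma>(X \<boxtimes> Y)\<close>.\<close>

definition tshift_right :: "'o \<Rightarrow> 'o \<Rightarrow> 'm" where
  "tshift_right X Y = shift_arr T (braid T Y X) \<cdot> tshift T Y X \<cdot> braid T X (shift T Y)"

text \<open>The arrow \<open>Z \<rightarrow> F(X,Y)\<close> adjoint to \<open>f : Z \<boxtimes> X \<rightarrow> Y\<close>.\<close>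

definition curry_arr :: "'o \<Rightarrow> 'o \<Rightarrow> 'o \<Rightarrow> 'm \<Rightarrow> 'm" where
  "curry_arr Z X Y f =
     (THE g. g \<in> Hom Z (ihom T X Y) \<and> eval T X Y \<cdot> (g \<boxtimes>\<^sub>a ident T X) = f)"

text \<open>\<open>F(f,W) : F(Y,W) \<rightarrow> F(X,W)\<close> for \<open>f : X \<rightarrow> Y\<close>.\<close>

definition ihom_arr :: "'m \<Rightarrow> 'o \<Rightarrow> 'm" where
  "ihom_arr f W = curry_arr (ihom T (tgt T f) W) (src T f) W
     (eval T (tgt T f) W \<cdot> (ident T (ihom T (tgt T f) W) \<boxtimes>\<^sub>a f))"

text \<open>The canonical arrow \<open>\<Sigma>F(\<Sigma>X,W) \<rightarrow> F(X,W)\<close>.\<close>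

definition ihom_shift :: "'o \<Rightarrow> 'o \<Rightarrow> 'm" where
  "ihom_shift X W =
     (let A = ihom T (shift T X) W in
      curry_arr (shift T A) X W
        (eval T (shift T X) W \<cdot> inv_arr (tshift_right A X) \<cdot> tshift T A X))"

definition dual_obj :: "'o \<Rightarrow> 'o" where
  "dual_obj X = ihom T X (unit_obj T)"

definition dual_arr :: "'m \<Rightarrow> 'm" where
  "dual_arr f = ihom_arr f (unit_obj T)"

text \<open>The canonical arrow \<open>F(X,\<one>) \<boxtimes> Y \<rightarrow> F(X,Y)\<close>.\<close>

definition rigid_map :: "'o \<Rightarrow> 'o \<Rightarrow> 'm" where
  "rigid_map X Y = curry_arr (dual_obj X \<boxtimes> Y) X Y
     (lunit T Y \<cdot> (eval T X (unit_obj T) \<boxtimes>\<^sub>a ident T Y) \<cdot> inv_arr (assoc T (dual_obj X) X Y) \<cdot>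
      (ident T (dual_obj X) \<boxtimes>\<^sub>a braid T Y X) \<cdot> assoc T (dual_obj X) Y X)"

definition rigid :: "'o \<Rightarrow> bool" where
  "rigid X \<longleftrightarrow> (\<forall>Y. is_iso (rigid_map X Y))"

text \<open>Full subcategories are identified with their sets of objects.\<close>

definition triangulated_subcat :: "'o set \<Rightarrow> bool" where
  "triangulated_subcat M \<longleftrightarrow>
     (\<exists>X\<in>M. is_zero X) \<and>
     (\<forall>X Y. X \<in> M \<and> isomorphic X Y \<longrightarrow> Y \<in> M) \<and>
     (\<forall>X. shift T X \<in> M \<longleftrightarrow> X \<in> M) \<and>
     (\<forall>f g h. (f, g, h) \<in> triangles T \<and> src T f \<in> M \<and> tgt T f \<in> M \<longrightarrow> tgt T g \<in> M)"

definition localising_ideal :: "'u set \<Rightarrow> 'o set \<Rightarrow> bool" where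
  "localising_ideal U M \<longleftrightarrow>
     triangulated_subcat M \<and>
     (\<forall>I X P \<iota>. I \<subseteq> U \<and> I \<prec> U \<and> (\<forall>i\<in>I. X i \<in> M) \<and> coproduct I X P \<iota> \<longrightarrow> P \<in> M) \<and>
     (\<forall>X. \<forall>Y\<in>M. X \<boxtimes> Y \<in> M)"

end

locale additive_category =
  fixes T :: "('o, 'm) tt_data" (structure)
  assumes ident_in: "ident T X \<in> Hom T X X"
    and cmp_in: "\<lbrakk>f \<in> Hom T X Y; g \<in> Hom T Y Z\<rbrakk> \<Longrightarrow> g \<cdot> f \<in> Hom T X Z"
    and ident_left: "f \<in> Hom T X Y \<Longrightarrow> ident T Y \<cdot> f = f"
    and ident_right: "f \<in> Hom T X Y \<Longrightarrow> f \<cdot> ident T X = f"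
    and cmp_assoc: "\<lbrakk>f \<in> Hom T W X; g \<in> Hom T X Y; h \<in> Hom T Y Z\<rbrakk> \<Longrightarrow> (h \<cdot> g) \<cdot> f = h \<cdot> g \<cdot> f"
    and comm_group_homgrp: "comm_group (homgrp T X Y)"
    and cmp_plus_left:
      "\<lbrakk>f \<in> Hom T X Y; g \<in> Hom T Y Z; h \<in> Hom T Y Z\<rbrakk> \<Longrightarrow> (g \<boxplus> h) \<cdot> f = (g \<cdot> f) \<boxplus> (h \<cdot> f)"
    and cmp_plus_right:
      "\<lbrakk>f \<in> Hom T X Y; g \<in> Hom T X Y; h \<in> Hom T Y Z\<rbrakk> \<Longrightarrow> h \<cdot> (f \<boxplus> g) = (h \<cdot> f) \<boxplus> (h \<cdot> g)"
    and zero_object: "\<exists>Z. is_zero T Z"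
    and binary_coproducts: "\<exists>P \<iota>. coproduct T (UNIV :: bool set) Xs P \<iota>"

text \<open>The suspension is an automorphism of the category; the last axiom is the octahedral one.\<close>

locale triangulated_category = additive_category +
  assumes shift_in: "f \<in> Hom T X Y \<Longrightarrow> shift_arr T f \<in> Hom T (shift T X) (shift T Y)"
    and shift_ident: "shift_arr T (ident T X) = ident T (shift T X)"
    and shift_cmp:
      "\<lbrakk>f \<in> Hom T X Y; g \<in> Hom T Y Z\<rbrakk> \<Longrightarrow> shift_arr T (g \<cdot> f) = shift_arr T g \<cdot> shift_arr T f"
    and shift_plus:
      "\<lbrakk>f \<in> Hom T X Y; g \<in> Hom T X Y\<rbrakk> \<Longrightarrow> shift_arr T (f \<boxplus> g) = shift_arr T f \<boxplus> shift_arr T g"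
    and bij_shift: "bij (shift T)"
    and bij_shift_arr: "bij (shift_arr T)"
    and triangle_arrows:
      "(f, g, h) \<in> triangles T \<Longrightarrow>
         src T g = tgt T f \<and> src T h = tgt T g \<and> tgt T h = shift T (src T f)"
    and triangle_iso:
      "\<lbrakk>(f, g, h) \<in> triangles T; is_iso T a; is_iso T b; is_iso T c;
        a \<in> Hom T (src T f) X; b \<in> Hom T (src T g) Y; c \<in> Hom T (src T h) Z;
        f' \<in> Hom T X Y; g' \<in> Hom T Y Z; h' \<in> Hom T Z (shift T X);
        b \<cdot> f = f' \<cdot> a; c \<cdot> g = g' \<cdot> b; shift_arr T a \<cdot> h = h' \<cdot> c\<rbrakk>
       \<Longrightarrow> (f', g', h') \<in> triangles T"
    and triangle_ident:
      "is_zero T Z \<Longrightarrow> (ident T X, zero_arr T X Z, zero_arr T Z (shift T X)) \<in> triangles T"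
    and triangle_exists: "\<exists>g h. (f, g, h) \<in> triangles T"
    and triangle_rotate:
      "\<lbrakk>f \<in> Hom T X Y; g \<in> Hom T Y Z; h \<in> Hom T Z (shift T X)\<rbrakk>
       \<Longrightarrow> (f, g, h) \<in> triangles T \<longleftrightarrow> (g, h, neg_arr T (shift_arr T f)) \<in> triangles T"
    and triangle_fill:
      "\<lbrakk>(f, g, h) \<in> triangles T; (f', g', h') \<in> triangles T;
        a \<in> Hom T (src T f) (src T f'); b \<in> Hom T (src T g) (src T g'); b \<cdot> f = f' \<cdot> a\<rbrakk>
       \<Longrightarrow> \<exists>c \<in> Hom T (src T h) (src T h'). c \<cdot> g = g' \<cdot> b \<and> shift_arr T a \<cdot> h = h' \<cdot> c"
    and triangle_octahedron:
      "\<lbrakk>f \<in> Hom T X Y; g \<in> Hom T Y Z;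
        (f, f1, f2) \<in> triangles T; (g, g1, g2) \<in> triangles T; (g \<cdot> f, k1, k2) \<in> triangles T\<rbrakk>
       \<Longrightarrow> \<exists>u v. (u, v, shift_arr T f1 \<cdot> g2) \<in> triangles T \<and>
              u \<in> Hom T (tgt T f1) (tgt T k1) \<and> v \<in> Hom T (tgt T k1) (tgt T g1) \<and>
              u \<cdot> f1 = k1 \<cdot> g \<and> k2 \<cdot> u = f2 \<and> v \<cdot> k1 = g1 \<and> g2 \<cdot> v = shift_arr T f \<cdot> k2"

locale closed_symmetric_monoidal = additive_category +
  assumes tensor_in:
      "\<lbrakk>f \<in> Hom T X X'; g \<in> Hom T Y Y'\<rbrakk> \<Longrightarrow> f \<boxtimes>\<^sub>a g \<in> Hom T (X \<boxtimes> Y) (X' \<boxtimes> Y')"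
    and tensor_ident: "ident T X \<boxtimes>\<^sub>a ident T Y = ident T (X \<boxtimes> Y)"
    and tensor_cmp:
      "\<lbrakk>f \<in> Hom T X X'; f' \<in> Hom T X' X''; g \<in> Hom T Y Y'; g' \<in> Hom T Y' Y''\<rbrakk>
       \<Longrightarrow> (f' \<cdot> f) \<boxtimes>\<^sub>a (g' \<cdot> g) = (f' \<boxtimes>\<^sub>a g') \<cdot> (f \<boxtimes>\<^sub>a g)"
    and tensor_plus_left:
      "\<lbrakk>f \<in> Hom T X X'; f' \<in> Hom T X X'; g \<in> Hom T Y Y'\<rbrakk>
       \<Longrightarrow> (f \<boxplus> f') \<boxtimes>\<^sub>a g = (f \<boxtimes>\<^sub>a g) \<boxplus> (f' \<boxtimes>\<^sub>a g)"
    and tensor_plus_right: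
      "\<lbrakk>f \<in> Hom T X X'; g \<in> Hom T Y Y'; g' \<in> Hom T Y Y'\<rbrakk>
       \<Longrightarrow> f \<boxtimes>\<^sub>a (g \<boxplus> g') = (f \<boxtimes>\<^sub>a g) \<boxplus> (f \<boxtimes>\<^sub>a g')"
    and assoc_in: "assoc T X Y Z \<in> Hom T ((X \<boxtimes> Y) \<boxtimes> Z) (X \<boxtimes> (Y \<boxtimes> Z))"
    and assoc_iso: "is_iso T (assoc T X Y Z)"
    and assoc_natural:
      "\<lbrakk>f \<in> Hom T X X'; g \<in> Hom T Y Y'; h \<in> Hom T Z Z'\<rbrakk>
       \<Longrightarrow> assoc T X' Y' Z' \<cdot> ((f \<boxtimes>\<^sub>a g) \<boxtimes>\<^sub>a h) = (f \<boxtimes>\<^sub>a (g \<boxtimes>\<^sub>a h)) \<cdot> assoc T X Y Z"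
    and lunit_in: "lunit T X \<in> Hom T (unit_obj T \<boxtimes> X) X"
    and lunit_iso: "is_iso T (lunit T X)"
    and lunit_natural:
      "f \<in> Hom T X X' \<Longrightarrow> lunit T X' \<cdot> (ident T (unit_obj T) \<boxtimes>\<^sub>a f) = f \<cdot> lunit T X"
    and runit_in: "runit T X \<in> Hom T (X \<boxtimes> unit_obj T) X"
    and runit_iso: "is_iso T (runit T X)"
    and runit_natural:
      "f \<in> Hom T X X' \<Longrightarrow> runit T X' \<cdot> (f \<boxtimes>\<^sub>a ident T (unit_obj T)) = f \<cdot> runit T X"
    and braid_in: "braid T X Y \<in> Hom T (X \<boxtimes> Y) (Y \<boxtimes> X)"
    and braid_natural:
      "\<lbrakk>f \<in> Hom T X X'; g \<in> Hom T Y Y'\<rbrakk>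
       \<Longrightarrow> braid T X' Y' \<cdot> (f \<boxtimes>\<^sub>a g) = (g \<boxtimes>\<^sub>a f) \<cdot> braid T X Y"
    and braid_symmetric: "braid T Y X \<cdot> braid T X Y = ident T (X \<boxtimes> Y)"
    and pentagon:
      "(ident T W \<boxtimes>\<^sub>a assoc T X Y Z) \<cdot> assoc T W (X \<boxtimes> Y) Z \<cdot> (assoc T W X Y \<boxtimes>\<^sub>a ident T Z)
       = assoc T W X (Y \<boxtimes> Z) \<cdot> assoc T (W \<boxtimes> X) Y Z"
    and triangle_identity:
      "(ident T X \<boxtimes>\<^sub>a lunit T Y) \<cdot> assoc T X (unit_obj T) Y = runit T X \<boxtimes>\<^sub>a ident T Y"
    and hexagon:
      "assoc T Y Z X \<cdot> braid T X (Y \<boxtimes> Z) \<cdot> assoc T X Y Z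
       = (ident T Y \<boxtimes>\<^sub>a braid T X Z) \<cdot> assoc T Y X Z \<cdot> (braid T X Y \<boxtimes>\<^sub>a ident T Z)"
    and eval_in: "eval T X Y \<in> Hom T (ihom T X Y \<boxtimes> X) Y"
    and eval_universal:
      "f \<in> Hom T (Z \<boxtimes> X) Y \<Longrightarrow>
         \<exists>!g. g \<in> Hom T Z (ihom T X Y) \<and> eval T X Y \<cdot> (g \<boxtimes>\<^sub>a ident T X) = f"

text \<open>
  Compatibility of the two structures is taken in the sense of Hovey, Palmieri and Strickland
  (Axiomatic stable homotopy theory, Definition A.2.1). Exactness of \<open>F(W,-)\<close> follows from
  adjointness and is not listed. \<open>F(-,W)\<close> is exact up to sign. The sign rule for the twist of
  \<open>\<Sigma>\<^sup>r\<one>\<close> and \<open>\<Sigma>\<^sup>s\<one>\<close> is stated for \<open>r = s = 1\<close>, the other cases being formal consequences.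
\<close>

locale tensor_triangulated_category = triangulated_category + closed_symmetric_monoidal +
  assumes tshift_in: "tshift T X Y \<in> Hom T (shift T X \<boxtimes> Y) (shift T (X \<boxtimes> Y))"
    and tshift_iso: "is_iso T (tshift T X Y)"
    and tshift_natural:
      "\<lbrakk>f \<in> Hom T X X'; g \<in> Hom T Y Y'\<rbrakk>
       \<Longrightarrow> tshift T X' Y' \<cdot> (shift_arr T f \<boxtimes>\<^sub>a g) = shift_arr T (f \<boxtimes>\<^sub>a g) \<cdot> tshift T X Y"
    and tshift_unit: "shift_arr T (runit T X) \<cdot> tshift T X (unit_obj T) = runit T (shift T X)"
    and tshift_assoc:
      "tshift T X (Y \<boxtimes> Z) \<cdot> assoc T (shift T X) Y Z
       = shift_arr T (assoc T X Y Z) \<cdot> tshift T (X \<boxtimes> Y) Z \<cdot> (tshift T X Y \<boxtimes>\<^sub>a ident T Z)"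
    and tensor_exact:
      "(f, g, h) \<in> triangles T \<Longrightarrow>
         (f \<boxtimes>\<^sub>a ident T W, g \<boxtimes>\<^sub>a ident T W, tshift T (src T f) W \<cdot> (h \<boxtimes>\<^sub>a ident T W)) \<in> triangles T"
    and ihom_exact:
      "(f, g, h) \<in> triangles T \<Longrightarrow>
         \<exists>k. k \<in> Hom T (ihom T (src T f) W) (shift T (ihom T (tgt T g) W)) \<and>
             k \<cdot> ihom_shift T (src T f) W = shift_arr T (ihom_arr T h W) \<and>
             ((ihom_arr T g W, ihom_arr T f W, k) \<in> triangles T \<or>
              (ihom_arr T g W, ihom_arr T f W, neg_arr T k) \<in> triangles T)"
    and braid_shift_unit:
      "braid T (shift T (unit_obj T)) (shift T (unit_obj T))
       = neg_arr T (ident T (shift T (unit_obj T) \<boxtimes> shift T (unit_obj T)))"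

text \<open>
  Compact generation in this form: small coproducts exist, the isomorphism classes of compact
  objects form a set, and the compact objects detect zero objects.
\<close>

locale big_tt_category = tensor_triangulated_category +
  fixes U :: "'u set"
  assumes universe: "universe U"
    and small_homs: "Hom T X Y \<prec> U"
    and small_coproducts:
      "\<lbrakk>I \<subseteq> U; I \<prec> U\<rbrakk> \<Longrightarrow> \<exists>P \<iota>. coproduct T I Xs P \<iota>"
    and compacts_essentially_small:
      "\<exists>G. G \<prec> U \<and> G \<subseteq> compacts T U \<and> (\<forall>C \<in> compacts T U. \<exists>C'\<in>G. isomorphic T C C')"
    and compacts_generate:
      "(\<And>C. C \<in> compacts T U \<Longrightarrow> Hom T C X = {zero_arr T C X}) \<Longrightarrow> is_zero T X"
    and compact_iff_rigid: "compact_obj T U X \<longleftrightarrow> rigid T X"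


section \<open>Smashing localisations\<close>

record ('o, 'm) endofunctor =
  on_obj :: "'o \<Rightarrow> 'o"
  on_arr :: "'m \<Rightarrow> 'm"

context
  fixes T :: "('o, 'm) tt_data" (structure)
begin

definition exact_functor :: "('o, 'm) endofunctor \<Rightarrow> bool" where
  "exact_functor L \<longleftrightarrow>
     (\<forall>X Y. \<forall>f \<in> Hom T X Y. on_arr L f \<in> Hom T (on_obj L X) (on_obj L Y)) \<and>
     (\<forall>X. on_arr L (ident T X) = ident T (on_obj L X)) \<and>
     (\<forall>X Y Z. \<forall>f \<in> Hom T X Y. \<forall>g \<in> Hom T Y Z. on_arr L (g \<cdot> f) = on_arr L g \<cdot> on_arr L f) \<and>
     (\<forall>X Y. \<forall>f \<in> Hom T X Y. \<forall>g \<in> Hom T X Y. on_arr L (f \<boxplus> g) = on_arr L f \<boxplus> on_arr L g) \<and>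
     (\<exists>\<psi>.
        (\<forall>X. \<psi> X \<in> Hom T (on_obj L (shift T X)) (shift T (on_obj L X)) \<and> is_iso T (\<psi> X)) \<and>
        (\<forall>X Y. \<forall>f \<in> Hom T X Y.
           \<psi> Y \<cdot> on_arr L (shift_arr T f) = shift_arr T (on_arr L f) \<cdot> \<psi> X) \<and>
        (\<forall>f g h. (f, g, h) \<in> triangles T \<longrightarrow>
           (on_arr L f, on_arr L g, \<psi> (src T f) \<cdot> on_arr L h) \<in> triangles T))"

definition localisation :: "('o, 'm) endofunctor \<Rightarrow> ('o \<Rightarrow> 'm) \<Rightarrow> bool" where
  "localisation L \<eta> \<longleftrightarrow>
     exact_functor L \<and>
     (\<forall>X. \<eta> X \<in> Hom T X (on_obj L X)) \<and>
     (\<forall>X Y. \<forall>f \<in> Hom T X Y. \<eta> Y \<cdot> f = on_arr L f \<cdot> \<eta> X) \<and>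
     (\<forall>X. is_iso T (on_arr L (\<eta> X))) \<and>
     (\<forall>X. on_arr L (\<eta> X) = \<eta> (on_obj L X)) \<and>
     (\<forall>X Y. is_zero T (on_obj L Y) \<longrightarrow> is_zero T (on_obj L (X \<boxtimes> Y)))"

definition smashing_localisation :: "'u set \<Rightarrow> ('o, 'm) endofunctor \<Rightarrow> ('o \<Rightarrow> 'm) \<Rightarrow> bool" where
  "smashing_localisation U L \<eta> \<longleftrightarrow>
     localisation L \<eta> \<and>
     (\<forall>I X P \<iota>. I \<subseteq> U \<and> I \<prec> U \<and> coproduct T I X P \<iota> \<longrightarrow>
        coproduct T I (\<lambda>i. on_obj L (X i)) (on_obj L P) (\<lambda>i. on_arr L (\<iota> i)))"

definition local_objects :: "('o \<Rightarrow> 'm) \<Rightarrow> 'o set" where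
  "local_objects \<eta> = {X. is_iso T (\<eta> X)}"

end


section \<open>Graded rings\<close>

definition graded_ring :: "('r, 'z) ring_scheme \<Rightarrow> (int \<Rightarrow> 'r set) \<Rightarrow> bool" where
  "graded_ring R gr \<longleftrightarrow>
     ring R \<and>
     (\<forall>n. additive_subgroup (gr n) R) \<and>
     (\<forall>r \<in> carrier R. \<exists>!x. (\<forall>n. x n \<in> gr n) \<and> finite {n. x n \<noteq> \<zero>\<^bsub>R\<^esub>} \<and>
        r = (\<Oplus>\<^bsub>R\<^esub>n\<in>{n. x n \<noteq> \<zero>\<^bsub>R\<^esub>}. x n)) \<and>
     \<one>\<^bsub>R\<^esub> \<in> gr 0 \<and>
     (\<forall>m n. \<forall>a \<in> gr m. \<forall>b \<in> gr n. a \<otimes>\<^bsub>R\<^esub> b \<in> gr (m + n))"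

definition graded_commutative :: "('r, 'z) ring_scheme \<Rightarrow> (int \<Rightarrow> 'r set) \<Rightarrow> bool" where
  "graded_commutative R gr \<longleftrightarrow>
     (\<forall>m n. \<forall>a \<in> gr m. \<forall>b \<in> gr n.
        a \<otimes>\<^bsub>R\<^esub> b = (if even (m * n) then b \<otimes>\<^bsub>R\<^esub> a else \<ominus>\<^bsub>R\<^esub> (b \<otimes>\<^bsub>R\<^esub> a)))"

text \<open>The library's \<open>primeideal\<close> is restricted to commutative rings.\<close>

definition hspec :: "('r, 'z) ring_scheme \<Rightarrow> (int \<Rightarrow> 'r set) \<Rightarrow> 'r set set" where
  "hspec R gr =
     {\<pp>. ideal \<pp> R \<and> \<pp> = genideal R (\<pp> \<inter> (\<Union>n. gr n)) \<and> \<pp> \<noteq> carrier R \<and>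
         (\<forall>a \<in> carrier R. \<forall>b \<in> carrier R. a \<otimes>\<^bsub>R\<^esub> b \<in> \<pp> \<longrightarrow> a \<in> \<pp> \<or> b \<in> \<pp>)}"


section \<open>Canonical actions and stratification\<close>

text \<open>
  \<open>End\<^sup>n(\<one>) = Hom(\<one>, \<Sigma>\<^sup>n\<one>)\<close>, with product \<open>x y = \<Sigma>\<^sup>n(x) \<cdot> y\<close> for \<open>y\<close> of degree \<open>n\<close>. The component
  of the ring map in degree \<open>n\<close> is \<open>\<phi> n\<close>; the degree is an argument because the zero of \<open>R\<close> lies
  in every degree.
\<close>

definition canonical_action ::
    "('o, 'm) tt_data \<Rightarrow> ('r, 'z) ring_scheme \<Rightarrow> (int \<Rightarrow> 'r set) \<Rightarrow> (int \<Rightarrow> 'r \<Rightarrow> 'm) \<Rightarrow> bool" where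
  "canonical_action T R gr \<phi> \<longleftrightarrow>
     (\<forall>n. \<forall>a \<in> gr n. \<phi> n a \<in> Hom T (unit_obj T) (shiftn T n (unit_obj T))) \<and>
     (\<forall>n. \<forall>a \<in> gr n. \<forall>b \<in> gr n. \<phi> n (a \<oplus>\<^bsub>R\<^esub> b) = \<phi> n a \<boxplus>\<^bsub>T\<^esub> \<phi> n b) \<and>
     \<phi> 0 \<one>\<^bsub>R\<^esub> = ident T (unit_obj T) \<and>
     (\<forall>m n. \<forall>a \<in> gr m. \<forall>b \<in> gr n.
        \<phi> (m + n) (a \<otimes>\<^bsub>R\<^esub> b) = shiftn_arr T n (\<phi> m a) \<cdot>\<^bsub>T\<^esub> \<phi> n b)"

context
  fixes T :: "('o, 'm) tt_data" (structure)
    and R :: "('r, 'z) ring_scheme"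
    and gr :: "int \<Rightarrow> 'r set"
    and \<phi> :: "int \<Rightarrow> 'r \<Rightarrow> 'm"
begin

text \<open>The image of \<open>r\<close> of degree \<open>n\<close> in \<open>End\<^sup>n(X) = Hom(X, \<Sigma>\<^sup>nX)\<close>, induced by \<open>- \<boxtimes> X\<close>.\<close>

definition act_obj :: "int \<Rightarrow> 'r \<Rightarrow> 'o \<Rightarrow> 'm" where
  "act_obj n r X =
     shiftn_arr T n (lunit T X) \<cdot> tshiftn T n (unit_obj T) X \<cdot>
     (\<phi> n r \<boxtimes>\<^sub>a ident T X) \<cdot> inv_arr T (lunit T X)"

text \<open>The product of \<open>r\<close>, of degree \<open>n\<close>, and \<open>x : C \<rightarrow> \<Sigma>\<^sup>jX\<close>.\<close>

definition act :: "'o \<Rightarrow> int \<Rightarrow> 'r \<Rightarrow> int \<Rightarrow> 'm \<Rightarrow> 'm" where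
  "act X n r j x = shiftn_arr T j (act_obj n r X) \<cdot> x"

text \<open>
  The degree \<open>k\<close> part of the localisation of \<open>Hom\<^sup>*(C,X)\<close> at \<open>\<pp>\<close>: classes of left fractions
  \<open>s\<^sup>-\<^sup>1x\<close>, with \<open>x\<close> of degree \<open>j\<close> and \<open>s \<notin> \<pp>\<close> homogeneous of degree \<open>d\<close>, where \<open>k = j - d\<close>, represented
  by \<open>(j, x, d, s)\<close>. Two fractions agree if they have a common expansion; in this form the relation
  involves no signs.
\<close>

definition fractions :: "'r set \<Rightarrow> 'o \<Rightarrow> 'o \<Rightarrow> int \<Rightarrow> (int \<times> 'm \<times> int \<times> 'r) set" where
  "fractions \<pp> C X k =
     {(j, x, d, s). x \<in> Hom T C (shiftn T j X) \<and> s \<in> gr d \<and> s \<notin> \<pp> \<and> j - d = k}"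

definition fraction_rel ::
    "'r set \<Rightarrow> 'o \<Rightarrow> 'o \<Rightarrow> int \<Rightarrow> ((int \<times> 'm \<times> int \<times> 'r) \<times> (int \<times> 'm \<times> int \<times> 'r)) set" where
  "fraction_rel \<pp> C X k =
     {((j, x, d, s), (j', x', d', s')).
        (j, x, d, s) \<in> fractions \<pp> C X k \<and> (j', x', d', s') \<in> fractions \<pp> C X k \<and>
        (\<exists>e e'. \<exists>a \<in> gr e. \<exists>a' \<in> gr e'. e + d = e' + d' \<and>
           a \<otimes>\<^bsub>R\<^esub> s = a' \<otimes>\<^bsub>R\<^esub> s' \<and> a \<otimes>\<^bsub>R\<^esub> s \<notin> \<pp> \<and> act X e a j x = act X e' a' j' x')}"

definition hom_localised :: "'r set \<Rightarrow> 'o \<Rightarrow> 'o \<Rightarrow> int \<Rightarrow> (int \<times> 'm \<times> int \<times> 'r) set set" where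
  "hom_localised \<pp> C X k = fractions \<pp> C X k // fraction_rel \<pp> C X k"

definition hom_localised_zero :: "'r set \<Rightarrow> 'o \<Rightarrow> 'o \<Rightarrow> bool" where
  "hom_localised_zero \<pp> C X \<longleftrightarrow>
     (\<forall>k. hom_localised \<pp> C X k =
        {fraction_rel \<pp> C X k `` {(k, zero_arr T C (shiftn T k X), 0, \<one>\<^bsub>R\<^esub>)}})"

definition supported_on :: "'u set \<Rightarrow> 'r set set \<Rightarrow> 'o set" where
  "supported_on U V =
     {X. \<forall>C \<in> compacts T U. \<forall>\<pp> \<in> hspec R gr - V. hom_localised_zero \<pp> C X}"

text \<open>
  A triangle \<open>\<Gamma>\<^sub>VX \<rightarrow> X \<rightarrow> L\<^sub>VX \<rightarrow> \<Sigma>\<Gamma>\<^sub>VX\<close> with \<open>G = \<Gamma>\<^sub>VX\<close> and \<open>Q = L\<^sub>VX\<close>. For specialization closed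
  \<open>V\<close> such a triangle exists and is unique up to unique isomorphism; the objects \<open>\<Gamma>\<^sub>VX\<close> and
  \<open>L\<^sub>VX\<close> are chosen accordingly.
\<close>

definition support_triangle :: "'u set \<Rightarrow> 'r set set \<Rightarrow> 'o \<Rightarrow> 'o \<Rightarrow> 'o \<Rightarrow> bool" where
  "support_triangle U V G X Q \<longleftrightarrow>
     (\<exists>f g h. (f, g, h) \<in> triangles T \<and> f \<in> Hom T G X \<and> g \<in> Hom T X Q) \<and>
     G \<in> supported_on U V \<and>
     (\<forall>Z \<in> supported_on U V. Hom T Z Q = {zero_arr T Z Q})"

definition Gamma_V :: "'u set \<Rightarrow> 'r set set \<Rightarrow> 'o \<Rightarrow> 'o" where
  "Gamma_V U V X = (SOME G. \<exists>Q. support_triangle U V G X Q)"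

definition L_V :: "'u set \<Rightarrow> 'r set set \<Rightarrow> 'o \<Rightarrow> 'o" where
  "L_V U V X = (SOME Q. \<exists>G. support_triangle U V G X Q)"

definition Gamma_p :: "'u set \<Rightarrow> 'r set \<Rightarrow> 'o \<Rightarrow> 'o" where
  "Gamma_p U \<pp> X =
     Gamma_V U {\<qq> \<in> hspec R gr. \<pp> \<subseteq> \<qq>} (L_V U {\<qq> \<in> hspec R gr. \<not> \<qq> \<subseteq> \<pp>} X)"

text \<open>The essential image of \<open>\<Gamma>\<^sub>\<pp>\<close>.\<close>

definition Gamma_p_image :: "'u set \<Rightarrow> 'r set \<Rightarrow> 'o set" where
  "Gamma_p_image U \<pp> = {Y. \<exists>X. isomorphic T (Gamma_p U \<pp> X) Y}"

definition canonically_stratified :: "'u set \<Rightarrow> bool" where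
  "canonically_stratified U \<longleftrightarrow>
     canonical_action T R gr \<phi> \<and>
     (\<forall>\<pp> \<in> hspec R gr. \<forall>M. localising_ideal T U M \<and> M \<subseteq> Gamma_p_image U \<pp> \<longrightarrow>
        M = {X. is_zero T X} \<or> M = Gamma_p_image U \<pp>)"

end


section \<open>Definable subcategories and their duals\<close>

text \<open>A functor from a full subcategory to abelian groups, on objects and on arrows.\<close>

record ('o, 'm, 'e) abfunctor =
  val :: "'o \<Rightarrow> 'e monoid"
  map_arr :: "'m \<Rightarrow> 'e \<Rightarrow> 'e"

context
  fixes T :: "('o, 'm) tt_data" (structure)
begin

definition definable :: "'u set \<Rightarrow> 'o set \<Rightarrow> bool" where
  "definable U D \<longleftrightarrow>
     (\<exists>S. S \<prec> U \<and> (\<forall>f\<in>S. src T f \<in> compacts T U \<and> tgt T f \<in> compacts T U) \<and>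
        D = {X. \<forall>f\<in>S. (\<lambda>h. h \<cdot> f) ` Hom T (tgt T f) X = Hom T (src T f) X})"

definition ab_functor_on :: "'o set \<Rightarrow> ('o, 'm, 'e) abfunctor \<Rightarrow> bool" where
  "ab_functor_on K G \<longleftrightarrow>
     (\<forall>X\<in>K. comm_group (val G X)) \<and>
     (\<forall>X\<in>K. \<forall>Y\<in>K. \<forall>f \<in> Hom T X Y. map_arr G f \<in> hom (val G X) (val G Y)) \<and>
     (\<forall>X\<in>K. \<forall>x \<in> carrier (val G X). map_arr G (ident T X) x = x) \<and>
     (\<forall>X\<in>K. \<forall>Y\<in>K. \<forall>Z\<in>K. \<forall>f \<in> Hom T X Y. \<forall>g \<in> Hom T Y Z. \<forall>x \<in> carrier (val G X).
        map_arr G (g \<cdot> f) x = map_arr G g (map_arr G f x))"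

definition nat_transf ::
    "'o set \<Rightarrow> ('o, 'm, 'd) abfunctor \<Rightarrow> ('o, 'm, 'e) abfunctor \<Rightarrow> ('o \<Rightarrow> 'd \<Rightarrow> 'e) \<Rightarrow> bool" where
  "nat_transf K G H \<tau> \<longleftrightarrow>
     (\<forall>X\<in>K. \<tau> X \<in> hom (val G X) (val H X)) \<and>
     (\<forall>X\<in>K. \<forall>Y\<in>K. \<forall>f \<in> Hom T X Y. \<forall>x \<in> carrier (val G X).
        \<tau> Y (map_arr G f x) = map_arr H f (\<tau> X x))"

definition nat_isomorphic ::
    "'o set \<Rightarrow> ('o, 'm, 'd) abfunctor \<Rightarrow> ('o, 'm, 'e) abfunctor \<Rightarrow> bool" where
  "nat_isomorphic K G H \<longleftrightarrow>
     (\<exists>\<tau>. nat_transf K G H \<tau> \<and> (\<forall>X\<in>K. \<tau> X \<in> iso (val G X) (val H X)))"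

definition hom_functor :: "'o \<Rightarrow> ('o, 'm, 'm) abfunctor" where
  "hom_functor A = \<lparr>val = homgrp T A, map_arr = (\<lambda>g x. g \<cdot> x)\<rparr>"

text \<open>
  The cokernel of \<open>Hom(f,-) : Hom(B,-) \<rightarrow> Hom(A,-)\<close> for \<open>f : A \<rightarrow> B\<close>. An arrow \<open>g : X \<rightarrow> Y\<close> sends the
  class of \<open>x : A \<rightarrow> X\<close> to the class of \<open>g \<cdot> x\<close>.
\<close>

definition im_hom :: "'m \<Rightarrow> 'o \<Rightarrow> 'm set" where
  "im_hom f X = (\<lambda>h. h \<cdot> f) ` Hom T (tgt T f) X"

definition coker_functor :: "'m \<Rightarrow> ('o, 'm, 'm set) abfunctor" where
  "coker_functor f =
     \<lparr>val = (\<lambda>X. homgrp T (src T f) X Mod im_hom f X),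
      map_arr = (\<lambda>g c. im_hom f (tgt T g) <#>\<^bsub>homgrp T (src T f) (tgt T g)\<^esub> ((\<lambda>x. g \<cdot> x) ` c))\<rparr>"

text \<open>
  In what follows \<open>K\<close> is the set of compact objects, and \<open>presents K f G\<close> says that \<open>G\<close> is the
  cokernel of \<open>Hom(f,-)\<close> restricted to \<open>K\<close>. A finitely presented functor is always isomorphic to one
  with values in groups of cosets, so the fixed element type \<open>'m set\<close> in \<open>annihilator\<close>
  below loses nothing.
\<close>

definition presents :: "'o set \<Rightarrow> 'm \<Rightarrow> ('o, 'm, 'e) abfunctor \<Rightarrow> bool" where
  "presents K f G \<longleftrightarrow> src T f \<in> K \<and> tgt T f \<in> K \<and> nat_isomorphic K (coker_functor f) G"

definition fp_functor :: "'o set \<Rightarrow> ('o, 'm, 'e) abfunctor \<Rightarrow> bool" where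
  "fp_functor K G \<longleftrightarrow> ab_functor_on K G \<and> (\<exists>f. presents K f G)"

text \<open>The extension \<open>G\<^sup>~\<close> of \<open>G\<close> to the whole category, determined up to isomorphism.\<close>

definition tilde :: "'o set \<Rightarrow> ('o, 'm, 'e) abfunctor \<Rightarrow> ('o, 'm, 'm set) abfunctor" where
  "tilde K G = coker_functor (SOME f. presents K f G)"

text \<open>Natural transformations are made unique as functions by fixing their junk values.\<close>

definition nat_group ::
    "'o set \<Rightarrow> ('o, 'm, 'd) abfunctor \<Rightarrow> ('o, 'm, 'e) abfunctor \<Rightarrow> ('o \<Rightarrow> 'd \<Rightarrow> 'e) monoid" where
  "nat_group K G H =
     \<lparr>carrier = {\<tau>. nat_transf K G H \<tau> \<and>
        (\<forall>X x. \<not> (X \<in> K \<and> x \<in> carrier (val G X)) \<longrightarrow> \<tau> X x = undefined)},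
      monoid.mult = (\<lambda>\<sigma> \<tau> X x. if X \<in> K \<and> x \<in> carrier (val G X)
                        then \<sigma> X x \<otimes>\<^bsub>val H X\<^esub> \<tau> X x else undefined),
      one = (\<lambda>X x. if X \<in> K \<and> x \<in> carrier (val G X) then \<one>\<^bsub>val H X\<^esub> else undefined)\<rparr>"

definition delta ::
    "'o set \<Rightarrow> ('o, 'm, 'e) abfunctor \<Rightarrow> ('o, 'm, 'o \<Rightarrow> 'e \<Rightarrow> 'm) abfunctor" where
  "delta K G =
     \<lparr>val = (\<lambda>Y. nat_group K G (hom_functor (dual_obj T Y))),
      map_arr = (\<lambda>h \<tau> X x. if X \<in> K \<and> x \<in> carrier (val G X)
                           then \<tau> X x \<cdot> dual_arr T h else undefined)\<rparr>"

definition annihilator :: "'o set \<Rightarrow> 'o set \<Rightarrow> ('o, 'm, 'm set) abfunctor set" where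
  "annihilator K D = {G. fp_functor K G \<and> (\<forall>X\<in>D. trivial_group (val (tilde K G) X))}"

definition dual_definable :: "'u set \<Rightarrow> 'o set \<Rightarrow> 'o set" where
  "dual_definable U D =
     {Y. \<forall>H \<in> delta (compacts T U) ` annihilator (compacts T U) D.
           trivial_group (val (tilde (compacts T U) H) Y)}"

end

end

theory Submission
  imports Defs "HOL-Algebra.Free_Abelian_Groups"
begin

text \<open>
  Let \<open>J\<close> be the class of arrows between compact objects that \<open>L\<close> kills. The functor \<open>Hom(C, L-)\<close> is
  homological and preserves coproducts, and the compact objects generate, so \<open>Hom(C, LX)\<close> is the
  colimit of the groups \<open>Hom(C, LC')\<close> over the compact objects \<open>C'\<close> above \<open>X\<close>. Hence an arrow from a
  compact object to an \<open>L\<close>-acyclic object factors through an arrow in \<open>J\<close>, and (Krause) \<open>X\<close> is local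
  if and only if \<open>Hom(j, X) = 0\<close> for all \<open>j\<close> in \<open>J\<close>. This makes the local objects definable.

  Compact objects are rigid, and \<open>J\<close> is stable under the duality \<open>D\<close>: if \<open>f : A \<rightarrow> B\<close> factors through
  an acyclic object \<open>G\<close>, then \<open>Df\<close> factors through \<open>DA \<boxtimes> (DB \<boxtimes> G)\<close>, which is again acyclic.

  Complete a compact arrow \<open>f\<close> to a triangle with arrows \<open>n : N \<rightarrow> Z\<close>, \<open>m : Z \<rightarrow> A\<close>, \<open>f : A \<rightarrow> B\<close>. Then
  \<open>\<delta>\<close> sends the cokernel of \<open>Hom(f, -)\<close> to the cokernel of \<open>Hom(Dn, -)\<close>. The first one vanishes on
  all local objects if and only if \<open>m\<close> lies in \<open>J\<close>, and the second one vanishes on \<open>Y\<close> if and only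
  if \<open>Hom(Dm, Y) = 0\<close>. So the dual definable category is cut out by \<open>DJ = J\<close>, as the local objects are.
\<close>

section \<open>Additive and triangulated categories\<close>

text \<open>The compact objects over \<open>X\<close> need not have a colimit in a triangulated
  category, so the colimit formula is split into two statements on elements: every element of Hom(C,
  LX) comes from a compact object over \<open>X\<close> (\<open>lift_prop\<close>), and an element
  that dies at \<open>X\<close> dies at a compact stage (\<open>kill_prop\<close>). They behave like
  the two halves of the five lemma: each passes to cones only with the help of the other, so they
  share one induction over coproducts and cones of compact objects. That such an induction reaches
  every object is shown by a mapping telescope.

  Two further obstacles shape the end. The extension of a functor to all of \<open>T\<close> rests
  on a chosen presentation, while isomorphisms of functors live on compact objects only;
  presentations must therefore be compared by relations between compact arrows, which can be
  composed into any object. And the dual functor sees an arrow \<open>j\<close> of \<open>J\<close>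
  through a second dual, so the double dual has to be undone. This needs rigid objects to be
  reflexive with rigid duals, and both facts are extracted from the invertibility of the canonical
  arrow \<open>rigid_map\<close>.\<close>

lemma in_Hom: "f \<in> Hom T X Y \<longleftrightarrow> src T f = X \<and> tgt T f = Y"
  by (simp add: Hom_def)

lemma homgrp_simps [simp]:
  "carrier (homgrp T X Y) = Hom T X Y"
  "f \<otimes>\<^bsub>homgrp T X Y\<^esub> g = plus_arr T f g"
  "\<one>\<^bsub>homgrp T X Y\<^esub> = zero_arr T X Y"
  by (simp_all add: homgrp_def)

section \<open>Arrow calculus in an additive category\<close>

context additive_category
begin

text \<open>Membership in \<open>Hom\<close> is replaced from here on by equations for source and
  target, so that the simplifier can check composability.\<close>

lemma src_ident [simp]: "src T (ident T X) = X" and tgt_ident [simp]: "tgt T (ident T X) = X"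
  using ident_in[of X] by (simp_all add: in_Hom)

lemma src_cmp [simp]: "tgt T f = src T g \<Longrightarrow> src T (g \<cdot> f) = src T f"
  and tgt_cmp [simp]: "tgt T f = src T g \<Longrightarrow> tgt T (g \<cdot> f) = tgt T g"
  using cmp_in[of f _ _ g] by (simp_all add: in_Hom)

lemma cmp_ident_left [simp]: "tgt T f = Y \<Longrightarrow> ident T Y \<cdot> f = f"
  and cmp_ident_right [simp]: "src T f = X \<Longrightarrow> f \<cdot> ident T X = f"
  using ident_left[of f "src T f" Y] ident_right[of f X "tgt T f"] by (simp_all add: in_Hom)

lemma cmp_assoc' [simp]:
  "\<lbrakk>tgt T f = src T g; tgt T g = src T h\<rbrakk> \<Longrightarrow> (h \<cdot> g) \<cdot> f = h \<cdot> g \<cdot> f"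
  using cmp_assoc by (simp add: in_Hom)

text \<open>Composites are normalised by bracketing to the right, so a known equation for
  \<open>g \<cdot> f\<close> no longer matches once another arrow stands behind it. This is the
  equation with such a tail \<open>z\<close>.\<close>

lemma cmp_reduce: "\<lbrakk>g \<cdot> f = k; tgt T f = src T g; tgt T z = src T f\<rbrakk> \<Longrightarrow> g \<cdot> f \<cdot> z = k \<cdot> z"
  using cmp_assoc'[of z f g] by simp

lemma cmp_reduce3:
  "\<lbrakk>h \<cdot> g \<cdot> f = k; tgt T f = src T g; tgt T g = src T h; tgt T z = src T f\<rbrakk> \<Longrightarrow> h \<cdot> g \<cdot> f \<cdot> z = k \<cdot> z"
  using cmp_assoc'[of z "g \<cdot> f" h] by simp

lemma src_zero [simp]: "src T (zero_arr T X Y) = X" and tgt_zero [simp]: "tgt T (zero_arr T X Y) = Y"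
  using comm_groupE(2)[OF comm_group_homgrp, of X Y] by (simp_all add: in_Hom)

lemma src_plus [simp]: "\<lbrakk>src T f = src T g; tgt T f = tgt T g\<rbrakk> \<Longrightarrow> src T (f \<boxplus> g) = src T g"
  and tgt_plus [simp]: "\<lbrakk>src T f = src T g; tgt T f = tgt T g\<rbrakk> \<Longrightarrow> tgt T (f \<boxplus> g) = tgt T g"
  using comm_groupE(1)[OF comm_group_homgrp, of f "src T g" "tgt T g" g] by (simp_all add: in_Hom)

lemma neg_arr_in: "f \<in> Hom T X Y \<Longrightarrow> neg_arr T f \<in> Hom T X Y"
  using group.inv_closed[OF comm_group.axioms(2)[OF comm_group_homgrp], of f X Y]
  by (simp add: neg_arr_def in_Hom)

lemma src_neg [simp]: "src T (neg_arr T f) = src T f" and tgt_neg [simp]: "tgt T (neg_arr T f) = tgt T f"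
  using neg_arr_in[of f] by (simp_all add: in_Hom)

lemma plus_assoc:
  "\<lbrakk>src T f = src T g; tgt T f = tgt T g; src T g = src T h; tgt T g = tgt T h\<rbrakk>
   \<Longrightarrow> (f \<boxplus> g) \<boxplus> h = f \<boxplus> (g \<boxplus> h)"
  using comm_groupE(3)[OF comm_group_homgrp, of f "src T h" "tgt T h" g h] by (simp add: in_Hom)

lemma plus_comm: "\<lbrakk>src T f = src T g; tgt T f = tgt T g\<rbrakk> \<Longrightarrow> f \<boxplus> g = g \<boxplus> f"
  using comm_groupE(4)[OF comm_group_homgrp, of f "src T g" "tgt T g" g] by (simp add: in_Hom)

lemma zero_plus [simp]: "\<lbrakk>src T f = X; tgt T f = Y\<rbrakk> \<Longrightarrow> zero_arr T X Y \<boxplus> f = f"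
  using comm_groupE(5)[OF comm_group_homgrp, of f X Y] by (simp add: in_Hom)

lemma plus_zero [simp]: "\<lbrakk>src T f = X; tgt T f = Y\<rbrakk> \<Longrightarrow> f \<boxplus> zero_arr T X Y = f"
  by (subst plus_comm) simp_all

lemma neg_plus [simp]: "neg_arr T f \<boxplus> f = zero_arr T (src T f) (tgt T f)"
  using group.l_inv[OF comm_group.axioms(2)[OF comm_group_homgrp], of f "src T f" "tgt T f"]
  by (simp add: neg_arr_def in_Hom)

lemma plus_neg [simp]: "f \<boxplus> neg_arr T f = zero_arr T (src T f) (tgt T f)"
  by (subst plus_comm) simp_all

lemma plus_neg_cancel [simp]:
  "\<lbrakk>src T f = src T g; tgt T f = tgt T g\<rbrakk> \<Longrightarrow> (f \<boxplus> g) \<boxplus> neg_arr T g = f"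
  "\<lbrakk>src T f = src T g; tgt T f = tgt T g\<rbrakk> \<Longrightarrow> (f \<boxplus> neg_arr T g) \<boxplus> g = f"
  by (simp_all add: plus_assoc)

lemma plus_right_cancel:
  "\<lbrakk>src T f = src T h; tgt T f = tgt T h; src T g = src T h; tgt T g = tgt T h; f \<boxplus> h = g \<boxplus> h\<rbrakk>
   \<Longrightarrow> f = g"
  by (metis plus_neg_cancel(1))

lemma eq_iff_diff_zero:
  "\<lbrakk>src T f = src T g; tgt T f = tgt T g\<rbrakk>
   \<Longrightarrow> f = g \<longleftrightarrow> f \<boxplus> neg_arr T g = zero_arr T (src T g) (tgt T g)"
  by (metis plus_neg_cancel(2) plus_neg zero_plus)

lemma neg_unique:
  "\<lbrakk>src T f = src T g; tgt T f = tgt T g; f \<boxplus> g = zero_arr T (src T g) (tgt T g)\<rbrakk> \<Longrightarrow> f = neg_arr T g"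
  by (metis plus_neg_cancel(1) src_neg tgt_neg zero_plus)

lemma neg_neg [simp]: "neg_arr T (neg_arr T f) = f"
  by (rule neg_unique[symmetric]) simp_all

lemma neg_zero [simp]: "neg_arr T (zero_arr T X Y) = zero_arr T X Y"
  by (rule neg_unique[symmetric]) simp_all

lemma cmp_plus_left' [simp]:
  "\<lbrakk>src T g = src T h; tgt T g = tgt T h; tgt T f = src T h\<rbrakk> \<Longrightarrow> (g \<boxplus> h) \<cdot> f = (g \<cdot> f) \<boxplus> (h \<cdot> f)"
  using cmp_plus_left[of f "src T f" "src T h" g "tgt T h" h] by (simp add: in_Hom)

lemma cmp_plus_right' [simp]:
  "\<lbrakk>src T f = src T g; tgt T f = tgt T g; tgt T g = src T h\<rbrakk> \<Longrightarrow> h \<cdot> (f \<boxplus> g) = (h \<cdot> f) \<boxplus> (h \<cdot> g)"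
  using cmp_plus_right[of f "src T g" "tgt T g" g h "tgt T h"] by (simp add: in_Hom)

lemma cmp_zero_right [simp]: assumes "src T f = Y" shows "f \<cdot> zero_arr T X Y = zero_arr T X (tgt T f)"
proof -
  have "f \<cdot> zero_arr T X Y \<boxplus> f \<cdot> zero_arr T X Y = f \<cdot> (zero_arr T X Y \<boxplus> zero_arr T X Y)"
    using assms by (subst cmp_plus_right') simp_all
  also have "\<dots> = zero_arr T X (tgt T f) \<boxplus> f \<cdot> zero_arr T X Y"
    using assms by simp
  finally show ?thesis
    using assms by (intro plus_right_cancel[of "f \<cdot> zero_arr T X Y" "f \<cdot> zero_arr T X Y"]) simp_all
qed

lemma cmp_zero_left [simp]: assumes "tgt T f = Y" shows "zero_arr T Y Z \<cdot> f = zero_arr T (src T f) Z"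
proof -
  have "zero_arr T Y Z \<cdot> f \<boxplus> zero_arr T Y Z \<cdot> f = (zero_arr T Y Z \<boxplus> zero_arr T Y Z) \<cdot> f"
    using assms by (subst cmp_plus_left') simp_all
  also have "\<dots> = zero_arr T (src T f) Z \<boxplus> zero_arr T Y Z \<cdot> f"
    using assms by simp
  finally show ?thesis
    using assms by (intro plus_right_cancel[of "zero_arr T Y Z \<cdot> f" "zero_arr T Y Z \<cdot> f"]) simp_all
qed

lemma neg_cmp [simp]: "tgt T f = src T g \<Longrightarrow> neg_arr T g \<cdot> f = neg_arr T (g \<cdot> f)"
  by (rule neg_unique) (simp_all flip: cmp_plus_left')

lemma cmp_neg [simp]: "tgt T f = src T g \<Longrightarrow> g \<cdot> neg_arr T f = neg_arr T (g \<cdot> f)"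
  by (rule neg_unique) (simp_all flip: cmp_plus_right')

lemma neg_eq_zero_iff [simp]: "neg_arr T f = zero_arr T X Y \<longleftrightarrow> f = zero_arr T X Y"
  by (metis neg_neg neg_zero)

lemma neg_eq_iff [simp]: "neg_arr T f = neg_arr T g \<longleftrightarrow> f = g"
  by (metis neg_neg)

lemma is_isoE:
  assumes "is_iso T f"
  obtains g where "src T g = tgt T f" "tgt T g = src T f"
    "g \<cdot> f = ident T (src T f)" "f \<cdot> g = ident T (tgt T f)"
  using assms by (auto simp: is_iso_def in_Hom)

lemma is_isoI:
  "\<lbrakk>src T g = tgt T f; tgt T g = src T f; g \<cdot> f = ident T (src T f); f \<cdot> g = ident T (tgt T f)\<rbrakk>
   \<Longrightarrow> is_iso T f"
  by (auto simp: is_iso_def in_Hom)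

lemma inv_arr_unique:
  assumes "src T g = tgt T f" "tgt T g = src T f" "g \<cdot> f = ident T (src T f)" "f \<cdot> g = ident T (tgt T f)"
  shows "inv_arr T f = g"
  unfolding inv_arr_def
proof (rule the_equality)
  fix g' assume g': "g' \<in> Hom T (tgt T f) (src T f) \<and> g' \<cdot> f = ident T (src T f) \<and> f \<cdot> g' = ident T (tgt T f)"
  then have "g' = g' \<cdot> (f \<cdot> g)" using assms by (simp add: in_Hom)
  also have "\<dots> = (g' \<cdot> f) \<cdot> g" using assms g' by (subst cmp_assoc') (simp_all add: in_Hom)
  also have "\<dots> = g" using assms g' by (simp add: in_Hom del: cmp_assoc')
  finally show "g' = g" .
qed (use assms in \<open>simp add: in_Hom\<close>)

lemma inv_arr:
  assumes "is_iso T f"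
  shows src_inv [simp]: "src T (inv_arr T f) = tgt T f" and tgt_inv [simp]: "tgt T (inv_arr T f) = src T f"
    and inv_cmp [simp]: "inv_arr T f \<cdot> f = ident T (src T f)"
    and cmp_inv [simp]: "f \<cdot> inv_arr T f = ident T (tgt T f)"
proof -
  obtain g where g: "src T g = tgt T f" "tgt T g = src T f"
    "g \<cdot> f = ident T (src T f)" "f \<cdot> g = ident T (tgt T f)"
    using is_isoE[OF assms] by blast
  moreover from g have "inv_arr T f = g" by (rule inv_arr_unique)
  ultimately show "src T (inv_arr T f) = tgt T f" "tgt T (inv_arr T f) = src T f"
    "inv_arr T f \<cdot> f = ident T (src T f)" "f \<cdot> inv_arr T f = ident T (tgt T f)"
    by simp_all
qed

lemma inv_cmp_assoc [simp]:
  "\<lbrakk>is_iso T f; tgt T g = src T f\<rbrakk> \<Longrightarrow> inv_arr T f \<cdot> f \<cdot> g = g"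
  "\<lbrakk>is_iso T f; tgt T g = tgt T f\<rbrakk> \<Longrightarrow> f \<cdot> inv_arr T f \<cdot> g = g"
  by (simp_all flip: cmp_assoc')

lemma iso_left_cancel:
  assumes "is_iso T f" "tgt T g = src T f" "tgt T h = src T f"
  shows "f \<cdot> g = f \<cdot> h \<longleftrightarrow> g = h"
proof
  assume "f \<cdot> g = f \<cdot> h"
  then have "inv_arr T f \<cdot> f \<cdot> g = inv_arr T f \<cdot> f \<cdot> h" by (rule arg_cong)
  then show "g = h" using assms by simp
qed simp

lemma iso_right_cancel:
  assumes "is_iso T f" "src T g = tgt T f" "src T h = tgt T f"
  shows "g \<cdot> f = h \<cdot> f \<longleftrightarrow> g = h"
proof
  assume "g \<cdot> f = h \<cdot> f"
  then have "(g \<cdot> f) \<cdot> inv_arr T f = (h \<cdot> f) \<cdot> inv_arr T f" by (rule arg_cong)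
  then show "g = h" using assms by simp
qed simp

lemma is_iso_ident [simp]: "is_iso T (ident T X)"
  by (rule is_isoI[of "ident T X"]) simp_all

lemma is_iso_inv [simp]: "is_iso T f \<Longrightarrow> is_iso T (inv_arr T f)"
  by (rule is_isoI[of f]) simp_all

lemma is_iso_cmp [simp]:
  "\<lbrakk>is_iso T f; is_iso T g; tgt T f = src T g\<rbrakk> \<Longrightarrow> is_iso T (g \<cdot> f)"
  by (rule is_isoI[of "inv_arr T f \<cdot> inv_arr T g"]) simp_all

lemma is_iso_cmpD:
  assumes "is_iso T (g \<cdot> f)" "is_iso T f" "tgt T f = src T g" shows "is_iso T g"
proof -
  have "is_iso T ((g \<cdot> f) \<cdot> inv_arr T f)" using assms by (intro is_iso_cmp[of "inv_arr T f" "g \<cdot> f"]) simp_all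
  also have "(g \<cdot> f) \<cdot> inv_arr T f = g" using assms by simp
  finally show ?thesis .
qed

lemma iso_cmp_eq_zero:
  assumes "is_iso T f" "tgt T g = src T f" "f \<cdot> g = zero_arr T (src T g) (tgt T f)"
  shows "g = zero_arr T (src T g) (src T f)"
proof -
  have "f \<cdot> g = f \<cdot> zero_arr T (src T g) (src T f)" using assms by simp
  then show ?thesis by (subst (asm) iso_left_cancel) (use assms in simp_all)
qed

lemma isomorphicI: "\<lbrakk>is_iso T f; src T f = X; tgt T f = Y\<rbrakk> \<Longrightarrow> isomorphic T X Y"
  by (auto simp: isomorphic_def in_Hom)

lemma isomorphicE:
  assumes "isomorphic T X Y"
  obtains f where "is_iso T f" "src T f = X" "tgt T f = Y"
  using assms by (auto simp: isomorphic_def in_Hom)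

lemma arr_to_zero: "\<lbrakk>is_zero T Z; tgt T f = Z\<rbrakk> \<Longrightarrow> f = zero_arr T (src T f) Z"
  and arr_from_zero: "\<lbrakk>is_zero T Z; src T f = Z\<rbrakk> \<Longrightarrow> f = zero_arr T Z (tgt T f)"
  unfolding is_zero_def set_eq_iff in_Hom by auto

lemma is_zero_iff: "is_zero T X \<longleftrightarrow> ident T X = zero_arr T X X"
proof
  assume *: "ident T X = zero_arr T X X"
  have "f = zero_arr T X (tgt T f)" if "src T f = X" for f
    using cmp_ident_right[OF that] cmp_zero_right[OF that] * by simp
  moreover have "f = zero_arr T (src T f) X" if "tgt T f = X" for f
    using cmp_ident_left[OF that] cmp_zero_left[OF that] * by simp
  ultimately show "is_zero T X"
    unfolding is_zero_def set_eq_iff in_Hom by auto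
next
  assume "is_zero T X"
  then show "ident T X = zero_arr T X X" using arr_to_zero[of X "ident T X"] by simp
qed

section \<open>Coproducts and biproducts\<close>

lemma coproduct_in: "\<lbrakk>coproduct T I X P \<iota>; i \<in> I\<rbrakk> \<Longrightarrow> src T (\<iota> i) = X i"
  "\<lbrakk>coproduct T I X P \<iota>; i \<in> I\<rbrakk> \<Longrightarrow> tgt T (\<iota> i) = P"
  by (simp_all add: coproduct_def in_Hom)

lemma coproduct_ex:
  assumes "coproduct T I X P \<iota>" "\<And>i. i \<in> I \<Longrightarrow> src T (g i) = X i \<and> tgt T (g i) = Y"
  obtains h where "src T h = P" "tgt T h = Y" "\<And>i. i \<in> I \<Longrightarrow> h \<cdot> \<iota> i = g i"
  using assms unfolding coproduct_def in_Hom by metis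

lemma coproduct_eqI:
  assumes "coproduct T I X P \<iota>" "src T h = P" "src T k = P" "tgt T h = tgt T k"
    "\<And>i. i \<in> I \<Longrightarrow> h \<cdot> \<iota> i = k \<cdot> \<iota> i"
  shows "h = k"
proof -
  have "\<forall>i\<in>I. k \<cdot> \<iota> i \<in> Hom T (X i) (tgt T k)"
    using assms coproduct_in[OF assms(1)] by (simp add: in_Hom)
  then have "\<exists>!h. h \<in> Hom T P (tgt T k) \<and> (\<forall>i\<in>I. h \<cdot> \<iota> i = k \<cdot> \<iota> i)"
    using assms(1) by (simp add: coproduct_def)
  then show ?thesis using assms unfolding in_Hom by blast
qed

text \<open>The purely equational form is preserved by every additive functor, in particular by
  \<open>L\<close>.\<close>

definition biproduct :: "'o \<Rightarrow> 'o \<Rightarrow> 'o \<Rightarrow> 'm \<Rightarrow> 'm \<Rightarrow> 'm \<Rightarrow> 'm \<Rightarrow> bool" where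
  "biproduct A B P i j p q \<longleftrightarrow>
     src T i = A \<and> tgt T i = P \<and> src T j = B \<and> tgt T j = P \<and>
     src T p = P \<and> tgt T p = A \<and> src T q = P \<and> tgt T q = B \<and>
     p \<cdot> i = ident T A \<and> q \<cdot> j = ident T B \<and> p \<cdot> j = zero_arr T B A \<and> q \<cdot> i = zero_arr T A B \<and>
     i \<cdot> p \<boxplus> j \<cdot> q = ident T P"

lemma biproduct_exists: "\<exists>P i j p q. biproduct A B P i j p q"
proof -
  obtain P \<iota> where P: "coproduct T (UNIV :: bool set) (\<lambda>b. if b then A else B) P \<iota>"
    using binary_coproducts by blast
  note \<iota> = coproduct_in[OF P UNIV_I, of True, simplified] coproduct_in[OF P UNIV_I, of False, simplified]
  obtain p where p: "src T p = P" "tgt T p = A" "p \<cdot> \<iota> True = ident T A" "p \<cdot> \<iota> False = zero_arr T B A"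
    by (rule coproduct_ex[OF P, of "\<lambda>b. if b then ident T A else zero_arr T B A" A]) (auto split: if_splits)
  obtain q where q: "src T q = P" "tgt T q = B" "q \<cdot> \<iota> True = zero_arr T A B" "q \<cdot> \<iota> False = ident T B"
    by (rule coproduct_ex[OF P, of "\<lambda>b. if b then zero_arr T A B else ident T B" B]) (auto split: if_splits)
  have "\<iota> True \<cdot> p \<boxplus> \<iota> False \<cdot> q = ident T P"
  proof (rule coproduct_eqI[OF P])
    show "(\<iota> True \<cdot> p \<boxplus> \<iota> False \<cdot> q) \<cdot> \<iota> b = ident T P \<cdot> \<iota> b" if "b \<in> UNIV" for b
      by (cases b) (simp_all add: \<iota> p q)
  qed (simp_all add: \<iota> p q)
  then have "biproduct A B P (\<iota> True) (\<iota> False) p q"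
    using \<iota> p q by (simp add: biproduct_def)
  then show ?thesis by blast
qed

lemma biproduct_arrows:
  assumes "biproduct A B P i j p q"
  shows "src T i = A" "tgt T i = P" "src T j = B" "tgt T j = P"
    "src T p = P" "tgt T p = A" "src T q = P" "tgt T q = B"
    "p \<cdot> i = ident T A" "q \<cdot> j = ident T B" "p \<cdot> j = zero_arr T B A" "q \<cdot> i = zero_arr T A B"
    "i \<cdot> p \<boxplus> j \<cdot> q = ident T P"
  using assms by (simp_all add: biproduct_def)

lemma biproduct_reduce:
  assumes S: "biproduct A B P i j p q"
  shows "tgt T z = A \<Longrightarrow> p \<cdot> i \<cdot> z = z" "tgt T z = B \<Longrightarrow> q \<cdot> j \<cdot> z = z"
    "tgt T z = B \<Longrightarrow> p \<cdot> j \<cdot> z = zero_arr T (src T z) A"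
    "tgt T z = A \<Longrightarrow> q \<cdot> i \<cdot> z = zero_arr T (src T z) B"
  using cmp_reduce[OF biproduct_arrows(9)[OF S], of z] cmp_reduce[OF biproduct_arrows(10)[OF S], of z]
    cmp_reduce[OF biproduct_arrows(11)[OF S], of z] cmp_reduce[OF biproduct_arrows(12)[OF S], of z]
    biproduct_arrows[OF S] by simp_all

end

section \<open>Suspension and exactness of triangles\<close>

context triangulated_category
begin

lemma src_shift [simp]: "src T (shift_arr T f) = shift T (src T f)"
  and tgt_shift [simp]: "tgt T (shift_arr T f) = shift T (tgt T f)"
  using shift_in[of f "src T f" "tgt T f"] by (simp_all add: in_Hom)

lemma shift_arr_ident [simp]: "shift_arr T (ident T X) = ident T (shift T X)"
  by (rule shift_ident)

lemma shift_cmp' [simp]: "tgt T f = src T g \<Longrightarrow> shift_arr T (g \<cdot> f) = shift_arr T g \<cdot> shift_arr T f"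
  using shift_cmp[of f "src T f" "src T g" g "tgt T g"] by (simp add: in_Hom)

lemma shift_plus' [simp]:
  "\<lbrakk>src T f = src T g; tgt T f = tgt T g\<rbrakk> \<Longrightarrow> shift_arr T (f \<boxplus> g) = shift_arr T f \<boxplus> shift_arr T g"
  using shift_plus[of f "src T g" "tgt T g" g] by (simp add: in_Hom)

lemma shift_zero [simp]: "shift_arr T (zero_arr T X Y) = zero_arr T (shift T X) (shift T Y)"
proof -
  let ?z = "shift_arr T (zero_arr T X Y)"
  have "?z \<boxplus> ?z = zero_arr T (shift T X) (shift T Y) \<boxplus> ?z"
    by (simp flip: shift_plus')
  then show ?thesis by (intro plus_right_cancel[of ?z ?z]) simp_all
qed

text \<open>The suspension is bijective on objects and on arrows, so this inverse is strict and no
  comparison isomorphisms enter.\<close>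

definition unshift :: "'a \<Rightarrow> 'a" where "unshift = inv_into UNIV (shift T)"

definition unshift_arr :: "'b \<Rightarrow> 'b" where "unshift_arr = inv_into UNIV (shift_arr T)"

lemma shift_unshift [simp]: "shift T (unshift X) = X" "unshift (shift T X) = X"
  using bij_shift by (simp_all add: unshift_def bij_is_inj bij_is_surj surj_f_inv_f)

lemma shift_arr_unshift [simp]: "shift_arr T (unshift_arr f) = f" "unshift_arr (shift_arr T f) = f"
  using bij_shift_arr by (simp_all add: unshift_arr_def bij_is_inj bij_is_surj surj_f_inv_f)

lemma shift_arr_eq_iff [simp]: "shift_arr T f = shift_arr T g \<longleftrightarrow> f = g"
  by (metis shift_arr_unshift(2))

lemma src_unshift [simp]: "src T (unshift_arr f) = unshift (src T f)"
  and tgt_unshift [simp]: "tgt T (unshift_arr f) = unshift (tgt T f)"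
  by (metis shift_arr_unshift(1) shift_unshift(2) src_shift,
      metis shift_arr_unshift(1) shift_unshift(2) tgt_shift)

lemma unshift_cmp [simp]: "tgt T f = src T g \<Longrightarrow> unshift_arr (g \<cdot> f) = unshift_arr g \<cdot> unshift_arr f"
  by (rule shift_arr_eq_iff[THEN iffD1]) simp

lemma unshift_plus [simp]:
  "\<lbrakk>src T f = src T g; tgt T f = tgt T g\<rbrakk> \<Longrightarrow> unshift_arr (f \<boxplus> g) = unshift_arr f \<boxplus> unshift_arr g"
  by (rule shift_arr_eq_iff[THEN iffD1]) simp

lemma unshift_ident [simp]: "unshift_arr (ident T X) = ident T (unshift X)"
  by (rule shift_arr_eq_iff[THEN iffD1]) simp

lemma unshift_zero [simp]: "unshift_arr (zero_arr T X Y) = zero_arr T (unshift X) (unshift Y)"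
  by (rule shift_arr_eq_iff[THEN iffD1]) simp

lemma shift_arr_eq_zero_iff [simp]:
  "shift_arr T f = zero_arr T (shift T X) (shift T Y) \<longleftrightarrow> f = zero_arr T X Y"
  by (simp flip: shift_zero)

lemma is_zero_shift_iff [simp]: "is_zero T (shift T X) \<longleftrightarrow> is_zero T X"
  by (simp add: is_zero_iff flip: shift_arr_ident)

lemma tri_arrows:
  assumes "(f, g, h) \<in> triangles T"
  shows "src T g = tgt T f" "src T h = tgt T g" "tgt T h = shift T (src T f)"
  using triangle_arrows[OF assms] by simp_all

lemma tri_rotate: "(f, g, h) \<in> triangles T \<Longrightarrow> (g, h, neg_arr T (shift_arr T f)) \<in> triangles T"
  using triangle_rotate[of f "src T f" "tgt T f" g "tgt T g" h] tri_arrows[of f g h]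
  by (simp add: in_Hom)

text \<open>The sign on \<open>h\<close> cancels the one that the rotation axiom puts on the
  suspended arrow.\<close>

lemma tri_unrotate:
  assumes "(f, g, h) \<in> triangles T" shows "(unshift_arr (neg_arr T h), f, g) \<in> triangles T"
  using triangle_rotate[of "unshift_arr (neg_arr T h)" "unshift (tgt T g)" "src T f" f "tgt T f" g]
    tri_arrows[OF assms] assms
  by (simp add: in_Hom)

lemma fibre_exists:
  obtains m k where "(m, f, k) \<in> triangles T"
  using triangle_exists[of f] tri_unrotate by blast

lemma tri_fill:
  assumes "(f, g, h) \<in> triangles T" "(f', g', h') \<in> triangles T"
    "src T a = src T f" "tgt T a = src T f'" "src T b = tgt T f" "tgt T b = tgt T f'" "b \<cdot> f = f' \<cdot> a"
  obtains c where "src T c = tgt T g" "tgt T c = tgt T g'" "c \<cdot> g = g' \<cdot> b" "shift_arr T a \<cdot> h = h' \<cdot> c"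
  using triangle_fill[OF assms(1,2), of a b] assms tri_arrows[OF assms(1)] tri_arrows[OF assms(2)]
  by (auto simp: in_Hom)

text \<open>All exactness properties of a triangle come from comparing it with the triangles
  \<open>X = X \<rightarrow> 0 \<rightarrow> \<Sigma>X\<close> and their rotations.\<close>

lemma tri_cmp_zero:
  assumes "(f, g, h) \<in> triangles T"
  shows "g \<cdot> f = zero_arr T (src T f) (tgt T g)"
proof -
  obtain Z where Z: "is_zero T Z" using zero_object by blast
  let ?X = "src T f"
  note [simp] = tri_arrows[OF assms]
  from triangle_ident[OF Z, of ?X] assms obtain c where
    "src T c = Z" "tgt T c = tgt T g" "c \<cdot> zero_arr T ?X Z = g \<cdot> f"
    by (rule tri_fill[of _ _ _ _ _ _ "ident T ?X" f]) simp_all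
  then show ?thesis by simp
qed

lemma tri_cmp_zero2:
  assumes "(f, g, h) \<in> triangles T"
  shows "h \<cdot> g = zero_arr T (tgt T f) (shift T (src T f))"
  using tri_cmp_zero[OF tri_rotate[OF assms]] tri_arrows[OF assms] by simp

lemma tri_weak_coker:
  assumes tri: "(f, g, h) \<in> triangles T" and x: "src T x = tgt T f" "x \<cdot> f = zero_arr T (src T f) (tgt T x)"
  obtains y where "src T y = tgt T g" "tgt T y = tgt T x" "y \<cdot> g = x"
proof -
  obtain Z where Z: "is_zero T Z" using zero_object by blast
  let ?W = "tgt T x"
  note [simp] = tri_arrows[OF tri]
  have "neg_arr T (shift_arr T (zero_arr T Z ?W)) = zero_arr T (shift T Z) (shift T ?W)" by simp
  \<comment> \<open>Rotating this triangle gives the identity triangle on \<open>?W\<close> whose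
    third term is \<open>shift T Z\<close>, again a zero object.\<close>
  then have tri': "(zero_arr T Z ?W, ident T ?W, zero_arr T ?W (shift T Z)) \<in> triangles T"
    using triangle_ident[of "shift T Z" ?W] Z
      triangle_rotate[of "zero_arr T Z ?W" Z ?W "ident T ?W" ?W "zero_arr T ?W (shift T Z)"]
    by (simp add: in_Hom)
  from tri tri' obtain c where "src T c = tgt T g" "tgt T c = ?W" "c \<cdot> g = ident T ?W \<cdot> x"
    by (rule tri_fill[of _ _ _ _ _ _ "zero_arr T (src T f) Z" x]) (simp_all add: x)
  then show ?thesis using that by (simp add: x)
qed

lemma tri_weak_ker:
  assumes tri: "(f, g, h) \<in> triangles T" and z: "tgt T z = tgt T f" "g \<cdot> z = zero_arr T (src T z) (tgt T g)"
  obtains w where "src T w = src T z" "tgt T w = src T f" "f \<cdot> w = z"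
proof -
  obtain Z where Z: "is_zero T Z" using zero_object by blast
  let ?W = "src T z"
  note [simp] = tri_arrows[OF tri]
  have "(zero_arr T ?W Z, zero_arr T Z (shift T ?W), neg_arr T (ident T (shift T ?W))) \<in> triangles T"
    using tri_rotate[OF triangle_ident[OF Z, of ?W]] by simp
  from this tri_rotate[OF tri] obtain c where
    c: "src T c = shift T ?W" "tgt T c = shift T (src T f)"
      "shift_arr T z \<cdot> neg_arr T (ident T (shift T ?W)) = neg_arr T (shift_arr T f) \<cdot> c"
    by (rule tri_fill[of _ _ _ _ _ _ z "zero_arr T Z (tgt T g)"]) (simp_all add: z)
  have "f \<cdot> unshift_arr c = z"
    by (rule shift_arr_eq_iff[THEN iffD1]) (use c z in simp)
  then show ?thesis using that[of "unshift_arr c"] c by simp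
qed

lemma tri_weak_coker2:
  assumes tri: "(f, g, h) \<in> triangles T" and x: "src T x = tgt T g" "x \<cdot> g = zero_arr T (tgt T f) (tgt T x)"
  obtains y where "src T y = shift T (src T f)" "tgt T y = tgt T x" "y \<cdot> h = x"
  using tri_weak_coker[OF tri_rotate[OF tri], of x] x that tri_arrows[OF tri] by auto

lemma tri_weak_ker2:
  assumes tri: "(f, g, h) \<in> triangles T" and z: "tgt T z = tgt T g" "h \<cdot> z = zero_arr T (src T z) (shift T (src T f))"
  obtains w where "src T w = src T z" "tgt T w = tgt T f" "g \<cdot> w = z"
  using tri_weak_ker[OF tri_rotate[OF tri], of z] z that tri_arrows[OF tri] by auto

lemma tri_weak_ker3:
  assumes tri: "(f, g, h) \<in> triangles T"
    and z: "tgt T z = shift T (src T f)" "shift_arr T f \<cdot> z = zero_arr T (src T z) (shift T (tgt T f))"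
  obtains w where "src T w = src T z" "tgt T w = tgt T g" "h \<cdot> w = z"
  using tri_weak_ker2[OF tri_rotate[OF tri], of z] z that tri_arrows[OF tri] by auto

text \<open>As \<open>g\<close> vanishes, the identity of the target lifts to a right inverse
  \<open>w\<close> of \<open>f\<close>. The difference between \<open>w \<cdot> f\<close> and the
  identity is killed by \<open>f\<close>, so after suspension it factors through the zero
  cone.\<close>

lemma tri_cone_zero_iso:
  assumes tri: "(f, g, h) \<in> triangles T" and z: "is_zero T (tgt T g)"
  shows "is_iso T f"
proof -
  note [simp] = tri_arrows[OF tri]
  have g: "g = zero_arr T (tgt T f) (tgt T g)" using arr_to_zero[OF z, of g] by simp
  have "g \<cdot> ident T (tgt T f) = zero_arr T (tgt T f) (tgt T g)" using g by simp
  then obtain w where w: "src T w = tgt T f" "tgt T w = src T f" "f \<cdot> w = ident T (tgt T f)"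
    using tri_weak_ker[OF tri, of "ident T (tgt T f)"] by auto
  define d where "d = w \<cdot> f \<boxplus> neg_arr T (ident T (src T f))"
  have d: "src T d = src T f" "tgt T d = src T f" using w by (simp_all add: d_def)
  have "f \<cdot> w \<cdot> f = (f \<cdot> w) \<cdot> f" using w by (subst cmp_assoc') simp_all
  then have "f \<cdot> w \<cdot> f = f" using w by simp
  then have "f \<cdot> d = zero_arr T (src T f) (tgt T f)" using w by (simp add: d_def)
  then have "shift_arr T f \<cdot> shift_arr T d = zero_arr T (shift T (src T f)) (shift T (tgt T f))"
    using d by (simp flip: shift_cmp')
  then obtain y where y: "src T y = shift T (src T f)" "tgt T y = tgt T g" "h \<cdot> y = shift_arr T d"
    using tri_weak_ker3[OF tri, of "shift_arr T d"] d by auto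
  have "y = zero_arr T (shift T (src T f)) (tgt T g)" using arr_to_zero[OF z, of y] y by simp
  then have "d = zero_arr T (src T f) (src T f)" using y(3)[symmetric] d by simp
  then have "w \<cdot> f = ident T (src T f)" unfolding d_def using w by (subst eq_iff_diff_zero) simp_all
  then show ?thesis using w by (intro is_isoI[of w]) simp_all
qed

text \<open>Both \<open>g \<cdot> f\<close> and \<open>h \<cdot> g\<close> vanish, so an invertible
  \<open>g\<close> forces \<open>f\<close> and \<open>h\<close> to vanish. The identity of the
  suspended source of \<open>f\<close> is then killed by the suspension of \<open>f\<close> and
  lifts along \<open>h\<close>, hence is zero.\<close>

lemma tri_iso_fibre_zero:
  assumes tri: "(f, g, h) \<in> triangles T" and iso: "is_iso T g"
  shows "is_zero T (src T f)"
proof -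
  note [simp] = tri_arrows[OF tri]
  have "inv_arr T g \<cdot> g \<cdot> f = zero_arr T (src T f) (tgt T f)"
    using tri_cmp_zero[OF tri] iso by simp
  then have f: "f = zero_arr T (src T f) (tgt T f)" using iso by simp
  have "shift_arr T f \<cdot> ident T (shift T (src T f)) = zero_arr T (shift T (src T f)) (shift T (tgt T f))"
    by (simp add: f[symmetric])
  then obtain w where w: "src T w = shift T (src T f)" "tgt T w = tgt T g" "h \<cdot> w = ident T (shift T (src T f))"
    using tri_weak_ker3[OF tri, of "ident T (shift T (src T f))"] by auto
  have "h \<cdot> w = h \<cdot> g \<cdot> inv_arr T g \<cdot> w" using iso w by simp
  also have "\<dots> = (h \<cdot> g) \<cdot> inv_arr T g \<cdot> w" using iso w by (subst cmp_assoc') simp_all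
  also have "\<dots> = zero_arr T (shift T (src T f)) (shift T (src T f))"
    using iso w tri_cmp_zero2[OF tri] by (simp del: cmp_assoc')
  finally have "is_zero T (shift T (src T f))" using w by (simp add: is_zero_iff)
  then show ?thesis by simp
qed

end

section \<open>Coproducts and compact objects\<close>

context additive_category
begin

text \<open>For a coproduct \<open>P\<close> this is the image in Hom(C, P) of the direct sum of the
  groups Hom(C, X i). The inductive form turns compactness into a rule induction without finite
  products over varying supports.\<close>

inductive_set fspan :: "'i set \<Rightarrow> ('i \<Rightarrow> 'm) \<Rightarrow> 'o \<Rightarrow> 'o \<Rightarrow> 'm set"
  for I :: "'i set" and \<iota> :: "'i \<Rightarrow> 'm" and C P :: 'o where
  zero: "zero_arr T C P \<in> fspan I \<iota> C P"
| comp: "\<lbrakk>i \<in> I; src T x = C; tgt T x = src T (\<iota> i)\<rbrakk> \<Longrightarrow> \<iota> i \<cdot> x \<in> fspan I \<iota> C P"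
| plus: "\<lbrakk>x \<in> fspan I \<iota> C P; y \<in> fspan I \<iota> C P\<rbrakk> \<Longrightarrow> x \<boxplus> y \<in> fspan I \<iota> C P"

lemma fspan_arr:
  assumes "x \<in> fspan I \<iota> C P" "coproduct T I X P \<iota>"
  shows "src T x = C" "tgt T x = P"
  using assms by (induction) (simp_all add: coproduct_in)

lemma fspan_cmp:
  assumes "x \<in> fspan I \<iota> C P" "coproduct T I X P \<iota>" "tgt T z = C"
  shows "x \<cdot> z \<in> fspan I \<iota> (src T z) P"
  using assms
proof induction
  case zero
  then show ?case by (simp add: fspan.zero)
next
  case (comp i x)
  then show ?case using fspan.comp[of i I "x \<cdot> z"] by (simp add: coproduct_in)
next
  case (plus x y)
  then show ?case by (simp add: fspan.plus fspan_arr)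
qed

lemma coproduct_proj:
  assumes P: "coproduct T I X P \<iota>"
  obtains \<pi> where "\<And>j. j \<in> I \<Longrightarrow> src T (\<pi> j) = P" "\<And>j. j \<in> I \<Longrightarrow> tgt T (\<pi> j) = X j"
    "\<And>i j. \<lbrakk>i \<in> I; j \<in> I\<rbrakk> \<Longrightarrow> \<pi> j \<cdot> \<iota> i = (if i = j then ident T (X j) else zero_arr T (X i) (X j))"
proof -
  have "\<exists>p. src T p = P \<and> tgt T p = X j \<and>
      (\<forall>i\<in>I. p \<cdot> \<iota> i = (if i = j then ident T (X j) else zero_arr T (X i) (X j)))" for j
    by (rule coproduct_ex[OF P, of "\<lambda>i. if i = j then ident T (X j) else zero_arr T (X i) (X j)" "X j"])
      auto
  then show ?thesis using that by metis
qed

text \<open>The last clause expresses that \<open>e \<cdot> v\<close> is a finite sum of the components \<open>\<iota> i \<cdot> \<pi> i \<cdot> v\<close>.\<close>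

lemma coproduct_projector:
  assumes P: "coproduct T I X P \<iota>" and F: "finite F" "F \<subseteq> I"
    and \<pi>: "\<And>j. j \<in> I \<Longrightarrow> src T (\<pi> j) = P" "\<And>j. j \<in> I \<Longrightarrow> tgt T (\<pi> j) = X j"
    "\<And>i j. \<lbrakk>i \<in> I; j \<in> I\<rbrakk> \<Longrightarrow> \<pi> j \<cdot> \<iota> i = (if i = j then ident T (X j) else zero_arr T (X i) (X j))"
  obtains e where "src T e = P" "tgt T e = P"
    "\<forall>j\<in>I. e \<cdot> \<iota> j = (if j \<in> F then \<iota> j else zero_arr T (X j) P)"
    "\<forall>v Q. tgt T v = P \<longrightarrow> Q (zero_arr T (src T v) P) \<longrightarrow>
       (\<forall>x y. src T x = src T v \<longrightarrow> tgt T x = P \<longrightarrow> src T y = src T v \<longrightarrow> tgt T y = P \<longrightarrow>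
          Q x \<longrightarrow> Q y \<longrightarrow> Q (x \<boxplus> y)) \<longrightarrow>
       (\<forall>i\<in>F. Q (\<iota> i \<cdot> \<pi> i \<cdot> v)) \<longrightarrow> Q (e \<cdot> v)"
proof -
  note \<iota> = coproduct_in[OF P]
  let ?induct = "\<lambda>e F. \<forall>v Q. tgt T v = P \<longrightarrow> Q (zero_arr T (src T v) P) \<longrightarrow>
       (\<forall>x y. src T x = src T v \<longrightarrow> tgt T x = P \<longrightarrow> src T y = src T v \<longrightarrow> tgt T y = P \<longrightarrow>
          Q x \<longrightarrow> Q y \<longrightarrow> Q (x \<boxplus> y)) \<longrightarrow>
       (\<forall>i\<in>F. Q (\<iota> i \<cdot> \<pi> i \<cdot> v)) \<longrightarrow> Q (e \<cdot> v)"
  have "\<exists>e. src T e = P \<and> tgt T e = P \<and>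
    (\<forall>j\<in>I. e \<cdot> \<iota> j = (if j \<in> F then \<iota> j else zero_arr T (X j) P)) \<and> ?induct e F"
    using F
  proof (induction F)
    case empty
    show ?case by (rule exI[of _ "zero_arr T P P"]) (use \<iota> in simp)
  next
    case (insert k F)
    then obtain e where e: "src T e = P" "tgt T e = P"
      "\<forall>j\<in>I. e \<cdot> \<iota> j = (if j \<in> F then \<iota> j else zero_arr T (X j) P)" "?induct e F"
      by auto
    have k: "k \<in> I" "k \<notin> F" using insert by auto
    note [simp] = \<iota>[OF k(1)] \<pi>(1,2)[OF k(1)] e(1,2)
    show ?case
    proof (rule exI[of _ "\<iota> k \<cdot> \<pi> k \<boxplus> e"], intro conjI ballI allI impI)
      show "(\<iota> k \<cdot> \<pi> k \<boxplus> e) \<cdot> \<iota> j = (if j \<in> insert k F then \<iota> j else zero_arr T (X j) P)" if "j \<in> I" for j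
        using that k e(3) \<iota>[OF that] \<pi>(3)[OF that k(1)] by auto
      fix v Q
      assume v: "tgt T v = P" and Q0: "Q (zero_arr T (src T v) P)"
        and Qplus: "\<forall>x y. src T x = src T v \<longrightarrow> tgt T x = P \<longrightarrow> src T y = src T v \<longrightarrow> tgt T y = P \<longrightarrow>
          Q x \<longrightarrow> Q y \<longrightarrow> Q (x \<boxplus> y)"
        and Qcomp: "\<forall>i\<in>insert k F. Q (\<iota> i \<cdot> \<pi> i \<cdot> v)"
      have "Q (e \<cdot> v)" using e(4)[rule_format, of v Q] v Q0 Qplus Qcomp by blast
      then have "Q (\<iota> k \<cdot> \<pi> k \<cdot> v \<boxplus> e \<cdot> v)"
        using Qplus[rule_format, of "\<iota> k \<cdot> \<pi> k \<cdot> v" "e \<cdot> v"] Qcomp v by simp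
      then show "Q ((\<iota> k \<cdot> \<pi> k \<boxplus> e) \<cdot> v)" using v by simp
    qed simp_all
  qed
  then obtain e where e: "src T e = P" "tgt T e = P"
    "\<forall>j\<in>I. e \<cdot> \<iota> j = (if j \<in> F then \<iota> j else zero_arr T (X j) P)" "?induct e F" by blast
  then show ?thesis by (rule that)
qed

text \<open>The support is described by its effect: every endomorphism of \<open>P\<close> that
  fixes the inclusions in \<open>F\<close> fixes \<open>x\<close>. In this form the supports of two
  summands may simply be united.\<close>

lemma fspan_finite_support:
  assumes "x \<in> fspan I \<iota> C P" and P: "coproduct T I X P \<iota>"
  obtains F where "finite F" "F \<subseteq> I"
    "\<And>e. \<lbrakk>src T e = P; tgt T e = P; \<And>j. j \<in> F \<Longrightarrow> e \<cdot> \<iota> j = \<iota> j\<rbrakk> \<Longrightarrow> e \<cdot> x = x"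
proof -
  have "\<exists>F. finite F \<and> F \<subseteq> I \<and> (\<forall>e. src T e = P \<longrightarrow> tgt T e = P \<longrightarrow> (\<forall>j\<in>F. e \<cdot> \<iota> j = \<iota> j) \<longrightarrow> e \<cdot> x = x)"
    using assms(1)
  proof induction
    case zero
    show ?case by (rule exI[of _ "{}"]) auto
  next
    case (comp i x)
    note [simp] = coproduct_in[OF P comp(1)]
    have "e \<cdot> \<iota> i \<cdot> x = \<iota> i \<cdot> x" if "e \<cdot> \<iota> i = \<iota> i" "src T e = P" for e
      using that comp cmp_assoc'[of x "\<iota> i" e] by simp
    then show ?case using comp by (intro exI[of _ "{i}"]) auto
  next
    case (plus x y)
    then obtain F F' where F: "finite F" "F \<subseteq> I"
      "\<forall>e. src T e = P \<longrightarrow> tgt T e = P \<longrightarrow> (\<forall>j\<in>F. e \<cdot> \<iota> j = \<iota> j) \<longrightarrow> e \<cdot> x = x"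
      and F': "finite F'" "F' \<subseteq> I"
      "\<forall>e. src T e = P \<longrightarrow> tgt T e = P \<longrightarrow> (\<forall>j\<in>F'. e \<cdot> \<iota> j = \<iota> j) \<longrightarrow> e \<cdot> y = y"
      by blast
    show ?case
      by (rule exI[of _ "F \<union> F'"]) (use plus F F' fspan_arr[OF plus(1) P] fspan_arr[OF plus(2) P] in auto)
  qed
  then show ?thesis using that by blast
qed

text \<open>The projector onto a finite support of \<open>x\<close> fixes \<open>x\<close>, which is
  therefore the finite sum of its own components.\<close>

lemma fspan_component_induct:
  assumes x: "x \<in> fspan I \<iota> C P" and P: "coproduct T I X P \<iota>"
    and \<pi>: "\<And>j. j \<in> I \<Longrightarrow> src T (\<pi> j) = P" "\<And>j. j \<in> I \<Longrightarrow> tgt T (\<pi> j) = X j"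
    "\<And>i j. \<lbrakk>i \<in> I; j \<in> I\<rbrakk> \<Longrightarrow> \<pi> j \<cdot> \<iota> i = (if i = j then ident T (X j) else zero_arr T (X i) (X j))"
    and zero: "Q (zero_arr T C P)"
    and plus: "\<And>x y. \<lbrakk>src T x = C; tgt T x = P; src T y = C; tgt T y = P; Q x; Q y\<rbrakk> \<Longrightarrow> Q (x \<boxplus> y)"
    and comp: "\<And>i. i \<in> I \<Longrightarrow> Q (\<iota> i \<cdot> \<pi> i \<cdot> x)"
  shows "Q x"
proof -
  note [simp] = fspan_arr[OF x P]
  obtain F where F: "finite F" "F \<subseteq> I"
    "\<And>e. \<lbrakk>src T e = P; tgt T e = P; \<And>j. j \<in> F \<Longrightarrow> e \<cdot> \<iota> j = \<iota> j\<rbrakk> \<Longrightarrow> e \<cdot> x = x"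
    using fspan_finite_support[OF x P] by metis
  obtain e where e: "src T e = P" "tgt T e = P"
    "\<forall>j\<in>I. e \<cdot> \<iota> j = (if j \<in> F then \<iota> j else zero_arr T (X j) P)"
    "\<forall>v Q. tgt T v = P \<longrightarrow> Q (zero_arr T (src T v) P) \<longrightarrow>
       (\<forall>x y. src T x = src T v \<longrightarrow> tgt T x = P \<longrightarrow> src T y = src T v \<longrightarrow> tgt T y = P \<longrightarrow>
          Q x \<longrightarrow> Q y \<longrightarrow> Q (x \<boxplus> y)) \<longrightarrow>
       (\<forall>i\<in>F. Q (\<iota> i \<cdot> \<pi> i \<cdot> v)) \<longrightarrow> Q (e \<cdot> v)"
    by (rule coproduct_projector[OF P F(1,2), of \<pi>, OF \<pi>])
  have "e \<cdot> x = x" using F e by (intro F(3)) auto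
  moreover have "Q (e \<cdot> x)" by (rule e(4)[rule_format]) (use zero plus comp F(2) in auto)
  ultimately show ?thesis by simp
qed

lemma fspan_eq_zero:
  assumes x: "x \<in> fspan I \<iota> C P" and P: "coproduct T I X P \<iota>"
    and \<pi>: "\<And>j. j \<in> I \<Longrightarrow> src T (\<pi> j) = P" "\<And>j. j \<in> I \<Longrightarrow> tgt T (\<pi> j) = X j"
    "\<And>i j. \<lbrakk>i \<in> I; j \<in> I\<rbrakk> \<Longrightarrow> \<pi> j \<cdot> \<iota> i = (if i = j then ident T (X j) else zero_arr T (X i) (X j))"
    and 0: "\<And>i. i \<in> I \<Longrightarrow> \<pi> i \<cdot> x = zero_arr T C (X i)"
  shows "x = zero_arr T C P"
  by (rule fspan_component_induct[OF x P, of \<pi>]) (simp_all add: \<pi> 0 coproduct_in[OF P])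

text \<open>Coproducts are given for index sets inside \<open>U\<close>, whereas the constructions
  below index by arrows or natural numbers; both are linked by a bijection.\<close>

lemma coproduct_reindex:
  assumes g: "bij_betw g J I"
  shows "coproduct T J (\<lambda>j. X (g j)) P (\<lambda>j. \<iota> (g j)) \<longleftrightarrow> coproduct T I X P \<iota>"
proof -
  have ball: "(\<forall>j\<in>J. Q (g j)) \<longleftrightarrow> (\<forall>i\<in>I. Q i)" for Q
    using g by (auto simp: bij_betw_def)
  let ?g = "inv_into J g"
  have inv: "?g (g j) = j" if "j \<in> J" for j using that g by (simp add: bij_betw_def)
  show ?thesis
    unfolding coproduct_def ball
  proof (intro conj_cong refl all_cong1 iffI allI impI)
    fix Y h
    assume all: "\<forall>h. (\<forall>i\<in>I. h i \<in> Hom T (X i) Y) \<longrightarrow> (\<exists>!k. k \<in> Hom T P Y \<and> (\<forall>i\<in>I. k \<cdot> \<iota> i = h i))"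
      and h: "\<forall>j\<in>J. h j \<in> Hom T (X (g j)) Y"
    have "\<forall>i\<in>I. h (?g i) \<in> Hom T (X i) Y" using h inv by (simp flip: ball)
    then have "\<exists>!k. k \<in> Hom T P Y \<and> (\<forall>i\<in>I. k \<cdot> \<iota> i = h (?g i))"
      using all[rule_format, of "\<lambda>i. h (?g i)"] by blast
    then show "\<exists>!k. k \<in> Hom T P Y \<and> (\<forall>j\<in>J. k \<cdot> \<iota> (g j) = h j)" using inv by (simp flip: ball)
  next
    fix Y h
    assume all: "\<forall>h. (\<forall>j\<in>J. h j \<in> Hom T (X (g j)) Y) \<longrightarrow>
        (\<exists>!k. k \<in> Hom T P Y \<and> (\<forall>j\<in>J. k \<cdot> \<iota> (g j) = h j))"
      and h: "\<forall>i\<in>I. h i \<in> Hom T (X i) Y"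
    have "\<forall>j\<in>J. h (g j) \<in> Hom T (X (g j)) Y" using h ball[of "\<lambda>i. h i \<in> Hom T (X i) Y"] by blast
    then have "\<exists>!k. k \<in> Hom T P Y \<and> (\<forall>j\<in>J. k \<cdot> \<iota> (g j) = h (g j))" using all[rule_format, of "\<lambda>j. h (g j)"] by blast
    then show "\<exists>!k. k \<in> Hom T P Y \<and> (\<forall>i\<in>I. k \<cdot> \<iota> i = h i)"
      using ball[of "\<lambda>i. _ \<cdot> \<iota> i = h i"] by simp
  qed (use ball[of "\<lambda>i. \<iota> i \<in> Hom T (X i) P"] in blast)+
qed

lemma coproduct_cong:
  assumes "coproduct T I X P \<iota>" and eq: "\<And>i. i \<in> I \<Longrightarrow> X i = X' i" "\<And>i. i \<in> I \<Longrightarrow> \<iota> i = \<iota>' i"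
  shows "coproduct T I X' P \<iota>'"
proof -
  have "(\<forall>i\<in>I. f i \<in> Hom T (X i) Y) \<longleftrightarrow> (\<forall>i\<in>I. f i \<in> Hom T (X' i) Y)" for f Y
    by (rule ball_cong) (simp_all add: eq)
  moreover have "(\<forall>i\<in>I. h \<cdot> \<iota> i = f i) \<longleftrightarrow> (\<forall>i\<in>I. h \<cdot> \<iota>' i = f i)" for h f
    by (rule ball_cong) (simp_all add: eq)
  moreover have "(\<forall>i\<in>I. \<iota> i \<in> Hom T (X i) P) \<longleftrightarrow> (\<forall>i\<in>I. \<iota>' i \<in> Hom T (X' i) P)"
    by (rule ball_cong) (simp_all add: eq)
  ultimately show ?thesis using assms(1) by (simp add: coproduct_def)
qed

lemma fspan_reindex:
  assumes g: "bij_betw g J I" and P: "coproduct T I X P \<iota>"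
    and x: "x \<in> fspan J (\<lambda>j. \<iota> (g j)) C P"
  shows "x \<in> fspan I \<iota> C P"
  using x
proof induction
  case (comp j x)
  then show ?case using g by (intro fspan.comp) (auto simp: bij_betw_def)
qed (auto intro: fspan.intros)

section \<open>Compactness in terms of finite sums\<close>

lemma compact_obj_imp_fspan:
  assumes C: "compact_obj T U C" and I: "I \<subseteq> U" "I \<prec> U" and P: "coproduct T I X P \<iota>"
    and x: "src T x = C" "tgt T x = P"
  shows "x \<in> fspan I \<iota> C P"
proof -
  interpret G: comm_group "homgrp T C P" by (rule comm_group_homgrp)
  let ?h = "\<lambda>x. finprod (homgrp T C P) (\<lambda>i. \<iota> i \<cdot> x i) {i \<in> I. x i \<noteq> zero_arr T C (X i)}"
  let ?S = "sum_group I (\<lambda>i. homgrp T C (X i))"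
  have "group (homgrp T C (X i))" for i using comm_group_homgrp comm_group.axioms(2) by blast
  then have S: "carrier ?S = {x \<in> \<Pi>\<^sub>E i\<in>I. Hom T C (X i). finite {i \<in> I. x i \<noteq> zero_arr T C (X i)}}"
    using carrier_sum_group[of I "\<lambda>i. homgrp T C (X i)"] by simp
  have "?h \<in> iso ?S (homgrp T C P)" using C I P by (simp add: compact_obj_def)
  then have "?h ` carrier ?S = Hom T C P" by (simp add: iso_def bij_betw_def)
  then obtain a where a: "a \<in> carrier ?S" "x = ?h a" using x by (fastforce simp: in_Hom)
  have "finprod (homgrp T C P) (\<lambda>i. \<iota> i \<cdot> a i) F \<in> fspan I \<iota> C P"
    if "finite F" "F \<subseteq> I" for F
    using that
  proof (induction F)
    case empty
    then show ?case by (simp add: fspan.zero)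
  next
    case (insert k F)
    have "(\<lambda>i. \<iota> i \<cdot> a i) \<in> F \<rightarrow> carrier (homgrp T C P)" "\<iota> k \<cdot> a k \<in> carrier (homgrp T C P)"
      using insert a(1) coproduct_in[OF P] by (auto simp: in_Hom S PiE_iff)
    moreover have "\<iota> k \<cdot> a k \<in> fspan I \<iota> C P"
      using insert a(1) coproduct_in[OF P] by (intro fspan.comp) (auto simp: in_Hom S PiE_iff)
    ultimately show ?case using insert by (simp add: fspan.plus)
  qed
  then show ?thesis using a by (simp add: S)
qed

text \<open>Surjectivity of the comparison map suffices: it is always injective, by the projections of the
  coproduct onto its summands.\<close>

lemma compact_objI:
  assumes span: "\<And>I X P \<iota> x. \<lbrakk>I \<subseteq> U; I \<prec> U; coproduct T I X P \<iota>; src T x = C; tgt T x = P\<rbrakk>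
      \<Longrightarrow> x \<in> fspan I \<iota> C P"
  shows "compact_obj T U C"
  unfolding compact_obj_def
proof (intro allI impI, elim conjE)
  fix I X P \<iota>
  assume I: "I \<subseteq> U" "I \<prec> U" and P: "coproduct T I X P \<iota>"
  interpret G: comm_group "homgrp T C P" by (rule comm_group_homgrp)
  note \<iota> = coproduct_in[OF P]
  let ?h = "\<lambda>x. finprod (homgrp T C P) (\<lambda>i. \<iota> i \<cdot> x i) {i \<in> I. x i \<noteq> zero_arr T C (X i)}"
  let ?S = "sum_group I (\<lambda>i. homgrp T C (X i))"
  have grp: "group (homgrp T C (X i))" for i using comm_group_homgrp comm_group.axioms(2) by blast
  then have S: "carrier ?S = {x \<in> \<Pi>\<^sub>E i\<in>I. Hom T C (X i). finite {i \<in> I. x i \<noteq> zero_arr T C (X i)}}"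
    using carrier_sum_group[of I "\<lambda>i. homgrp T C (X i)"] by simp
  interpret S: group ?S using grp by simp
  have aI: "src T (a i) = C" "tgt T (a i) = X i" if "a \<in> carrier ?S" "i \<in> I" for a i
    using that by (auto simp: S PiE_iff in_Hom)
  have car: "(\<lambda>i. \<iota> i \<cdot> a i) \<in> F \<rightarrow> Hom T C P" if "a \<in> carrier ?S" "F \<subseteq> I" for a F
    using that aI \<iota> by (auto simp: in_Hom)
  have "(\<lambda>x. gfinprod (homgrp T C P) (\<lambda>i. \<iota> i \<cdot> x i) I) \<in> hom ?S (homgrp T C P)"
    by (rule G.hom_group_sum) (use grp \<iota> in \<open>auto simp: hom_def in_Hom\<close>)
  then have hom: "?h \<in> hom ?S (homgrp T C P)"
  proof (rule S.hom_restrict)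
    fix a assume a: "a \<in> carrier ?S"
    \<comment> \<open>The homomorphism \<open>gfinprod\<close> runs over the indices where the
      summand \<open>\<iota> i \<cdot> a i\<close> is non-zero, the comparison map over those where
      \<open>a i\<close> is non-zero. The additional terms of the latter are neutral.\<close>
    let ?F = "{i \<in> I. a i \<noteq> zero_arr T C (X i)}" and ?F' = "{i \<in> I. \<iota> i \<cdot> a i \<noteq> zero_arr T C P}"
    have sub: "?F' \<subseteq> ?F" using \<iota> by auto
    have fin: "finite ?F" using a by (simp add: S)
    then have "finite ?F'" by (rule rev_finite_subset[OF _ sub])
    then have "gfinprod (homgrp T C P) (\<lambda>i. \<iota> i \<cdot> a i) I = finprod (homgrp T C P) (\<lambda>i. \<iota> i \<cdot> a i) ?F'"
      by (simp add: gfinprod_def)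
    also have "\<dots> = ?h a"
      by (rule G.finprod_mono_neutral_cong_left) (use fin sub car[OF a, of ?F] in auto)
    finally show "gfinprod (homgrp T C P) (\<lambda>i. \<iota> i \<cdot> a i) I = ?h a" .
  qed
  obtain \<pi> where \<pi>: "\<And>j. j \<in> I \<Longrightarrow> src T (\<pi> j) = P" "\<And>j. j \<in> I \<Longrightarrow> tgt T (\<pi> j) = X j"
    "\<And>i j. \<lbrakk>i \<in> I; j \<in> I\<rbrakk> \<Longrightarrow> \<pi> j \<cdot> \<iota> i = (if i = j then ident T (X j) else zero_arr T (X i) (X j))"
    using coproduct_proj[OF P] by blast
  have proj: "\<pi> j \<cdot> ?h a = a j" if a: "a \<in> carrier ?S" and j: "j \<in> I" for a j
  proof -
    have "\<pi> j \<cdot> finprod (homgrp T C P) (\<lambda>i. \<iota> i \<cdot> a i) F = (if j \<in> F then a j else zero_arr T C (X j))"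
      if "finite F" "F \<subseteq> I" for F
      using that
    proof (induction F)
      case empty
      then show ?case using \<pi>(1,2)[OF j] by simp
    next
      case (insert k F)
      have k: "k \<in> I" using insert by simp
      have "finprod (homgrp T C P) (\<lambda>i. \<iota> i \<cdot> a i) F \<in> carrier (homgrp T C P)"
        using car[OF a, of F] insert by (intro G.finprod_closed) auto
      moreover have "\<pi> j \<cdot> \<iota> k \<cdot> a k = (if k = j then a j else zero_arr T C (X j))"
        using \<pi>[OF j] \<pi>(3)[OF k j] \<iota>[OF k] aI[OF a k] aI[OF a j] cmp_assoc'[of "a k" "\<iota> k" "\<pi> j", symmetric]
        by (simp add: \<pi> j del: cmp_assoc')
      moreover have "(\<lambda>i. \<iota> i \<cdot> a i) \<in> F \<rightarrow> carrier (homgrp T C P)" "\<iota> k \<cdot> a k \<in> carrier (homgrp T C P)"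
        using insert car[OF a, of F] car[OF a, of "{k}"] by auto
      ultimately show ?case
        using insert \<pi>(1,2)[OF j] aI[OF a j] \<iota>[OF k] aI[OF a k] by (auto simp: in_Hom)
    qed
    from this[of "{i \<in> I. a i \<noteq> zero_arr T C (X i)}"] show ?thesis using a j by (auto simp: S)
  qed
  have "inj_on ?h (carrier ?S)"
  proof (rule inj_onI)
    fix a b assume a: "a \<in> carrier ?S" and b: "b \<in> carrier ?S" and eq: "?h a = ?h b"
    have "a j = b j" if "j \<in> I" for j using proj[OF a that] proj[OF b that] eq by simp
    then show "a = b" using a b by (auto simp: S intro: PiE_ext)
  qed
  moreover have "?h ` carrier ?S = Hom T C P"
  proof
    show "?h ` carrier ?S \<subseteq> Hom T C P" using hom by (auto simp: hom_def)
    have "x \<in> ?h ` carrier ?S" if "x \<in> fspan I \<iota> C P" for x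
      using that
    proof induction
      case zero
      have "?h \<one>\<^bsub>?S\<^esub> = zero_arr T C P"
        using hom_one[OF hom S.group_axioms G.group_axioms] by simp
      then show ?case by (intro image_eqI[OF sym S.one_closed])
    next
      case (comp i x)
      let ?a = "\<lambda>j\<in>I. if j = i then x else zero_arr T C (X j)"
      have supp: "{j \<in> I. ?a j \<noteq> zero_arr T C (X j)} = (if x = zero_arr T C (X i) then {} else {i})"
        using comp by auto
      have "?a \<in> carrier ?S"
        unfolding S using comp \<iota>[OF comp(1)] supp by (simp add: in_Hom)
      moreover have "?h ?a = \<iota> i \<cdot> x"
        unfolding supp using comp \<iota>[OF comp(1)] by (simp add: in_Hom)
      ultimately show ?case by (intro image_eqI[OF sym])
    next
      case (plus x y)
      then obtain a b where a: "a \<in> carrier ?S" "x = ?h a" and b: "b \<in> carrier ?S" "y = ?h b" by blast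
      have "?h (a \<otimes>\<^bsub>?S\<^esub> b) = x \<boxplus> y" using hom_mult[OF hom a(1) b(1)] a b by simp
      then show ?case by (intro image_eqI[OF sym S.m_closed[OF a(1) b(1)]])
    qed
    then show "Hom T C P \<subseteq> ?h ` carrier ?S" using span[OF I P] by (auto simp: in_Hom)
  qed
  ultimately show "?h \<in> iso ?S (homgrp T C P)"
    using hom by (simp add: iso_def bij_betw_def)
qed

end

lemma universe_Union:
  "\<lbrakk>universe U; I \<subseteq> U; I \<prec> U; \<forall>i\<in>I. A i \<subseteq> U \<and> A i \<prec> U\<rbrakk> \<Longrightarrow> (\<Union>i\<in>I. A i) \<prec> U"
  by (simp add: universe_def)

text \<open>The closure axiom speaks of subsets of \<open>U\<close> only. If the union were not
  small, \<open>U\<close> would inject into it, and the preimages of the pieces would cover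
  \<open>U\<close> by a small family of small subsets.\<close>

lemma small_Union:
  fixes F :: "'i \<Rightarrow> 'a set" and U :: "'u set"
  assumes U: "universe U" and I: "I \<prec> U" and F: "\<And>i. i \<in> I \<Longrightarrow> F i \<prec> U"
  shows "(\<Union>i\<in>I. F i) \<prec> U"
proof (rule ccontr)
  assume "\<not> (\<Union>i\<in>I. F i) \<prec> U"
  moreover have "U \<lesssim> (\<Union>i\<in>I. F i) \<or> (\<Union>i\<in>I. F i) \<lesssim> U"
    unfolding lepoll_def card_of_ordLeq by (intro ordLeq_total card_of_Well_order)
  ultimately have "U \<lesssim> (\<Union>i\<in>I. F i)"
    using lepoll_iff_leqpoll eqpoll_sym eqpoll_imp_lepoll by blast
  then obtain e where e: "inj_on e U" "e ` U \<subseteq> (\<Union>i\<in>I. F i)" by (auto simp: lepoll_def)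
  from I obtain g where g: "inj_on g I" "g ` I \<subseteq> U" unfolding lesspoll_def lepoll_def by blast
  let ?A = "\<lambda>u. {x \<in> U. e x \<in> F (inv_into I g u)}"
  have "\<forall>u\<in>g ` I. ?A u \<subseteq> U \<and> ?A u \<prec> U"
  proof safe
    fix i assume i: "i \<in> I"
    have "?A (g i) \<lesssim> F i"
      unfolding lepoll_def using e(1) g(1) i by (intro exI[of _ e]) (auto intro: inj_on_subset)
    then show "?A (g i) \<prec> U" using F[OF i] lesspoll_trans1 by blast
  qed
  moreover have "g ` I \<prec> U" using I g by simp
  ultimately have "(\<Union>u\<in>g ` I. ?A u) \<prec> U" using g(2) by (intro universe_Union[OF U]) auto
  moreover have "(\<Union>u\<in>g ` I. ?A u) = U" using e(2) g(1) by fastforce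
  ultimately show False by simp
qed

section \<open>Closure properties of compact objects\<close>

context triangulated_category
begin

lemma compact_biproduct:
  assumes A: "compact_obj T U A" and B: "compact_obj T U B" and S: "biproduct A B S i j p q"
  shows "compact_obj T U S"
proof (rule compact_objI)
  fix I X P and \<iota> :: "'c \<Rightarrow> 'b" and x
  assume I: "I \<subseteq> U" "I \<prec> U" and P: "coproduct T I X P \<iota>" and x: "src T x = S" "tgt T x = P"
  note [simp] = S[unfolded biproduct_def]
  have "(x \<cdot> i) \<cdot> p \<in> fspan I \<iota> (src T p) P"
    by (rule fspan_cmp[OF compact_obj_imp_fspan[OF A I P] P]) (simp_all add: x)
  moreover have "(x \<cdot> j) \<cdot> q \<in> fspan I \<iota> (src T q) P"
    by (rule fspan_cmp[OF compact_obj_imp_fspan[OF B I P] P]) (simp_all add: x)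
  ultimately have "(x \<cdot> i) \<cdot> p \<boxplus> (x \<cdot> j) \<cdot> q \<in> fspan I \<iota> S P" by (simp add: fspan.plus)
  also have "(x \<cdot> i) \<cdot> p \<boxplus> (x \<cdot> j) \<cdot> q = x \<cdot> (i \<cdot> p \<boxplus> j \<cdot> q)" by (subst cmp_plus_right') (simp_all add: x)
  also have "\<dots> = x" by (simp add: x del: cmp_plus_right')
  finally show "x \<in> fspan I \<iota> S P" .
qed

lemma compact_zero:
  assumes "is_zero T Z" shows "compact_obj T U Z"
proof (rule compact_objI)
  fix I X P and \<iota> :: "'c \<Rightarrow> 'b" and x
  assume "src T x = Z" "tgt T x = P"
  then have "x = zero_arr T Z P" using arr_from_zero[OF assms] by blast
  then show "x \<in> fspan I \<iota> Z P" by (simp add: fspan.zero)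
qed

text \<open>Stated for an abstract automorphism so as to cover the suspension and its inverse at
  once. A coproduct is carried back along \<open>G\<close>, compactness of \<open>C\<close> yields a
  finite sum there, and \<open>F\<close> carries it forward.\<close>

lemma compact_automorphism:
  assumes F: "\<And>f. src T (F f) = Fo (src T f)" "\<And>f. tgt T (F f) = Fo (tgt T f)"
      "\<And>f g. tgt T f = src T g \<Longrightarrow> F (g \<cdot> f) = F g \<cdot> F f"
      "\<And>f g. \<lbrakk>src T f = src T g; tgt T f = tgt T g\<rbrakk> \<Longrightarrow> F (f \<boxplus> g) = F f \<boxplus> F g"
      "\<And>X Y. F (zero_arr T X Y) = zero_arr T (Fo X) (Fo Y)"
    and G: "\<And>f. src T (G f) = Go (src T f)" "\<And>f. tgt T (G f) = Go (tgt T f)"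
      "\<And>f g. tgt T f = src T g \<Longrightarrow> G (g \<cdot> f) = G g \<cdot> G f"
    and inv: "\<And>f. F (G f) = f" "\<And>f. G (F f) = f" "\<And>X. Fo (Go X) = X" "\<And>X. Go (Fo X) = X"
    and C: "compact_obj T U C"
  shows "compact_obj T U (Fo C)"
proof (rule compact_objI)
  fix I X P and \<iota> :: "'c \<Rightarrow> 'b" and x
  assume I: "I \<subseteq> U" "I \<prec> U" and P: "coproduct T I X P \<iota>" and x: "src T x = Fo C" "tgt T x = P"
  note \<iota> = coproduct_in[OF P]
  have P': "coproduct T I (\<lambda>i. Go (X i)) (Go P) (\<lambda>i. G (\<iota> i))"
    unfolding coproduct_def
  proof (intro conjI ballI allI impI)
    show "G (\<iota> i) \<in> Hom T (Go (X i)) (Go P)" if "i \<in> I" for i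
      using that \<iota> by (simp add: in_Hom G)
    fix Y g assume g: "\<forall>i\<in>I. g i \<in> Hom T (Go (X i)) Y"
    obtain h where h: "src T h = P" "tgt T h = Fo Y" "\<And>i. i \<in> I \<Longrightarrow> h \<cdot> \<iota> i = F (g i)"
      by (rule coproduct_ex[OF P, of "\<lambda>i. F (g i)" "Fo Y"]) (use g in \<open>auto simp: in_Hom F inv\<close>)
    show "\<exists>!h. h \<in> Hom T (Go P) Y \<and> (\<forall>i\<in>I. h \<cdot> G (\<iota> i) = g i)"
    proof (rule ex1I[of _ "G h"])
      show "G h \<in> Hom T (Go P) Y \<and> (\<forall>i\<in>I. G h \<cdot> G (\<iota> i) = g i)"
        using h \<iota> by (simp add: in_Hom G(1,2) inv flip: G(3))
      fix k assume k: "k \<in> Hom T (Go P) Y \<and> (\<forall>i\<in>I. k \<cdot> G (\<iota> i) = g i)"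
      have "F k = h"
      proof (rule coproduct_eqI[OF P])
        fix i assume i: "i \<in> I"
        have "F (k \<cdot> G (\<iota> i)) = F k \<cdot> \<iota> i"
          using k i \<iota> by (subst F(3)) (simp_all add: in_Hom G inv)
        then show "F k \<cdot> \<iota> i = h \<cdot> \<iota> i" using h i k by simp
      qed (use k h in \<open>auto simp: in_Hom F inv\<close>)
      then show "k = G h" using inv by auto
    qed
  qed
  have "F y \<in> fspan I \<iota> (Fo C) P" if "y \<in> fspan I (\<lambda>i. G (\<iota> i)) C (Go P)" for y
    using that
  proof induction
    case zero
    show ?case by (simp add: F inv fspan.zero)
  next
    case (comp i x)
    then show ?case using fspan.comp[of i I "F x" "Fo C" \<iota> P] by (simp add: F G inv)
  next
    case (plus x y)
    then show ?case by (simp add: F fspan.plus fspan_arr[OF _ P'])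
  qed
  moreover have "G x \<in> fspan I (\<lambda>i. G (\<iota> i)) C (Go P)"
    by (rule compact_obj_imp_fspan[OF C I P']) (use x in \<open>simp_all add: G inv\<close>)
  ultimately have "F (G x) \<in> fspan I \<iota> (Fo C) P" by blast
  then show "x \<in> fspan I \<iota> (Fo C) P" by (simp add: inv)
qed

lemma compact_shift: "compact_obj T U C \<Longrightarrow> compact_obj T U (shift T C)"
  by (rule compact_automorphism[of "shift_arr T" "shift T" unshift_arr unshift]) simp_all

lemma compact_unshift: "compact_obj T U C \<Longrightarrow> compact_obj T U (unshift C)"
  by (rule compact_automorphism[of unshift_arr unshift "shift_arr T" "shift T"]) simp_all

text \<open>The arrow \<open>x - e x\<close>, with \<open>e\<close> the projector onto the summands that occur in \<open>x g\<close>, vanishes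
  on the middle term of the triangle and so factors through the shifted first one.\<close>

lemma compact_cone:
  assumes tri: "(f, g, h) \<in> triangles T" and A: "compact_obj T U (src T f)" and B: "compact_obj T U (tgt T f)"
  shows "compact_obj T U (tgt T g)"
proof (rule compact_objI)
  fix I X P and \<iota> :: "'c \<Rightarrow> 'b" and x
  assume I: "I \<subseteq> U" "I \<prec> U" and P: "coproduct T I X P \<iota>" and x: "src T x = tgt T g" "tgt T x = P"
  note [simp] = tri_arrows[OF tri]
  note \<iota> = coproduct_in[OF P]
  have xg: "x \<cdot> g \<in> fspan I \<iota> (tgt T f) P" by (rule compact_obj_imp_fspan[OF B I P]) (simp_all add: x)
  obtain F where F: "finite F" "F \<subseteq> I"
    "\<And>e. \<lbrakk>src T e = P; tgt T e = P; \<And>j. j \<in> F \<Longrightarrow> e \<cdot> \<iota> j = \<iota> j\<rbrakk> \<Longrightarrow> e \<cdot> x \<cdot> g = x \<cdot> g"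
    using fspan_finite_support[OF xg P] by metis
  obtain \<pi> where \<pi>: "\<And>j. j \<in> I \<Longrightarrow> src T (\<pi> j) = P" "\<And>j. j \<in> I \<Longrightarrow> tgt T (\<pi> j) = X j"
    "\<And>i j. \<lbrakk>i \<in> I; j \<in> I\<rbrakk> \<Longrightarrow> \<pi> j \<cdot> \<iota> i = (if i = j then ident T (X j) else zero_arr T (X i) (X j))"
    using coproduct_proj[OF P] by blast
  obtain e where e: "src T e = P" "tgt T e = P"
    "\<forall>j\<in>I. e \<cdot> \<iota> j = (if j \<in> F then \<iota> j else zero_arr T (X j) P)"
    "\<forall>v Q. tgt T v = P \<longrightarrow> Q (zero_arr T (src T v) P) \<longrightarrow>
       (\<forall>x y. src T x = src T v \<longrightarrow> tgt T x = P \<longrightarrow> src T y = src T v \<longrightarrow> tgt T y = P \<longrightarrow>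
          Q x \<longrightarrow> Q y \<longrightarrow> Q (x \<boxplus> y)) \<longrightarrow>
       (\<forall>i\<in>F. Q (\<iota> i \<cdot> \<pi> i \<cdot> v)) \<longrightarrow> Q (e \<cdot> v)"
    by (rule coproduct_projector[OF P F(1,2), of \<pi>, OF \<pi>])
  have exg: "e \<cdot> x \<cdot> g = x \<cdot> g" using F e by (intro F(3)) auto
  let ?d = "x \<boxplus> neg_arr T (e \<cdot> x)"
  have "?d \<cdot> g = zero_arr T (tgt T f) (tgt T ?d)" using exg x e by simp
  then obtain z where z: "src T z = shift T (src T f)" "tgt T z = P" "z \<cdot> h = ?d"
    using tri_weak_coker2[OF tri, of ?d] x e by auto
  have "z \<in> fspan I \<iota> (shift T (src T f)) P"
    by (rule compact_obj_imp_fspan[OF compact_shift[OF A] I P]) (use z in simp_all)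
  from fspan_cmp[OF this P, of h] have "?d \<in> fspan I \<iota> (tgt T g) P" using z by simp
  moreover have "e \<cdot> x \<in> fspan I \<iota> (tgt T g) P"
    by (rule e(4)[rule_format]) (use x F(2) \<pi> \<iota> in \<open>auto intro!: fspan.intros\<close>)
  ultimately have "?d \<boxplus> e \<cdot> x \<in> fspan I \<iota> (tgt T g) P" by (rule fspan.plus)
  then show "x \<in> fspan I \<iota> (tgt T g) P" using x e by simp
qed

lemma compact_fibre:
  assumes tri: "(f, g, h) \<in> triangles T" and B: "compact_obj T U (tgt T f)" and C: "compact_obj T U (tgt T g)"
  shows "compact_obj T U (src T f)"
proof -
  have "compact_obj T U (shift T (src T f))"
    using compact_cone[OF tri_rotate[OF tri]] B C tri_arrows[OF tri] by simp
  then show ?thesis using compact_unshift by fastforce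
qed

end

section \<open>Generation by compact objects\<close>

context big_tt_category
begin

abbreviation K :: "'a set" where "K \<equiv> compacts T U"

section \<open>Small index sets\<close>

lemma small_bij:
  assumes "A \<prec> U"
  obtains J g where "J \<subseteq> U" "J \<prec> U" "bij_betw g J A"
proof -
  from assms obtain k where k: "inj_on k A" "k ` A \<subseteq> U" unfolding lesspoll_def lepoll_def by blast
  then have "bij_betw (inv_into A k) (k ` A) A" by (simp add: bij_betw_def inj_on_inv_into)
  moreover have "k ` A \<prec> U" using assms k by simp
  ultimately show ?thesis using that k by blast
qed

lemma small_coproduct_exists:
  assumes "A \<prec> U"
  obtains P \<iota> where "coproduct T A X P \<iota>"
proof -
  obtain J g where J: "J \<subseteq> U" "J \<prec> U" "bij_betw g J A" using small_bij[OF assms] by blast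
  obtain P \<iota> where P: "coproduct T J (\<lambda>j. X (g j)) P \<iota>" using small_coproducts[OF J(1,2)] by blast
  have g': "bij_betw (inv_into J g) A J" using J(3) by (rule bij_betw_inv_into)
  have "coproduct T A (\<lambda>a. X (g (inv_into J g a))) P (\<lambda>a. \<iota> (inv_into J g a))"
    using P by (subst coproduct_reindex[OF g'])
  then have "coproduct T A X P (\<lambda>a. \<iota> (inv_into J g a))"
    by (rule coproduct_cong) (use J(3) in \<open>simp_all add: bij_betw_inv_into_right\<close>)
  then show ?thesis using that by blast
qed

lemma compact_fspan:
  assumes C: "C \<in> K" and A: "A \<prec> U" and P: "coproduct T A X P \<iota>" and x: "src T x = C" "tgt T x = P"
  shows "x \<in> fspan A \<iota> C P"
proof -
  obtain J g where J: "J \<subseteq> U" "J \<prec> U" "bij_betw g J A" using small_bij[OF A] by blast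
  have "x \<in> fspan J (\<lambda>j. \<iota> (g j)) C P"
    by (rule compact_obj_imp_fspan[where U = U and X = "\<lambda>j. X (g j)"])
      (use C J coproduct_reindex[OF J(3)] P x in \<open>simp_all add: compacts_def\<close>)
  then show ?thesis by (rule fspan_reindex[OF J(3) P])
qed

lemma nat_small: "(UNIV :: nat set) \<prec> U"
  using universe by (simp add: universe_def)

lemma small_arrows:
  assumes "G \<prec> U" shows "{f. src T f \<in> G \<and> tgt T f = X} \<prec> U"
proof -
  have "{f. src T f \<in> G \<and> tgt T f = X} = (\<Union>C\<in>G. Hom T C X)" by (auto simp: in_Hom)
  then show ?thesis using small_Union[OF universe assms, of "\<lambda>C. Hom T C X"] small_homs by simp
qed

lemma small_arrows2:
  assumes "G \<prec> U" shows "{f. src T f \<in> G \<and> tgt T f \<in> G} \<prec> U"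
proof -
  have "{f. src T f \<in> G \<and> tgt T f \<in> G} = (\<Union>X\<in>G. {f. src T f \<in> G \<and> tgt T f = X})" by auto
  then show ?thesis by (simp only:) (rule small_Union[OF universe assms small_arrows[OF assms]])
qed

lemma small_subset: "\<lbrakk>B \<prec> U; A \<subseteq> B\<rbrakk> \<Longrightarrow> A \<prec> U"
  using lesspoll_trans1 subset_imp_lepoll by blast

text \<open>The mapping telescope: a compact object maps to it through one of the finite stages, because
  \<open>1 - shift\<close> is injective on \<open>Hom(C, \<Oplus>W\<^sub>n)\<close>.\<close>

lemma telescope:
  fixes W :: "nat \<Rightarrow> 'a" and w :: "nat \<Rightarrow> 'b"
  assumes w: "\<And>n. src T (w n) = W n" "\<And>n. tgt T (w n) = W (Suc n)"
  obtains P \<iota> s t u where "coproduct T UNIV W P \<iota>" "src T s = P" "tgt T s = P" "(s, t, u) \<in> triangles T"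
    "\<forall>n. s \<cdot> \<iota> n = \<iota> n \<boxplus> neg_arr T (\<iota> (Suc n) \<cdot> w n)"
    "\<forall>x. src T x \<in> K \<and> tgt T x = tgt T t \<longrightarrow> (\<exists>n z. src T z = src T x \<and> tgt T z = W n \<and> x = t \<cdot> \<iota> n \<cdot> z)"
proof -
  obtain P \<iota> where P: "coproduct T UNIV W P \<iota>" using small_coproduct_exists[OF nat_small] by blast
  note [simp] = w coproduct_in[OF P UNIV_I]
  obtain s where s: "src T s = P" "tgt T s = P" "\<And>n. s \<cdot> \<iota> n = \<iota> n \<boxplus> neg_arr T (\<iota> (Suc n) \<cdot> w n)"
    using coproduct_ex[OF P, of "\<lambda>n. \<iota> n \<boxplus> neg_arr T (\<iota> (Suc n) \<cdot> w n)" P] by auto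
  obtain t u where tri: "(s, t, u) \<in> triangles T" using triangle_exists by blast
  note [simp] = s(1,2) tri_arrows[OF tri]
  obtain \<pi> where \<pi>: "\<And>j. src T (\<pi> j) = P" "\<And>j. tgt T (\<pi> j) = W j"
    "\<And>i j. \<pi> j \<cdot> \<iota> i = (if i = j then ident T (W j) else zero_arr T (W i) (W j))"
    using coproduct_proj[OF P] by (metis UNIV_I)
  have \<pi>w: "\<pi> j \<cdot> \<iota> i \<cdot> z = (if i = j then z else zero_arr T (src T z) (W j))" if "tgt T z = W i" for i j z
    using that \<pi> cmp_reduce[OF \<pi>(3)[of j i], where z = z] by simp
  have \<pi>0: "\<pi> 0 \<cdot> s = \<pi> 0"
    by (rule coproduct_eqI[OF P]) (simp_all add: \<pi> s(3) \<pi>w)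
  have \<pi>S: "\<pi> (Suc m) \<cdot> s = \<pi> (Suc m) \<boxplus> neg_arr T (w m \<cdot> \<pi> m)" for m
    by (rule coproduct_eqI[OF P]) (auto simp: \<pi> s(3) \<pi>w)
  \<comment> \<open>If \<open>s\<close> kills \<open>y\<close>, the component of \<open>y\<close> at
    0 vanishes by \<open>\<pi>0\<close>, and by \<open>\<pi>S\<close> each later component is the
    image under \<open>w m\<close> of the previous one.\<close>
  have inj: "y = zero_arr T C P" if y: "y \<in> fspan UNIV \<iota> C P" and sy: "s \<cdot> y = zero_arr T C P" for y C
  proof -
    note [simp] = fspan_arr[OF y P]
    have "\<pi> n \<cdot> y = zero_arr T C (W n)" for n
    proof (induction n)
      case 0
      show ?case using cmp_reduce[OF \<pi>0, where z = y] \<pi> sy by simp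
    next
      case (Suc m)
      have "\<pi> (Suc m) \<cdot> s \<cdot> y = \<pi> (Suc m) \<cdot> y \<boxplus> neg_arr T (w m \<cdot> \<pi> m \<cdot> y)"
        using cmp_reduce[OF \<pi>S, where z = y] \<pi> by simp
      then show ?case using sy Suc \<pi> by simp
    qed
    then show ?thesis using fspan_eq_zero[OF y P, of \<pi>] \<pi> by auto
  qed
  have t\<iota>: "t \<cdot> \<iota> n \<cdot> z = t \<cdot> \<iota> (Suc n) \<cdot> w n \<cdot> z" if z: "tgt T z = W n" for n z
  proof -
    have "t \<cdot> s \<cdot> \<iota> n \<cdot> z = zero_arr T (src T z) (tgt T t)"
      using cmp_reduce[OF tri_cmp_zero[OF tri], where z = "\<iota> n \<cdot> z"] z by simp
    moreover have "s \<cdot> \<iota> n \<cdot> z = \<iota> n \<cdot> z \<boxplus> neg_arr T (\<iota> (Suc n) \<cdot> w n \<cdot> z)"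
      using cmp_reduce[OF s(3), where z = z] z by simp
    ultimately show ?thesis using z by (subst eq_iff_diff_zero) simp_all
  qed
  \<comment> \<open>Elements at stages \<open>n\<close> and \<open>m\<close> are added at stage
    \<open>n + m\<close>, which avoids a case distinction on the larger one.\<close>
  have push: "\<exists>z'. src T z' = src T z \<and> tgt T z' = W (n + k) \<and> t \<cdot> \<iota> n \<cdot> z = t \<cdot> \<iota> (n + k) \<cdot> z'"
    if "tgt T z = W n" for n k z
  proof (induction k)
    case 0
    then show ?case using that by auto
  next
    case (Suc k)
    then obtain z' where z': "src T z' = src T z" "tgt T z' = W (n + k)" "t \<cdot> \<iota> n \<cdot> z = t \<cdot> \<iota> (n + k) \<cdot> z'"
      by blast
    then show ?case using t\<iota>[OF z'(2)] by (intro exI[of _ "w (n + k) \<cdot> z'"]) simp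
  qed
  have stage: "\<exists>n z. src T z = C \<and> tgt T z = W n \<and> t \<cdot> y = t \<cdot> \<iota> n \<cdot> z" if "y \<in> fspan UNIV \<iota> C P" for y C
    using that
  proof induction
    case zero
    show ?case by (intro exI[of _ 0] exI[of _ "zero_arr T C (W 0)"]) simp
  next
    case (comp i x)
    then show ?case by (intro exI[of _ i] exI[of _ x]) simp
  next
    case (plus x y)
    then obtain n z m z' where z: "src T z = C" "tgt T z = W n" "t \<cdot> x = t \<cdot> \<iota> n \<cdot> z"
      and z': "src T z' = C" "tgt T z' = W m" "t \<cdot> y = t \<cdot> \<iota> m \<cdot> z'" by blast
    obtain v where v: "src T v = C" "tgt T v = W (n + m)" "t \<cdot> x = t \<cdot> \<iota> (n + m) \<cdot> v"
      using push[OF z(2), of m] z by auto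
    obtain v' where v': "src T v' = C" "tgt T v' = W (n + m)" "t \<cdot> y = t \<cdot> \<iota> (n + m) \<cdot> v'"
      using push[OF z'(2), of n] z' by (auto simp: add.commute)
    show ?case
      by (intro exI[of _ "n + m"] exI[of _ "v \<boxplus> v'"])
        (use v v' fspan_arr[OF plus(1) P] fspan_arr[OF plus(2) P] in simp)
  qed
  have "\<exists>n z. src T z = src T x \<and> tgt T z = W n \<and> x = t \<cdot> \<iota> n \<cdot> z"
    if x: "src T x \<in> K" "tgt T x = tgt T t" for x
  proof -
    have C: "unshift (src T x) \<in> K" using x(1) compact_unshift by (simp add: compacts_def)
    \<comment> \<open>The desuspension of \<open>u \<cdot> x\<close> is killed by \<open>s\<close>
      and so vanishes. Hence \<open>x\<close> comes from the coproduct \<open>P\<close>, where only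
      finitely many stages are involved.\<close>
    let ?y = "unshift_arr (u \<cdot> x)"
    have y: "src T ?y = unshift (src T x)" "tgt T ?y = P" using x by simp_all
    have "shift_arr T s \<cdot> u = zero_arr T (tgt T t) (shift T P)"
      using tri_cmp_zero2[OF tri_rotate[OF tri]] by simp
    then have "shift_arr T s \<cdot> u \<cdot> x = zero_arr T (src T x) (shift T P)"
      using cmp_reduce[of "shift_arr T s" u _ x] x by simp
    then have "shift_arr T (s \<cdot> ?y) = shift_arr T (zero_arr T (unshift (src T x)) P)" using x y by simp
    then have "s \<cdot> ?y = zero_arr T (unshift (src T x)) P" by (simp only: shift_arr_eq_iff)
    moreover have "?y \<in> fspan UNIV \<iota> (unshift (src T x)) P" by (rule compact_fspan[OF C nat_small P y])
    ultimately have "?y = zero_arr T (unshift (src T x)) P" using inj by blast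
    then have "shift_arr T ?y = shift_arr T (zero_arr T (unshift (src T x)) P)" by (rule arg_cong)
    then have "u \<cdot> x = zero_arr T (src T x) (shift T P)" by (simp del: unshift_cmp)
    then obtain y' where y': "src T y' = src T x" "tgt T y' = P" "t \<cdot> y' = x"
      using tri_weak_ker2[OF tri, of x] x by auto
    have "y' \<in> fspan UNIV \<iota> (src T x) P" by (rule compact_fspan[OF x(1) nat_small P y'(1,2)])
    then show ?thesis using stage y' by metis
  qed
  with P s tri show ?thesis using that by blast
qed

lemma coproduct_closed_small:
  assumes closed: "\<And>I X P \<iota>. \<lbrakk>I \<subseteq> U; I \<prec> U; coproduct T I X P \<iota>; \<And>i. i \<in> I \<Longrightarrow> Q (X i)\<rbrakk> \<Longrightarrow> Q P"
    and A: "A \<prec> U" "coproduct T A X P \<iota>" "\<And>a. a \<in> A \<Longrightarrow> Q (X a)"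
  shows "Q P"
proof -
  obtain J g where J: "J \<subseteq> U" "J \<prec> U" "bij_betw g J A" using small_bij[OF A(1)] by blast
  have "coproduct T J (\<lambda>j. X (g j)) P (\<lambda>j. \<iota> (g j))" using A(2) by (subst coproduct_reindex[OF J(3)])
  then show ?thesis by (rule closed[OF J(1,2)]) (use A(3) J(3) in \<open>auto simp: bij_betw_def\<close>)
qed

text \<open>\<open>X\<close> is rebuilt as a telescope over itself. Stage 0 is a coproduct of
  compact objects through which every arrow from a compact object to \<open>X\<close> factors; each
  step cones off the arrows from compact objects that die in \<open>X\<close>. Arrows from compact
  objects see finite stages only, so the telescope and \<open>X\<close> agree on them, and
  generation makes the comparison \<open>q\<close> invertible.\<close>

theorem localising_induct:
  assumes compact: "\<And>C. C \<in> K \<Longrightarrow> Q C"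
    and iso: "\<And>X Y. \<lbrakk>isomorphic T X Y; Q X\<rbrakk> \<Longrightarrow> Q Y"
    and cone: "\<And>f g h. \<lbrakk>(f, g, h) \<in> triangles T; Q (src T f); Q (tgt T f)\<rbrakk> \<Longrightarrow> Q (tgt T g)"
    and coprod: "\<And>I X P \<iota>. \<lbrakk>I \<subseteq> U; I \<prec> U; coproduct T I X P \<iota>; \<And>i. i \<in> I \<Longrightarrow> Q (X i)\<rbrakk> \<Longrightarrow> Q P"
  shows "Q X"
proof -
  obtain G where G: "G \<prec> U" "G \<subseteq> K" "\<And>C. C \<in> K \<Longrightarrow> \<exists>C'\<in>G. isomorphic T C C'"
    using compacts_essentially_small by blast
  \<comment> \<open>The arrows from all compact objects need not form a small set; those from the
    representatives in \<open>G\<close> do, and every other one differs from such an arrow by an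
    isomorphism.\<close>
  have via_G: "\<exists>i d. is_iso T i \<and> src T i = src T c \<and> src T d \<in> G \<and> tgt T i = src T d \<and> tgt T d = tgt T c \<and> d \<cdot> i = c"
    if c: "src T c \<in> K" for c
  proof -
    obtain i where i: "is_iso T i" "src T i = src T c" "tgt T i \<in> G"
      using G(3)[OF c] by (auto elim!: isomorphicE)
    then show ?thesis by (intro exI[of _ i] exI[of _ "c \<cdot> inv_arr T i"]) simp
  qed
  \<comment> \<open>Surjectivity is demanded at stage 0 only, since a lift there already maps to the
    telescope. \<open>S\<close> says that the transition arrow kills every arrow from a compact
    object that \<open>p\<close> kills.\<close>
  define R where "R n p \<longleftrightarrow> tgt T p = X \<and> Q (src T p) \<and>
      (n = (0::nat) \<longrightarrow> (\<forall>c. src T c \<in> K \<and> tgt T c = X \<longrightarrow>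
         (\<exists>d. src T d = src T c \<and> tgt T d = src T p \<and> p \<cdot> d = c)))" for n p
  define S where "S p p' \<longleftrightarrow> (\<exists>w. src T w = src T p \<and> tgt T w = src T p' \<and> p' \<cdot> w = p \<and>
      (\<forall>c. src T c \<in> K \<and> tgt T c = src T p \<and> p \<cdot> c = zero_arr T (src T c) X \<longrightarrow>
         w \<cdot> c = zero_arr T (src T c) (tgt T w)))" for p p'
  have "\<exists>p. \<forall>n. R n (p n) \<and> S (p n) (p (Suc n))"
  proof (rule dependent_nat_choice)
    let ?A = "{c. src T c \<in> G \<and> tgt T c = X}"
    obtain P \<iota> where P: "coproduct T ?A (src T) P \<iota>"
      using small_coproduct_exists[OF small_arrows[OF G(1)]] by blast
    note \<iota> = coproduct_in[OF P]
    have QP: "Q P"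
      by (rule coproduct_closed_small[OF coprod small_arrows[OF G(1)] P]) (use G(2) compact in auto)
    obtain p where p: "src T p = P" "tgt T p = X" "\<And>c. c \<in> ?A \<Longrightarrow> p \<cdot> \<iota> c = c"
      by (rule coproduct_ex[OF P, of "\<lambda>c. c" X]) auto
    have "\<exists>d. src T d = src T c \<and> tgt T d = src T p \<and> p \<cdot> d = c" if c: "src T c \<in> K" "tgt T c = X" for c
    proof -
      obtain i d where d: "is_iso T i" "src T i = src T c" "src T d \<in> G" "tgt T i = src T d"
        "tgt T d = tgt T c" "d \<cdot> i = c"
        using via_G[OF c(1)] by blast
      then have "d \<in> ?A" using c by simp
      then show ?thesis using d p \<iota>[of d] cmp_reduce[OF p(3)[of d], where z = i]
        by (intro exI[of _ "\<iota> d \<cdot> i"]) simp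
    qed
    then show "\<exists>p. R 0 p" using p QP by (auto simp: R_def)
  next
    fix p n assume "R n p"
    then have p: "tgt T p = X" "Q (src T p)" by (simp_all add: R_def)
    let ?A = "{c. src T c \<in> G \<and> tgt T c = src T p \<and> p \<cdot> c = zero_arr T (src T c) X}"
    have small: "?A \<prec> U" by (rule small_subset[OF small_arrows[OF G(1), of "src T p"]]) auto
    obtain P \<iota> where P: "coproduct T ?A (src T) P \<iota>"
      using small_coproduct_exists[OF small] by blast
    note \<iota> = coproduct_in[OF P]
    have QP: "Q P"
      by (rule coproduct_closed_small[OF coprod small P]) (use G(2) compact in auto)
    obtain k where k: "src T k = P" "tgt T k = src T p" "\<And>c. c \<in> ?A \<Longrightarrow> k \<cdot> \<iota> c = c"
      by (rule coproduct_ex[OF P, of "\<lambda>c. c" "src T p"]) auto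
    obtain w z where tri: "(k, w, z) \<in> triangles T" using triangle_exists by blast
    note [simp] = tri_arrows[OF tri] k(1,2) p(1)
    have "p \<cdot> k = zero_arr T P X"
      by (rule coproduct_eqI[OF P]) (use \<iota> k(3) in auto)
    then obtain p' where p': "src T p' = tgt T w" "tgt T p' = X" "p' \<cdot> w = p"
      using tri_weak_coker[OF tri, of p] by auto
    have "w \<cdot> c = zero_arr T (src T c) (tgt T w)"
      if c: "src T c \<in> K" "tgt T c = src T p" "p \<cdot> c = zero_arr T (src T c) X" for c
    proof -
      obtain i d where d: "is_iso T i" "src T i = src T c" "src T d \<in> G" "tgt T i = src T d"
        "tgt T d = tgt T c" "d \<cdot> i = c"
        using via_G[OF c(1)] by blast
      have "c \<cdot> inv_arr T i = d" by (subst d(6)[symmetric]) (use d(1-5) in simp)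
      then have "p \<cdot> d = zero_arr T (src T d) X"
        using cmp_reduce[OF c(3), where z = "inv_arr T i"] c d by simp
      then have dA: "d \<in> ?A" using c d by simp
      have "w \<cdot> c = (w \<cdot> k) \<cdot> \<iota> d \<cdot> i" using k(3)[OF dA] d \<iota>[OF dA] cmp_reduce[OF k(3)[OF dA], where z = i] by simp
      also have "\<dots> = zero_arr T (src T c) (tgt T w)"
        using \<iota>[OF dA] d by (subst tri_cmp_zero[OF tri]) simp
      finally show ?thesis .
    qed
    then have "S p p'" unfolding S_def using p' by (intro exI[of _ w]) simp
    moreover have "Q (src T p')" using cone[OF tri] QP p p' by simp
    ultimately show "\<exists>p'. R (Suc n) p' \<and> S p p'" using p' by (auto simp: R_def)
  qed
  then obtain p where R: "\<And>n. R n (p n)" and S: "\<And>n. S (p n) (p (Suc n))" by blast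
  have p [simp]: "tgt T (p n) = X" and Qp: "Q (src T (p n))" for n using R by (simp_all add: R_def)
  have "\<exists>w. \<forall>n. src T (w n) = src T (p n) \<and> tgt T (w n) = src T (p (Suc n)) \<and> p (Suc n) \<cdot> w n = p n \<and>
      (\<forall>c. src T c \<in> K \<and> tgt T c = src T (p n) \<and> p n \<cdot> c = zero_arr T (src T c) X \<longrightarrow>
         w n \<cdot> c = zero_arr T (src T c) (tgt T (w n)))"
    using S unfolding S_def by (rule choice[OF allI])
  then obtain w where w_all: "\<forall>n. src T (w n) = src T (p n) \<and> tgt T (w n) = src T (p (Suc n)) \<and> p (Suc n) \<cdot> w n = p n \<and>
      (\<forall>c. src T c \<in> K \<and> tgt T c = src T (p n) \<and> p n \<cdot> c = zero_arr T (src T c) X \<longrightarrow>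
         w n \<cdot> c = zero_arr T (src T c) (tgt T (w n)))" by blast
  then have w [simp]: "src T (w n) = src T (p n)" "tgt T (w n) = src T (p (Suc n))" "p (Suc n) \<cdot> w n = p n" for n
    by blast+
  have wc: "w n \<cdot> c = zero_arr T (src T c) (src T (p (Suc n)))"
    if "src T c \<in> K" "tgt T c = src T (p n)" "p n \<cdot> c = zero_arr T (src T c) X" for n c
    using w_all that by (metis w(2))
  obtain P \<iota> s t u where P: "coproduct T UNIV (\<lambda>n. src T (p n)) P \<iota>" and s: "src T s = P" "tgt T s = P"
    and tri: "(s, t, u) \<in> triangles T"
    and s\<iota>_all: "\<forall>n. s \<cdot> \<iota> n = \<iota> n \<boxplus> neg_arr T (\<iota> (Suc n) \<cdot> w n)"
    and stage_all: "\<forall>x. src T x \<in> K \<and> tgt T x = tgt T t \<longrightarrow>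
        (\<exists>n z. src T z = src T x \<and> tgt T z = src T (p n) \<and> x = t \<cdot> \<iota> n \<cdot> z)"
    by (rule telescope[of w "\<lambda>n. src T (p n)", OF w(1,2)])
  note s\<iota> = s\<iota>_all[rule_format] and stage = stage_all[rule_format, OF conjI]
  note [simp] = s tri_arrows[OF tri] coproduct_in[OF P UNIV_I]
  have "Q P"
    by (rule coproduct_closed_small[where Q = Q, OF _ nat_small P]) (use coprod Qp in blast)+
  then have QH: "Q (tgt T t)" using cone[OF tri] by simp
  obtain r where r [simp]: "src T r = P" "tgt T r = X" "\<And>n. r \<cdot> \<iota> n = p n"
    by (rule coproduct_ex[OF P, of p X]) auto
  have "r \<cdot> s = zero_arr T P X"
  proof (rule coproduct_eqI[OF P])
    show "(r \<cdot> s) \<cdot> \<iota> n = zero_arr T P X \<cdot> \<iota> n" for n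
      using cmp_reduce[OF r(3)[of "Suc n"], where z = "w n"] by (simp add: s\<iota>)
  qed simp_all
  then obtain q where q [simp]: "src T q = tgt T t" "tgt T q = X" and qt: "q \<cdot> t = r"
    using tri_weak_coker[OF tri, of r] by auto
  have q\<iota>: "q \<cdot> t \<cdot> \<iota> n \<cdot> z = p n \<cdot> z" if "tgt T z = src T (p n)" for n z
    using that cmp_reduce[OF qt, where z = "\<iota> n \<cdot> z"] cmp_reduce[OF r(3)[of n], where z = z] by simp
  \<comment> \<open>An arrow into the telescope lives at some stage \<open>n\<close>. If
    \<open>q\<close> kills it, then so does \<open>p n\<close>, and the next transition arrow makes
    it zero.\<close>
  have inj: "x = zero_arr T (src T x) (tgt T t)"
    if x: "src T x \<in> K" "tgt T x = tgt T t" "q \<cdot> x = zero_arr T (src T x) X" for x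
  proof -
    obtain n z where z: "src T z = src T x" "tgt T z = src T (p n)" "t \<cdot> \<iota> n \<cdot> z = x"
      using stage[of x] x by metis
    have "p n \<cdot> z = zero_arr T (src T x) X" using x(3) q\<iota>[OF z(2)] by (simp add: z(3))
    then have wz: "w n \<cdot> z = zero_arr T (src T z) (src T (p (Suc n)))" using wc z x by simp
    have "zero_arr T (src T z) (tgt T t) = t \<cdot> s \<cdot> \<iota> n \<cdot> z"
      using cmp_reduce[OF tri_cmp_zero[OF tri], where z = "\<iota> n \<cdot> z"] z by simp
    also have "s \<cdot> \<iota> n \<cdot> z = \<iota> n \<cdot> z \<boxplus> neg_arr T (\<iota> (Suc n) \<cdot> w n \<cdot> z)"
      using cmp_reduce[OF s\<iota>, where z = z] z(2) by simp
    also have "t \<cdot> \<dots> = x" using z wz by simp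
    finally show ?thesis using z(1) by simp
  qed
  have surj: "\<exists>d. src T d = src T c \<and> tgt T d = tgt T t \<and> q \<cdot> d = c"
    if c: "src T c \<in> K" "tgt T c = X" for c
  proof -
    obtain d where d: "src T d = src T c" "tgt T d = src T (p 0)" "p 0 \<cdot> d = c"
      using R[of 0] c by (auto simp: R_def)
    then show ?thesis using q\<iota>[OF d(2)] by (intro exI[of _ "t \<cdot> \<iota> 0 \<cdot> d"]) simp
  qed
  obtain v k where tri': "(q, v, k) \<in> triangles T" using triangle_exists by blast
  note [simp] = tri_arrows[OF tri']
  \<comment> \<open>Injectivity is applied to the desuspended boundary of \<open>x\<close>, which
    lets \<open>x\<close> lift to \<open>X\<close>; surjectivity then shows that the lift dies in
    the cone.\<close>
  have "is_zero T (tgt T v)"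
  proof (rule compacts_generate)
    fix C assume C: "C \<in> compacts T U"
    have "x = zero_arr T C (tgt T v)" if x: "src T x = C" "tgt T x = tgt T v" for x
    proof -
      let ?y = "unshift_arr (k \<cdot> x)"
      have y: "src T ?y = unshift C" "tgt T ?y = tgt T t" using x by simp_all
      have "shift_arr T q \<cdot> k = zero_arr T (tgt T v) (shift T X)"
        using tri_cmp_zero2[OF tri_rotate[OF tri']] by simp
      then have "shift_arr T q \<cdot> k \<cdot> x = zero_arr T C (shift T X)"
        using cmp_reduce[of "shift_arr T q" k _ x] x by simp
      then have "shift_arr T (q \<cdot> ?y) = shift_arr T (zero_arr T (unshift C) X)" using x y by simp
      then have "q \<cdot> ?y = zero_arr T (unshift C) X" by (simp only: shift_arr_eq_iff)
      moreover have "unshift C \<in> K" using C compact_unshift by (simp add: compacts_def)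
      ultimately have "?y = zero_arr T (unshift C) (tgt T t)" using inj[of ?y] y by simp
      then have "shift_arr T ?y = shift_arr T (zero_arr T (unshift C) (tgt T t))" by (rule arg_cong)
      then have "k \<cdot> x = zero_arr T C (shift T (tgt T t))" by (simp del: unshift_cmp)
      then obtain x' where x': "src T x' = C" "tgt T x' = X" "v \<cdot> x' = x"
        using tri_weak_ker2[OF tri', of x] x by auto
      obtain d where "src T d = C" "tgt T d = tgt T t" "q \<cdot> d = x'" using surj[of x'] x' C by auto
      then show ?thesis using cmp_reduce[OF tri_cmp_zero[OF tri'], where z = d] x' by simp
    qed
    then show "Hom T C (tgt T v) = {zero_arr T C (tgt T v)}" by (auto simp: in_Hom)
  qed
  then have "is_iso T q" by (rule tri_cone_zero_iso[OF tri'])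
  then show ?thesis by (rule iso[OF isomorphicI QH]) (rule q)+
qed

section \<open>Compact objects in triangles\<close>

lemma K_shift [simp]: "C \<in> K \<Longrightarrow> shift T C \<in> K" and K_unshift [simp]: "C \<in> K \<Longrightarrow> unshift C \<in> K"
  by (simp_all add: compacts_def compact_shift compact_unshift)

lemma K_cone: "\<lbrakk>(f, g, h) \<in> triangles T; src T f \<in> K; tgt T f \<in> K\<rbrakk> \<Longrightarrow> tgt T g \<in> K"
  and K_fibre: "\<lbrakk>(f, g, h) \<in> triangles T; tgt T f \<in> K; tgt T g \<in> K\<rbrakk> \<Longrightarrow> src T f \<in> K"
  by (simp_all add: compacts_def compact_cone compact_fibre)

lemma compact_biproduct_exists:
  assumes "A \<in> K" "B \<in> K"
  obtains S i j p q where "biproduct A B S i j p q" "S \<in> K"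
proof -
  obtain S i j p q where S: "biproduct A B S i j p q" using biproduct_exists by blast
  moreover have "S \<in> K" using compact_biproduct[OF _ _ S] assms by (simp add: compacts_def)
  ultimately show ?thesis by (rule that)
qed

text \<open>The corner is the cone of the difference of \<open>b\<close> and \<open>g\<close> into
  the biproduct of their targets. A cone is only a weak cokernel, so the induced arrow
  \<open>h\<close> exists without being unique.\<close>

lemma compact_weak_pushout:
  assumes K: "src T b \<in> K" "tgt T b \<in> K" "tgt T g \<in> K" and bg: "src T b = src T g"
  obtains j k where "src T j = tgt T b" "src T k = tgt T g" "tgt T j \<in> K" "tgt T k = tgt T j" "j \<cdot> b = k \<cdot> g"
    "\<forall>c e. src T c = tgt T b \<and> src T e = tgt T g \<and> tgt T c = tgt T e \<and> c \<cdot> b = e \<cdot> g \<longrightarrow>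
       (\<exists>h. src T h = tgt T j \<and> tgt T h = tgt T e \<and> h \<cdot> j = c \<and> h \<cdot> k = e)"
proof -
  obtain S i i' p q where S: "biproduct (tgt T b) (tgt T g) S i i' p q" and SK: "S \<in> K"
    using compact_biproduct_exists[OF K(2,3)] by blast
  note [simp] = biproduct_arrows(1-12)[OF S] biproduct_reduce[OF S] bg
  let ?m = "i \<cdot> b \<boxplus> neg_arr T (i' \<cdot> g)"
  obtain w z where tri: "(?m, w, z) \<in> triangles T" using triangle_exists by blast
  have w: "src T w = S" using tri_arrows(1)[OF tri] by simp
  have wK: "tgt T w \<in> K"
    using K_cone[OF tri] K SK by simp
  have "w \<cdot> ?m = zero_arr T (src T g) (tgt T w)" using tri_cmp_zero[OF tri] by simp
  then have eq: "w \<cdot> i \<cdot> b = w \<cdot> i' \<cdot> g" using w by (subst eq_iff_diff_zero) simp_all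
  have univ: "\<exists>h. src T h = tgt T w \<and> tgt T h = tgt T e \<and> h \<cdot> w \<cdot> i = c \<and> h \<cdot> w \<cdot> i' = e"
    if ce: "src T c = tgt T b" "src T e = tgt T g" "tgt T c = tgt T e" "c \<cdot> b = e \<cdot> g" for c e
  proof -
    let ?v = "c \<cdot> p \<boxplus> e \<cdot> q"
    have "?v \<cdot> ?m = zero_arr T (src T ?m) (tgt T ?v)" using ce by simp
    then obtain h where h: "src T h = tgt T w" "tgt T h = tgt T e" "h \<cdot> w = ?v"
      using tri_weak_coker[OF tri, of ?v] ce w by auto
    have "h \<cdot> w \<cdot> i = c" "h \<cdot> w \<cdot> i' = e"
      using cmp_reduce[OF h(3), of i] cmp_reduce[OF h(3), of i'] ce h w by simp_all
    then show ?thesis using h by blast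
  qed
  show ?thesis by (rule that[of "w \<cdot> i" "w \<cdot> i'"]) (use w wK eq univ in simp_all)
qed

end

section \<open>Smashing localisations\<close>

locale smashing_tt_category = big_tt_category +
  fixes L :: "('a, 'b) endofunctor" and \<eta> :: "'a \<Rightarrow> 'b"
  assumes smashing: "smashing_localisation T U L \<eta>"
begin

abbreviation LO :: "'a \<Rightarrow> 'a" where "LO \<equiv> on_obj L"
abbreviation LA :: "'b \<Rightarrow> 'b" where "LA \<equiv> on_arr L"

lemma localisation: "localisation T L \<eta>" and exact: "exact_functor T L"
  using smashing unfolding smashing_localisation_def localisation_def by blast+

lemma L_coproduct:
  "\<lbrakk>I \<subseteq> U; I \<prec> U; coproduct T I X P \<iota>\<rbrakk> \<Longrightarrow> coproduct T I (\<lambda>i. LO (X i)) (LO P) (\<lambda>i. LA (\<iota> i))"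
  using smashing by (simp add: smashing_localisation_def)

lemma L_arr_in: "\<forall>X Y. \<forall>f \<in> Hom T X Y. LA f \<in> Hom T (LO X) (LO Y)"
  and L_ident [simp]: "LA (ident T X) = ident T (LO X)"
  and L_cmp_all: "\<forall>X Y Z. \<forall>f \<in> Hom T X Y. \<forall>g \<in> Hom T Y Z. LA (g \<cdot> f) = LA g \<cdot> LA f"
  and L_plus_all: "\<forall>X Y. \<forall>f \<in> Hom T X Y. \<forall>g \<in> Hom T X Y. LA (f \<boxplus> g) = LA f \<boxplus> LA g"
  using exact unfolding exact_functor_def by blast+

lemma src_L [simp]: "src T (LA f) = LO (src T f)" and tgt_L [simp]: "tgt T (LA f) = LO (tgt T f)"
  using L_arr_in[rule_format, of f "src T f" "tgt T f"] by (simp_all add: in_Hom)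

lemma L_cmp [simp]: "tgt T f = src T g \<Longrightarrow> LA (g \<cdot> f) = LA g \<cdot> LA f"
  using L_cmp_all[rule_format, of f "src T f" "src T g" g "tgt T g"] by (simp add: in_Hom)

lemma L_plus [simp]: "\<lbrakk>src T f = src T g; tgt T f = tgt T g\<rbrakk> \<Longrightarrow> LA (f \<boxplus> g) = LA f \<boxplus> LA g"
  using L_plus_all[rule_format, of f "src T g" "tgt T g" g] by (simp add: in_Hom)

lemma L_zero [simp]: "LA (zero_arr T X Y) = zero_arr T (LO X) (LO Y)"
proof -
  let ?z = "LA (zero_arr T X Y)"
  have "?z \<boxplus> ?z = zero_arr T (LO X) (LO Y) \<boxplus> ?z"
    by (simp flip: L_plus)
  then show ?thesis by (intro plus_right_cancel[of ?z ?z]) simp_all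
qed

lemma L_shift:
  obtains \<psi> where "\<And>X. src T (\<psi> X) = LO (shift T X)" "\<And>X. tgt T (\<psi> X) = shift T (LO X)"
    "\<And>X. is_iso T (\<psi> X)"
    "\<And>f. \<psi> (tgt T f) \<cdot> LA (shift_arr T f) = shift_arr T (LA f) \<cdot> \<psi> (src T f)"
    "\<And>f g h. (f, g, h) \<in> triangles T \<Longrightarrow> (LA f, LA g, \<psi> (src T f) \<cdot> LA h) \<in> triangles T"
proof -
  let ?P = "\<lambda>\<psi>. (\<forall>X. \<psi> X \<in> Hom T (LO (shift T X)) (shift T (LO X)) \<and> is_iso T (\<psi> X)) \<and>
        (\<forall>X Y. \<forall>f \<in> Hom T X Y. \<psi> Y \<cdot> LA (shift_arr T f) = shift_arr T (LA f) \<cdot> \<psi> X) \<and>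
        (\<forall>f g h. (f, g, h) \<in> triangles T \<longrightarrow> (LA f, LA g, \<psi> (src T f) \<cdot> LA h) \<in> triangles T)"
  have "\<exists>\<psi>. ?P \<psi>" using exact unfolding exact_functor_def by (elim conjE)
  then obtain \<psi> where "?P \<psi>" ..
  then show ?thesis using that[of \<psi>] by (simp add: Hom_def)
qed

lemma L_triangle:
  assumes "(f, g, h) \<in> triangles T"
  obtains k where "(LA f, LA g, k) \<in> triangles T"
  using L_shift assms by metis

lemma L_weak_ker:
  assumes "(f, g, h) \<in> triangles T" "tgt T z = LO (tgt T f)" "LA g \<cdot> z = zero_arr T (src T z) (LO (tgt T g))"
  obtains w where "src T w = src T z" "tgt T w = LO (src T f)" "LA f \<cdot> w = z"
proof -
  obtain k where "(LA f, LA g, k) \<in> triangles T" using L_triangle[OF assms(1)] .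
  from tri_weak_ker[OF this, of z] show ?thesis using assms that by auto
qed

lemma L_shift_zero:
  assumes "LA f = zero_arr T (LO (src T f)) (LO (tgt T f))"
  shows "LA (shift_arr T f) = zero_arr T (LO (shift T (src T f))) (LO (shift T (tgt T f)))"
proof -
  obtain \<psi> where \<psi>: "\<And>X. src T (\<psi> X) = LO (shift T X)" "\<And>X. tgt T (\<psi> X) = shift T (LO X)"
    "\<And>X. is_iso T (\<psi> X)"
    "\<And>f. \<psi> (tgt T f) \<cdot> LA (shift_arr T f) = shift_arr T (LA f) \<cdot> \<psi> (src T f)"
    using L_shift by metis
  have "\<psi> (tgt T f) \<cdot> LA (shift_arr T f) = zero_arr T (LO (shift T (src T f))) (shift T (LO (tgt T f)))"
    using \<psi>(1,2) by (simp add: \<psi>(4) assms)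
  then show ?thesis using iso_cmp_eq_zero[OF \<psi>(3)[of "tgt T f"], of "LA (shift_arr T f)"] \<psi>(1,2) by simp
qed

lemma src_eta [simp]: "src T (\<eta> X) = X" and tgt_eta [simp]: "tgt T (\<eta> X) = LO X"
  and L_eta_iso [simp]: "is_iso T (LA (\<eta> X))" and L_eta: "LA (\<eta> X) = \<eta> (LO X)"
  using localisation unfolding localisation_def in_Hom by blast+

lemma eta_natural: "\<eta> (tgt T f) \<cdot> f = LA f \<cdot> \<eta> (src T f)"
  using localisation unfolding localisation_def Hom_def by blast

lemma acyclic_tensor: "is_zero T (LO Y) \<Longrightarrow> is_zero T (LO (X \<boxtimes> Y))"
  using localisation unfolding localisation_def by blast

lemma eta_L_iso [simp]: "is_iso T (\<eta> (LO X))"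
  by (simp flip: L_eta)

section \<open>Acyclic and local objects\<close>

lemma fibre_acyclic:
  assumes "(m, \<eta> X, k) \<in> triangles T" shows "is_zero T (LO (src T m))"
proof -
  obtain k' where "(LA m, LA (\<eta> X), k') \<in> triangles T" using L_triangle[OF assms] .
  from tri_iso_fibre_zero[OF this] show ?thesis by simp
qed

text \<open>One direction is naturality of \<open>\<eta>\<close>. For the other, apply
  \<open>L\<close> and cancel the invertible image of \<open>\<eta>\<close>.\<close>

lemma L_zero_iff:
  "LA f = zero_arr T (LO (src T f)) (LO (tgt T f)) \<longleftrightarrow> \<eta> (tgt T f) \<cdot> f = zero_arr T (src T f) (LO (tgt T f))"
proof
  assume "\<eta> (tgt T f) \<cdot> f = zero_arr T (src T f) (LO (tgt T f))"
  then have "LA (\<eta> (tgt T f) \<cdot> f) = LA (zero_arr T (src T f) (LO (tgt T f)))" by (rule arg_cong)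
  then have "LA (\<eta> (tgt T f)) \<cdot> LA f = zero_arr T (LO (src T f)) (LO (LO (tgt T f)))" by simp
  then show "LA f = zero_arr T (LO (src T f)) (LO (tgt T f))"
    using iso_cmp_eq_zero[OF L_eta_iso, of "LA f" "tgt T f"] by simp
qed (simp add: eta_natural)

lemma local_kills:
  assumes f: "LA f = zero_arr T (LO (src T f)) (LO (tgt T f))" and X: "is_iso T (\<eta> (tgt T h))"
    and h: "src T h = tgt T f"
  shows "h \<cdot> f = zero_arr T (src T f) (tgt T h)"
proof -
  have "\<eta> (tgt T h) \<cdot> h \<cdot> f = LA (h \<cdot> f) \<cdot> \<eta> (src T f)" using eta_natural[of "h \<cdot> f"] h by simp
  also have "\<dots> = zero_arr T (src T f) (LO (tgt T h))" using f h by simp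
  finally show ?thesis using iso_cmp_eq_zero[OF X, of "h \<cdot> f"] h by simp
qed

lemma L_zero_factor:
  assumes "is_zero T (LO V)" "src T g = V" "tgt T f = V"
  shows "LA (g \<cdot> f) = zero_arr T (LO (src T f)) (LO (tgt T g))"
proof -
  have "LA f = zero_arr T (LO (src T f)) (LO V)" using arr_to_zero[OF assms(1), of "LA f"] assms by simp
  then show ?thesis using assms by simp
qed

text \<open>\<open>Hom(C\<^sub>0, L-)\<close> is a homological functor preserving coproducts, so its value at \<open>X\<close> is the colimit
  of its values at compact objects over \<open>X\<close>: \<open>lift_prop\<close> says that every element comes from
  such an object, \<open>kill_prop\<close> that an element becoming zero at \<open>X\<close> does so at a compact stage.\<close>

definition liftable :: "'a \<Rightarrow> 'b \<Rightarrow> bool" where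
  "liftable X x \<longleftrightarrow> tgt T x = LO X \<and>
     (\<exists>c y. src T c \<in> K \<and> tgt T c = X \<and> src T y = src T x \<and> tgt T y = LO (src T c) \<and> LA c \<cdot> y = x)"

definition killable :: "'b \<Rightarrow> 'b \<Rightarrow> bool" where
  "killable y c \<longleftrightarrow> (\<exists>f c'. src T f = src T c \<and> tgt T f \<in> K \<and> src T c' = tgt T f \<and> tgt T c' = tgt T c \<and>
     c' \<cdot> f = c \<and> LA f \<cdot> y = zero_arr T (src T y) (LO (tgt T f)))"

definition lift_prop :: "'a \<Rightarrow> bool" where
  "lift_prop X \<longleftrightarrow> (\<forall>x. src T x \<in> K \<and> tgt T x = LO X \<longrightarrow> liftable X x)"

definition kill_prop :: "'a \<Rightarrow> bool" where
  "kill_prop X \<longleftrightarrow> (\<forall>c y. src T c \<in> K \<and> tgt T c = X \<and> src T y \<in> K \<and> tgt T y = LO (src T c) \<and>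
     LA c \<cdot> y = zero_arr T (src T y) (LO X) \<longrightarrow> killable y c)"

section \<open>Liftable and killable elements\<close>

lemma liftableI:
  "\<lbrakk>src T c \<in> K; tgt T c = X; tgt T y = LO (src T c)\<rbrakk> \<Longrightarrow> liftable X (LA c \<cdot> y)"
  unfolding liftable_def by (intro conjI exI[of _ c] exI[of _ y]) simp_all

lemma liftableE:
  assumes "liftable X x"
  obtains c y where "src T c \<in> K" "tgt T c = X" "src T y = src T x" "tgt T y = LO (src T c)" "LA c \<cdot> y = x"
  using assms unfolding liftable_def by blast

lemma compact_zero_object: obtains Z where "is_zero T Z" "Z \<in> K"
  using zero_object compact_zero by (auto simp: compacts_def)

lemma liftable_zero: "liftable X (zero_arr T C (LO X))"
proof -
  obtain Z where Z: "is_zero T Z" "Z \<in> K" using compact_zero_object .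
  show ?thesis using liftableI[of "zero_arr T Z X" X "zero_arr T C (LO Z)"] Z by simp
qed

text \<open>Over the biproduct of the two compact sources both elements are defined at once and can
  be added there.\<close>

lemma liftable_plus:
  assumes "liftable X x" "liftable X x'" and src: "src T x = src T x'"
  shows "liftable X (x \<boxplus> x')"
proof -
  obtain c y where c: "src T c \<in> K" "tgt T c = X" "src T y = src T x" "tgt T y = LO (src T c)" "LA c \<cdot> y = x"
    using assms(1) by (rule liftableE)
  obtain c' y' where c': "src T c' \<in> K" "tgt T c' = X" "src T y' = src T x'" "tgt T y' = LO (src T c')" "LA c' \<cdot> y' = x'"
    using assms(2) by (rule liftableE)
  obtain S i j p q where S: "biproduct (src T c) (src T c') S i j p q" and SK: "S \<in> K"
    using compact_biproduct_exists[OF c(1) c'(1)] .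
  note [simp] = biproduct_arrows(1-12)[OF S]
  have LS: "LA p \<cdot> LA i \<cdot> z = z" "LA q \<cdot> LA i \<cdot> z = zero_arr T (src T z) (LO (src T c'))"
    if "tgt T z = LO (src T c)" for z
    using that by (simp_all flip: cmp_assoc' L_cmp)
  have LS': "LA q \<cdot> LA j \<cdot> z = z" "LA p \<cdot> LA j \<cdot> z = zero_arr T (src T z) (LO (src T c))"
    if "tgt T z = LO (src T c')" for z
    using that by (simp_all flip: cmp_assoc' L_cmp)
  have "LA (c \<cdot> p \<boxplus> c' \<cdot> q) \<cdot> (LA i \<cdot> y \<boxplus> LA j \<cdot> y') = x \<boxplus> x'"
    using c(2-5) c'(2-5) src assms(1,2) by (simp add: LS LS' liftable_def)
  moreover have "liftable X (LA (c \<cdot> p \<boxplus> c' \<cdot> q) \<cdot> (LA i \<cdot> y \<boxplus> LA j \<cdot> y'))"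
    by (rule liftableI) (use c(2-4) c'(2-4) src SK in simp_all)
  ultimately show ?thesis by simp
qed

lemma liftable_post:
  assumes "liftable X x" "src T g = X" shows "liftable (tgt T g) (LA g \<cdot> x)"
proof -
  obtain c y where c: "src T c \<in> K" "tgt T c = X" "src T y = src T x" "tgt T y = LO (src T c)" "LA c \<cdot> y = x"
    using assms(1) by (rule liftableE)
  have "liftable (tgt T g) (LA (g \<cdot> c) \<cdot> y)" by (rule liftableI) (use c(1-4) assms(2) in simp_all)
  then show ?thesis using c assms(2) by simp
qed

lemma killableI:
  "\<lbrakk>tgt T f \<in> K; src T c' = tgt T f; LA f \<cdot> y = zero_arr T (src T y) (LO (tgt T f))\<rbrakk> \<Longrightarrow> killable y (c' \<cdot> f)"
  unfolding killable_def by (intro exI[of _ f] exI[of _ c']) simp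

lemma killableE:
  assumes "killable y c"
  obtains f c' where "src T f = src T c" "tgt T f \<in> K" "src T c' = tgt T f" "tgt T c' = tgt T c"
     "c' \<cdot> f = c" "LA f \<cdot> y = zero_arr T (src T y) (LO (tgt T f))"
  using assms unfolding killable_def by blast

lemma killable_zero: assumes "tgt T y = LO C" shows "killable y (zero_arr T C X)"
proof -
  obtain Z where Z: "is_zero T Z" "Z \<in> K" using compact_zero_object .
  show ?thesis using killableI[of "zero_arr T C Z" "zero_arr T Z X" y] Z assms by simp
qed

text \<open>The sum factors through the arrow with components \<open>f\<close> and \<open>f'\<close>
  into the biproduct, and this arrow kills \<open>y\<close> because both components do.\<close>

lemma killable_plus:
  assumes "killable y c" "killable y c'" and eq: "src T c = src T c'" "tgt T c = tgt T c'"
    and y: "tgt T y = LO (src T c)"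
  shows "killable y (c \<boxplus> c')"
proof -
  obtain f d where f: "src T f = src T c" "tgt T f \<in> K" "src T d = tgt T f" "tgt T d = tgt T c"
     "d \<cdot> f = c" "LA f \<cdot> y = zero_arr T (src T y) (LO (tgt T f))"
    using assms(1) by (rule killableE)
  obtain f' d' where f': "src T f' = src T c'" "tgt T f' \<in> K" "src T d' = tgt T f'" "tgt T d' = tgt T c'"
     "d' \<cdot> f' = c'" "LA f' \<cdot> y = zero_arr T (src T y) (LO (tgt T f'))"
    using assms(2) by (rule killableE)
  obtain S i j p q where S: "biproduct (tgt T f) (tgt T f') S i j p q" and SK: "S \<in> K"
    using compact_biproduct_exists[OF f(2) f'(2)] .
  note [simp] = biproduct_arrows(1-12)[OF S] biproduct_reduce[OF S]
  have "killable y ((d \<cdot> p \<boxplus> d' \<cdot> q) \<cdot> (i \<cdot> f \<boxplus> j \<cdot> f'))"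
    by (rule killableI) (use f f' eq y SK in simp_all)
  moreover have "(d \<cdot> p \<boxplus> d' \<cdot> q) \<cdot> (i \<cdot> f \<boxplus> j \<cdot> f') = c \<boxplus> c'"
    using f(1-5) f'(1-5) eq by simp
  ultimately show ?thesis by simp
qed

lemma killable_post:
  assumes "killable y c" "src T g = tgt T c" shows "killable y (g \<cdot> c)"
proof -
  obtain f d where f: "src T f = src T c" "tgt T f \<in> K" "src T d = tgt T f" "tgt T d = tgt T c"
     "d \<cdot> f = c" "LA f \<cdot> y = zero_arr T (src T y) (LO (tgt T f))"
    using assms(1) by (rule killableE)
  then have "killable y ((g \<cdot> d) \<cdot> f)" using assms(2) by (intro killableI) simp_all
  then show ?thesis using f assms(2) by simp
qed

section \<open>The colimit formula for all objects\<close>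

lemma lift_prop_compact: "C \<in> K \<Longrightarrow> lift_prop C"
  unfolding lift_prop_def using liftableI[of "ident T C" C] by fastforce

lemma kill_prop_compact: assumes "C \<in> K" shows "kill_prop C"
  unfolding kill_prop_def
proof (intro allI impI)
  fix c y assume "src T c \<in> K \<and> tgt T c = C \<and> src T y \<in> K \<and> tgt T y = LO (src T c) \<and>
     LA c \<cdot> y = zero_arr T (src T y) (LO C)"
  then show "killable y c" using killableI[of c "ident T C" y] assms by simp
qed

lemma lift_prop_iso:
  assumes "isomorphic T X Y" "lift_prop X" shows "lift_prop Y"
  unfolding lift_prop_def
proof (intro allI impI)
  obtain f where f: "is_iso T f" "src T f = X" "tgt T f = Y" using assms(1) by (rule isomorphicE)
  fix x assume x: "src T x \<in> K \<and> tgt T x = LO Y"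
  then have "liftable X (LA (inv_arr T f) \<cdot> x)" using assms(2) f by (simp add: lift_prop_def)
  from liftable_post[OF this f(2)] have "liftable Y (LA f \<cdot> LA (inv_arr T f) \<cdot> x)" using f by simp
  moreover have "LA f \<cdot> LA (inv_arr T f) \<cdot> x = x" using f x by (simp flip: cmp_assoc' L_cmp)
  ultimately show "liftable Y x" by simp
qed

lemma kill_prop_iso:
  assumes "isomorphic T X Y" "kill_prop X" shows "kill_prop Y"
  unfolding kill_prop_def
proof (intro allI impI)
  obtain f where f: "is_iso T f" "src T f = X" "tgt T f = Y" using assms(1) by (rule isomorphicE)
  fix c y assume c: "src T c \<in> K \<and> tgt T c = Y \<and> src T y \<in> K \<and> tgt T y = LO (src T c) \<and>
     LA c \<cdot> y = zero_arr T (src T y) (LO Y)"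
  then have "killable y (inv_arr T f \<cdot> c)" using assms(2) f by (simp add: kill_prop_def)
  from killable_post[OF this, of f] show "killable y c" using f c by simp
qed

text \<open>Smashing enters here: \<open>L\<close> preserves the coproduct, so by compactness an
  element at \<open>P\<close> is a finite sum of elements coming from the summands.\<close>

lemma lift_prop_coproduct:
  assumes I: "I \<subseteq> U" "I \<prec> U" and P: "coproduct T I X P \<iota>" and X: "\<And>i. i \<in> I \<Longrightarrow> lift_prop (X i)"
  shows "lift_prop P"
  unfolding lift_prop_def
proof (intro allI impI)
  fix x assume x: "src T x \<in> K \<and> tgt T x = LO P"
  note LP = L_coproduct[OF I P] and \<iota> = coproduct_in[OF P]
  have "liftable P z" if "z \<in> fspan I (\<lambda>i. LA (\<iota> i)) (src T x) (LO P)" for z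
    using that
  proof induction
    case zero
    show ?case by (rule liftable_zero)
  next
    case (comp i z)
    then have "liftable (X i) z" using X[OF comp(1)] x \<iota>[OF comp(1)] by (simp add: lift_prop_def)
    from liftable_post[OF this, of "\<iota> i"] show ?case using \<iota>[OF comp(1)] by simp
  next
    case (plus z z')
    then show ?case using liftable_plus fspan_arr[OF _ LP] by simp
  qed
  moreover have "x \<in> fspan I (\<lambda>i. LA (\<iota> i)) (src T x) (LO P)"
    by (rule compact_fspan[OF _ I(2) LP]) (use x in simp_all)
  ultimately show "liftable P x" by blast
qed

text \<open>Now compactness is applied to the source of \<open>c\<close>: the arrow is a finite sum
  of its components, and each component is killed through its own summand.\<close>

lemma kill_prop_coproduct:
  assumes I: "I \<subseteq> U" "I \<prec> U" and P: "coproduct T I X P \<iota>" and X: "\<And>i. i \<in> I \<Longrightarrow> kill_prop (X i)"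
  shows "kill_prop P"
  unfolding kill_prop_def
proof (intro allI impI)
  fix c y assume c: "src T c \<in> K \<and> tgt T c = P \<and> src T y \<in> K \<and> tgt T y = LO (src T c) \<and>
     LA c \<cdot> y = zero_arr T (src T y) (LO P)"
  note \<iota> = coproduct_in[OF P]
  obtain \<pi> where \<pi>: "\<And>j. j \<in> I \<Longrightarrow> src T (\<pi> j) = P" "\<And>j. j \<in> I \<Longrightarrow> tgt T (\<pi> j) = X j"
    "\<And>i j. \<lbrakk>i \<in> I; j \<in> I\<rbrakk> \<Longrightarrow> \<pi> j \<cdot> \<iota> i = (if i = j then ident T (X j) else zero_arr T (X i) (X j))"
    using coproduct_proj[OF P] by blast
  have cP: "c \<in> fspan I \<iota> (src T c) P" by (rule compact_fspan[OF _ I(2) P]) (use c in simp_all)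
  show "killable y c"
  proof (rule fspan_component_induct[OF cP P \<pi>])
    fix i assume i: "i \<in> I"
    have "killable y (\<pi> i \<cdot> c)" using X[OF i] c \<pi>(1,2)[OF i] by (simp add: kill_prop_def)
    from killable_post[OF this, of "\<iota> i"] show "killable y (\<iota> i \<cdot> \<pi> i \<cdot> c)" using \<iota>[OF i] \<pi>(1,2)[OF i] c by simp
  qed (use c killable_zero killable_plus in simp_all)
qed

text \<open>The cone step needs the properties at suspended objects, while the induction supplies
  them only at the two objects of the first arrow. The isomorphism \<open>\<psi>\<close> between
  \<open>L\<close> after suspension and suspension after \<open>L\<close> carries them over.\<close>

lemma lift_prop_shift: assumes "lift_prop X" shows "lift_prop (shift T X)"
  unfolding lift_prop_def
proof (intro allI impI)
  obtain \<psi> where \<psi>: "\<And>X. src T (\<psi> X) = LO (shift T X)" "\<And>X. tgt T (\<psi> X) = shift T (LO X)"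
    "\<And>X. is_iso T (\<psi> X)"
    "\<And>f. \<psi> (tgt T f) \<cdot> LA (shift_arr T f) = shift_arr T (LA f) \<cdot> \<psi> (src T f)"
    using L_shift by metis
  note [simp] = \<psi>(1-3)
  fix x assume x: "src T x \<in> K \<and> tgt T x = LO (shift T X)"
  let ?x = "unshift_arr (\<psi> X \<cdot> x)"
  have "unshift (src T x) \<in> K" using x by simp
  then have "liftable X ?x" using assms x by (simp add: lift_prop_def)
  then obtain c y where c: "src T c \<in> K" "tgt T c = X" "src T y = src T ?x" "tgt T y = LO (src T c)" "LA c \<cdot> y = ?x"
    by (rule liftableE)
  have "shift_arr T (LA c \<cdot> y) = \<psi> X \<cdot> x" unfolding c(5) by (simp del: unshift_cmp)
  then have cy: "shift_arr T (LA c) \<cdot> shift_arr T y = \<psi> X \<cdot> x" using c(4) by simp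
  let ?y = "inv_arr T (\<psi> (src T c)) \<cdot> shift_arr T y"
  have "\<psi> X \<cdot> LA (shift_arr T c) \<cdot> ?y = (\<psi> (tgt T c) \<cdot> LA (shift_arr T c)) \<cdot> ?y"
    using c(2,4) by (subst cmp_assoc') simp_all
  also have "\<dots> = shift_arr T (LA c) \<cdot> \<psi> (src T c) \<cdot> ?y"
    unfolding \<psi>(4) using c(2,4) by (subst cmp_assoc') simp_all
  also have "\<dots> = \<psi> X \<cdot> x" using c(2,4) cy by simp
  finally have "LA (shift_arr T c) \<cdot> ?y = x"
    using iso_left_cancel[of "\<psi> X"] c(2,4) x by simp
  moreover have "liftable (shift T X) (LA (shift_arr T c) \<cdot> ?y)"
    by (rule liftableI) (use c(1,2,4) in simp_all)
  ultimately show "liftable (shift T X) x" by simp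
qed

lemma kill_prop_shift: assumes "kill_prop X" shows "kill_prop (shift T X)"
  unfolding kill_prop_def
proof (intro allI impI)
  obtain \<psi> where \<psi>: "\<And>X. src T (\<psi> X) = LO (shift T X)" "\<And>X. tgt T (\<psi> X) = shift T (LO X)"
    "\<And>X. is_iso T (\<psi> X)"
    "\<And>f. \<psi> (tgt T f) \<cdot> LA (shift_arr T f) = shift_arr T (LA f) \<cdot> \<psi> (src T f)"
    using L_shift by metis
  note [simp] = \<psi>(1-3)
  fix c0 y assume asm: "src T c0 \<in> K \<and> tgt T c0 = shift T X \<and> src T y \<in> K \<and> tgt T y = LO (src T c0) \<and>
     LA c0 \<cdot> y = zero_arr T (src T y) (LO (shift T X))"
  define c where "c = unshift_arr c0"
  have c0: "c0 = shift_arr T c" by (simp add: c_def)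
  have cK: "src T c \<in> K" using asm by (simp add: c_def)
  have c: "tgt T c = X" "tgt T y = LO (shift T (src T c))" "src T y \<in> K"
    "LA (shift_arr T c) \<cdot> y = zero_arr T (src T y) (LO (shift T X))"
    using asm by (simp_all add: c_def)
  have conj: "shift_arr T (LA f) \<cdot> \<psi> (src T f) \<cdot> y = \<psi> (tgt T f) \<cdot> LA (shift_arr T f) \<cdot> y"
    if "src T f = src T c" for f
    using cmp_reduce[OF \<psi>(4)[of f], where z = y] that c(2) by simp
  let ?y = "unshift_arr (\<psi> (src T c) \<cdot> y)"
  have Sy: "shift_arr T ?y = \<psi> (src T c) \<cdot> y" by (simp del: unshift_cmp)
  have y: "src T ?y = unshift (src T y)" "tgt T ?y = LO (src T c)" using c by simp_all
  have "shift_arr T (LA c \<cdot> ?y) = shift_arr T (LA c) \<cdot> \<psi> (src T c) \<cdot> y"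
    using y Sy by (simp del: unshift_cmp)
  also have "\<dots> = zero_arr T (src T y) (shift T (LO X))" using conj[of c] c by simp
  also have "\<dots> = shift_arr T (zero_arr T (unshift (src T y)) (LO X))" by simp
  finally have "LA c \<cdot> ?y = zero_arr T (unshift (src T y)) (LO X)" by (simp only: shift_arr_eq_iff)
  moreover have "unshift (src T y) \<in> K" using c(3) by simp
  ultimately have "killable ?y c" using assms cK c(1) y by (simp add: kill_prop_def)
  then obtain f d where f: "src T f = src T c" "tgt T f \<in> K" "src T d = tgt T f" "tgt T d = tgt T c"
     "d \<cdot> f = c" "LA f \<cdot> ?y = zero_arr T (src T ?y) (LO (tgt T f))"
    by (rule killableE)
  have "\<psi> (tgt T f) \<cdot> LA (shift_arr T f) \<cdot> y = shift_arr T (LA f) \<cdot> \<psi> (src T c) \<cdot> y"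
    using conj[OF f(1)] f(1) by simp
  also have "\<dots> = shift_arr T (LA f \<cdot> ?y)" using y Sy f(1) by (simp del: unshift_cmp)
  also have "\<dots> = \<psi> (tgt T f) \<cdot> zero_arr T (src T y) (LO (shift T (tgt T f)))"
    unfolding f(6) using y by simp
  finally have "LA (shift_arr T f) \<cdot> y = zero_arr T (src T y) (LO (shift T (tgt T f)))"
    using iso_cmp_eq_zero[of "\<psi> (tgt T f)" "LA (shift_arr T f) \<cdot> y"] f(1) c(2) by simp
  then have "killable y (shift_arr T d \<cdot> shift_arr T f)"
    using f by (intro killableI) simp_all
  then show "killable y c0" using f(3,5) c0 by (simp flip: shift_cmp')
qed

text \<open>This is the surjective half of the five lemma. The image of \<open>x\<close> under
  \<open>LA w\<close> comes from a compact stage \<open>c\<close>. Followed by the suspension of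
  \<open>u\<close> it dies at a further stage \<open>f\<close>, so it lifts to the fibre
  \<open>b\<close> of \<open>f\<close>, where \<open>c \<cdot> b\<close> lifts along
  \<open>w\<close> to an arrow \<open>a\<close>. What \<open>a\<close> does not account for comes
  from the middle object of the triangle.\<close>

lemma lift_prop_cone:
  assumes tri: "(u, v, w) \<in> triangles T"
    and lift: "lift_prop (shift T (src T u))" "lift_prop (tgt T u)" and kill: "kill_prop (shift T (tgt T u))"
  shows "lift_prop (tgt T v)"
  unfolding lift_prop_def
proof (intro allI impI)
  fix x assume "src T x \<in> K \<and> tgt T x = LO (tgt T v)"
  then have x: "src T x \<in> K" "tgt T x = LO (tgt T v)" by simp_all
  note [simp] = tri_arrows[OF tri]
  have uw: "shift_arr T u \<cdot> w = zero_arr T (tgt T v) (shift T (tgt T u))"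
    using tri_cmp_zero2[OF tri_rotate[OF tri]] by simp
  have "liftable (shift T (src T u)) (LA w \<cdot> x)" using lift(1) x by (simp add: lift_prop_def)
  then obtain c y where c: "src T c \<in> K" "tgt T c = shift T (src T u)" "src T y = src T (LA w \<cdot> x)"
      "tgt T y = LO (src T c)" "LA c \<cdot> y = LA w \<cdot> x"
    by (rule liftableE)
  have y: "src T y = src T x" using c(3) x by simp
  have "LA (shift_arr T u \<cdot> c) \<cdot> y = LA (shift_arr T u \<cdot> w) \<cdot> x" using c(2,4,5) x(2) by simp
  also have "\<dots> = zero_arr T (src T x) (LO (shift T (tgt T u)))" using x(2) by (simp add: uw del: L_cmp)
  finally have "killable y (shift_arr T u \<cdot> c)"
    using kill c(1,2,4) x y by (simp add: kill_prop_def)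
  then obtain f d where f: "src T f = src T c" "tgt T f \<in> K" "src T d = tgt T f" "tgt T d = shift T (tgt T u)"
     "d \<cdot> f = shift_arr T u \<cdot> c" "LA f \<cdot> y = zero_arr T (src T y) (LO (tgt T f))"
    using c(2) by (elim killableE) simp
  obtain b k where tri': "(b, f, k) \<in> triangles T" using fibre_exists .
  note b = tri_arrows[OF tri']
  have bK: "src T b \<in> K" using K_fibre[OF tri'] b f(1,2) c(1) by simp
  obtain y1 where y1: "src T y1 = src T x" "tgt T y1 = LO (src T b)" "LA b \<cdot> y1 = y"
    using L_weak_ker[OF tri', of y] f(1,6) b c(4) y by auto
  have "shift_arr T u \<cdot> c \<cdot> b = d \<cdot> f \<cdot> b"
    using cmp_reduce[OF f(5)[symmetric], of b] f(1,3) b c(2) by simp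
  also have "\<dots> = zero_arr T (src T b) (shift T (tgt T u))" using tri_cmp_zero[OF tri'] f(3,4) by simp
  finally have "neg_arr T (shift_arr T u) \<cdot> c \<cdot> b = zero_arr T (src T b) (shift T (tgt T u))"
    using c(2) b f(1) by simp
  then obtain a where a: "src T a = src T b" "tgt T a = tgt T v" "w \<cdot> a = c \<cdot> b"
    using tri_weak_ker2[OF tri_rotate[OF tri], of "c \<cdot> b"] c(2) b f(1) by auto
  let ?d = "x \<boxplus> neg_arr T (LA a \<cdot> y1)"
  have "LA w \<cdot> LA a \<cdot> y1 = LA (w \<cdot> a) \<cdot> y1" using a(1,2) y1 by simp
  also have "\<dots> = LA w \<cdot> x" unfolding a(3) using y1 c(2,5) b f(1) by simp
  finally have "LA w \<cdot> ?d = zero_arr T (src T ?d) (LO (tgt T w))" using x a(1,2) y1 by simp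
  then obtain z where z: "src T z = src T x" "tgt T z = LO (tgt T u)" "LA v \<cdot> z = ?d"
    using L_weak_ker[OF tri_rotate[OF tri], of ?d] x a(1,2) y1 by auto
  have "liftable (tgt T v) (LA v \<cdot> z)"
    by (rule liftable_post[of "tgt T u"]) (use lift(2) z(1,2) x(1) in \<open>simp_all add: lift_prop_def\<close>)
  moreover have "liftable (tgt T v) (LA a \<cdot> y1)"
    by (rule liftableI) (use bK a(1,2) y1 in simp_all)
  ultimately have "liftable (tgt T v) (?d \<boxplus> LA a \<cdot> y1)"
    unfolding z(3) by (rule liftable_plus) (use x a(1,2) y1 in simp)
  then show "liftable (tgt T v) x" using x a(1,2) y1 by simp
qed

text \<open>The system of compact objects over \<open>Y\<close> behaves as a filtered one: the
  difference of the two elements lives over the biproduct of the sources and dies at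
  \<open>Y\<close>, so it dies at a compact stage.\<close>

lemma kill_prop_equalise:
  assumes kill: "kill_prop Y"
    and a: "src T a \<in> K" "tgt T a = Y" "tgt T y = LO (src T a)"
    and b: "src T b \<in> K" "tgt T b = Y" "tgt T z = LO (src T b)"
    and yz: "src T y \<in> K" "src T z = src T y" "LA a \<cdot> y = LA b \<cdot> z"
  obtains g h e where "src T g = src T a" "src T h = src T b" "tgt T g \<in> K" "tgt T h = tgt T g"
    "src T e = tgt T g" "tgt T e = Y" "e \<cdot> g = a" "e \<cdot> h = b" "LA g \<cdot> y = LA h \<cdot> z"
proof -
  obtain S i j p q where S: "biproduct (src T a) (src T b) S i j p q" and SK: "S \<in> K"
    using compact_biproduct_exists[OF a(1) b(1)] .
  note [simp] = biproduct_arrows(1-12)[OF S] biproduct_reduce[OF S]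
  have LS: "LA p \<cdot> LA i \<cdot> z = z" "LA q \<cdot> LA i \<cdot> z = zero_arr T (src T z) (LO (src T b))"
    if "tgt T z = LO (src T a)" for z
    using that by (simp_all flip: cmp_assoc' L_cmp)
  have LS': "LA q \<cdot> LA j \<cdot> z = z" "LA p \<cdot> LA j \<cdot> z = zero_arr T (src T z) (LO (src T a))"
    if "tgt T z = LO (src T b)" for z
    using that by (simp_all flip: cmp_assoc' L_cmp)
  let ?c = "a \<cdot> p \<boxplus> b \<cdot> q" and ?y = "LA i \<cdot> y \<boxplus> neg_arr T (LA j \<cdot> z)"
  have y: "src T ?y = src T y" "tgt T ?y = LO S" using a(3) b(3) yz(2) by simp_all
  have "LA ?c \<cdot> ?y = zero_arr T (src T y) (LO Y)"
    using a(2,3) b(2,3) yz(2,3) by (simp add: LS LS')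
  then have "killable ?y ?c"
    using kill y yz(1) a(2) b(2) SK unfolding kill_prop_def by simp
  then obtain f e where f: "src T f = src T ?c" "tgt T f \<in> K" "src T e = tgt T f" "tgt T e = tgt T ?c"
     "e \<cdot> f = ?c" "LA f \<cdot> ?y = zero_arr T (src T ?y) (LO (tgt T f))"
    by (rule killableE)
  have fS: "src T f = S" "tgt T e = Y" using f(1,4) a(2) b(2) by simp_all
  have "e \<cdot> f \<cdot> i = a" "e \<cdot> f \<cdot> j = b"
    using cmp_reduce[OF f(5), of i] cmp_reduce[OF f(5), of j] fS f(3) a(2) b(2) by simp_all
  moreover have "LA (f \<cdot> i) \<cdot> y = LA (f \<cdot> j) \<cdot> z"
  proof (subst eq_iff_diff_zero)
    have "LA f \<cdot> ?y = LA (f \<cdot> i) \<cdot> y \<boxplus> neg_arr T (LA (f \<cdot> j) \<cdot> z)"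
      using fS a(3) b(3) yz(2) by simp
    then show "LA (f \<cdot> i) \<cdot> y \<boxplus> neg_arr T (LA (f \<cdot> j) \<cdot> z) =
        zero_arr T (src T (LA (f \<cdot> j) \<cdot> z)) (tgt T (LA (f \<cdot> j) \<cdot> z))"
      using f(6) fS a(3) b(3) y yz(2) by simp
  qed (use fS a(3) b(3) yz(2) in simp_all)
  ultimately show ?thesis
    using fS f(2,3) by (intro that[of "f \<cdot> i" "f \<cdot> j" e]) simp_all
qed

text \<open>This is the injective half of the five lemma. After passing to the fibre
  \<open>b\<close> of an arrow that kills \<open>y\<close> over the suspended first object,
  \<open>c \<cdot> b\<close> factors as \<open>v \<cdot> a\<close>. The element
  \<open>LA a \<cdot> y1\<close> is then killed by \<open>LA v\<close>, so it comes from the first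
  object, and by \<open>lift_prop\<close> from a compact stage \<open>d'\<close> over it.\<close>

lemma kill_prop_cone:
  assumes tri: "(u, v, w) \<in> triangles T"
    and lift: "lift_prop (src T u)" and kill: "kill_prop (tgt T u)" "kill_prop (shift T (src T u))"
  shows "kill_prop (tgt T v)"
  unfolding kill_prop_def
proof (intro allI impI)
  fix c y assume "src T c \<in> K \<and> tgt T c = tgt T v \<and> src T y \<in> K \<and> tgt T y = LO (src T c) \<and>
     LA c \<cdot> y = zero_arr T (src T y) (LO (tgt T v))"
  then have c: "src T c \<in> K" "tgt T c = tgt T v" "src T y \<in> K" "tgt T y = LO (src T c)"
     "LA c \<cdot> y = zero_arr T (src T y) (LO (tgt T v))" by simp_all
  note [simp] = tri_arrows[OF tri]
  have "LA (w \<cdot> c) \<cdot> y = zero_arr T (src T y) (LO (shift T (src T u)))" using c by simp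
  then have "killable y (w \<cdot> c)" using kill(2) c by (simp add: kill_prop_def)
  then obtain f d where f: "src T f = src T c" "tgt T f \<in> K" "src T d = tgt T f" "tgt T d = shift T (src T u)"
     "d \<cdot> f = w \<cdot> c" "LA f \<cdot> y = zero_arr T (src T y) (LO (tgt T f))"
    using c(2) by (elim killableE) simp
  obtain b k where tri': "(b, f, k) \<in> triangles T" using fibre_exists .
  note b = tri_arrows[OF tri']
  have bK: "src T b \<in> K" using K_fibre[OF tri'] b f(1,2) c(1) by simp
  obtain y1 where y1: "src T y1 = src T y" "tgt T y1 = LO (src T b)" "LA b \<cdot> y1 = y"
    using L_weak_ker[OF tri', of y] f(1,6) b c(4) by auto
  have "w \<cdot> c \<cdot> b = d \<cdot> f \<cdot> b"
    using cmp_reduce[OF f(5)[symmetric], of b] f(1,3) b c(2) by simp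
  also have "\<dots> = zero_arr T (src T b) (shift T (src T u))" using tri_cmp_zero[OF tri'] f(3,4) by simp
  finally obtain a where a: "src T a = src T b" "tgt T a = tgt T u" "v \<cdot> a = c \<cdot> b"
    using tri_weak_ker2[OF tri, of "c \<cdot> b"] c(2) b f(1) by auto
  have "LA v \<cdot> LA a \<cdot> y1 = LA (v \<cdot> a) \<cdot> y1" using a(1,2) y1 by simp
  also have "\<dots> = LA c \<cdot> LA b \<cdot> y1" unfolding a(3) using y1(2) c(2) b f(1) by simp
  also have "\<dots> = zero_arr T (src T y) (LO (tgt T v))" unfolding y1(3) using c(5) .
  finally obtain z where z: "src T z = src T y" "tgt T z = LO (src T u)" "LA u \<cdot> z = LA a \<cdot> y1"
    using L_weak_ker[OF tri, of "LA a \<cdot> y1"] a(1,2) y1 by auto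
  have "liftable (src T u) z" using lift z(1,2) c(3) by (simp add: lift_prop_def)
  then obtain d' z1 where d': "src T d' \<in> K" "tgt T d' = src T u" "src T z1 = src T z" "tgt T z1 = LO (src T d')"
      "LA d' \<cdot> z1 = z"
    by (rule liftableE)
  have "LA a \<cdot> y1 = LA (u \<cdot> d') \<cdot> z1" using z(3) d'(2,4,5) by simp
  then obtain g h e where g: "src T g = src T a" "src T h = src T d'" "tgt T g \<in> K" "tgt T h = tgt T g"
    "src T e = tgt T g" "tgt T e = tgt T u" "e \<cdot> g = a" "e \<cdot> h = u \<cdot> d'" "LA g \<cdot> y1 = LA h \<cdot> z1"
    using kill_prop_equalise[OF kill(1), of a y1 "u \<cdot> d'" z1] a(1,2) bK y1(1,2) d'(1-4) z(1) c(3) by auto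
  \<comment> \<open>At the stage \<open>e\<close> the element \<open>y1\<close> agrees with one
    coming through \<open>h\<close>, so it dies in the cone of \<open>h\<close>. This cone maps to
    the third object of the triangle because \<open>v \<cdot> u\<close> is zero.\<close>
  obtain s t where tri'': "(h, s, t) \<in> triangles T" using triangle_exists by blast
  note s = tri_arrows[OF tri'']
  have sK: "tgt T s \<in> K" using K_cone[OF tri''] g(2-4) d'(1) by simp
  have "v \<cdot> e \<cdot> h = v \<cdot> u \<cdot> d'" using g(8) by simp
  also have "\<dots> = zero_arr T (src T d') (tgt T v)"
    using cmp_reduce[OF tri_cmp_zero[OF tri], of d'] d'(2) by simp
  finally obtain e' where e': "src T e' = tgt T s" "tgt T e' = tgt T v" "e' \<cdot> s = v \<cdot> e"
    using tri_weak_coker[OF tri'', of "v \<cdot> e"] g(2,4-6) by auto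
  have sg: "LA (s \<cdot> g) \<cdot> y1 = zero_arr T (src T y) (LO (tgt T s))"
  proof -
    have "LA (s \<cdot> g) \<cdot> y1 = LA s \<cdot> LA h \<cdot> z1" using g(1,4,9) s a(1) y1(2) by simp
    also have "\<dots> = LA (s \<cdot> h) \<cdot> z1" using s g(2) d'(4) by simp
    also have "\<dots> = zero_arr T (src T y) (LO (tgt T s))"
      using tri_cmp_zero[OF tri''] d'(3,4) g(2) z(1) by simp
    finally show ?thesis .
  qed
  have cb: "c \<cdot> b = e' \<cdot> s \<cdot> g"
    using cmp_reduce[OF e'(3), of g] e'(1) a(3) g(1,4-7) s by simp
  \<comment> \<open>So far only the lift \<open>y1\<close> of \<open>y\<close> along
    \<open>b\<close> has been killed. Pushing out along \<open>b\<close> gives an arrow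
    \<open>j\<close> from the source of \<open>c\<close> which kills \<open>y\<close> and through
    which \<open>c\<close> factors.\<close>
  obtain j k' where j: "src T j = tgt T b" "src T k' = tgt T (s \<cdot> g)" "tgt T j \<in> K" "tgt T k' = tgt T j"
    "j \<cdot> b = k' \<cdot> s \<cdot> g"
    and univ: "\<forall>c e. src T c = tgt T b \<and> src T e = tgt T (s \<cdot> g) \<and> tgt T c = tgt T e \<and> c \<cdot> b = e \<cdot> s \<cdot> g \<longrightarrow>
       (\<exists>h. src T h = tgt T j \<and> tgt T h = tgt T e \<and> h \<cdot> j = c \<and> h \<cdot> k' = e)"
    by (rule compact_weak_pushout[of b "s \<cdot> g"]) (use bK sK c(1) f(1) b s g(1,4) a(1) in simp_all)
  obtain c' where c': "src T c' = tgt T j" "tgt T c' = tgt T v" "c' \<cdot> j = c"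
    using univ[rule_format, of c e'] cb c(2) f(1) b s g(4) e' by auto
  have "LA j \<cdot> y = LA (j \<cdot> b) \<cdot> y1" using y1 j(1) by simp
  also have "\<dots> = LA k' \<cdot> LA (s \<cdot> g) \<cdot> y1"
    unfolding j(5) using j(2) y1(2) g(1,4) a(1) s by simp
  also have "\<dots> = zero_arr T (src T y) (LO (tgt T j))" using sg j(2,4) g(4) s by simp
  finally have "killable y (c' \<cdot> j)" using j(3) c'(1) by (intro killableI) simp_all
  then show "killable y c" using c'(3) by simp
qed

text \<open>The conjunction is the induction hypothesis, since the cone step of each property uses
  both.\<close>

theorem lift_and_kill: "lift_prop X \<and> kill_prop X"
proof (induction X rule: localising_induct)
  fix C assume "C \<in> K" then show "lift_prop C \<and> kill_prop C"
    using lift_prop_compact kill_prop_compact by blast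
next
  fix X Y assume "isomorphic T X Y" "lift_prop X \<and> kill_prop X" then show "lift_prop Y \<and> kill_prop Y"
    using lift_prop_iso kill_prop_iso by blast
next
  fix f g h assume "(f, g, h) \<in> triangles T" "lift_prop (src T f) \<and> kill_prop (src T f)"
    "lift_prop (tgt T f) \<and> kill_prop (tgt T f)"
  then show "lift_prop (tgt T g) \<and> kill_prop (tgt T g)"
    using lift_prop_cone kill_prop_cone lift_prop_shift kill_prop_shift by blast
next
  fix I X P and \<iota> :: "'c \<Rightarrow> 'b"
  assume "I \<subseteq> U" "I \<prec> U" "coproduct T I X P \<iota>" "\<And>i. i \<in> I \<Longrightarrow> lift_prop (X i) \<and> kill_prop (X i)"
  then show "lift_prop P \<and> kill_prop P"
    using lift_prop_coproduct kill_prop_coproduct by blast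
qed

section \<open>Arrows killed by the localisation\<close>

definition J :: "'b set" where
  "J = {f. src T f \<in> K \<and> tgt T f \<in> K \<and> LA f = zero_arr T (LO (src T f)) (LO (tgt T f))}"

text \<open>\<open>kill_prop\<close> is applied to the tautological element \<open>\<eta>\<close> at
  the source of \<open>c\<close>, which dies at the acyclic object \<open>W\<close>. By naturality
  an arrow at which it dies is killed by \<open>L\<close>.\<close>

lemma acyclic_factor:
  assumes W: "is_zero T (LO W)" and c: "src T c \<in> K" "tgt T c = W"
  obtains f c' where "f \<in> J" "src T f = src T c" "src T c' = tgt T f" "tgt T c' = W" "c' \<cdot> f = c"
proof -
  have "LA c \<cdot> \<eta> (src T c) = zero_arr T (src T c) (LO W)"
    using arr_to_zero[OF W, of "LA c \<cdot> \<eta> (src T c)"] c by simp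
  then have "killable (\<eta> (src T c)) c" using lift_and_kill[of W] c by (simp add: kill_prop_def)
  then obtain f c' where f: "src T f = src T c" "tgt T f \<in> K" "src T c' = tgt T f" "tgt T c' = tgt T c"
     "c' \<cdot> f = c" "LA f \<cdot> \<eta> (src T c) = zero_arr T (src T (\<eta> (src T c))) (LO (tgt T f))"
    by (rule killableE)
  have "\<eta> (tgt T f) \<cdot> f = zero_arr T (src T f) (LO (tgt T f))" using f(1,6) eta_natural[of f] by simp
  then have "f \<in> J" using f(1,2) c(1) by (simp add: J_def L_zero_iff)
  then show ?thesis using that f c by simp
qed

text \<open>For the converse it must be shown that the acyclic fibre of \<open>\<eta> Y\<close>
  vanishes. The factorisation through \<open>J\<close> is used twice: first \<open>m\<close> kills
  all arrows from compact objects; then an arrow \<open>x\<close> into the fibre is written as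
  \<open>c \<cdot> f\<close> with \<open>f\<close> in \<open>J\<close>, and \<open>c\<close>, being
  killed by \<open>m\<close>, lifts to the desuspension of the local object
  \<open>LO Y\<close>.\<close>

theorem local_iff: "is_iso T (\<eta> Y) \<longleftrightarrow> (\<forall>f\<in>J. \<forall>h. src T h = tgt T f \<and> tgt T h = Y \<longrightarrow> h \<cdot> f = zero_arr T (src T f) Y)"
proof
  assume "is_iso T (\<eta> Y)"
  then show "\<forall>f\<in>J. \<forall>h. src T h = tgt T f \<and> tgt T h = Y \<longrightarrow> h \<cdot> f = zero_arr T (src T f) Y"
    using local_kills by (auto simp: J_def)
next
  assume kills: "\<forall>f\<in>J. \<forall>h. src T h = tgt T f \<and> tgt T h = Y \<longrightarrow> h \<cdot> f = zero_arr T (src T f) Y"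
  obtain m k where tri: "(m, \<eta> Y, k) \<in> triangles T" using fibre_exists .
  have m: "tgt T m = Y" "src T k = LO Y" "tgt T k = shift T (src T m)" using tri_arrows[OF tri] by simp_all
  have acyc: "is_zero T (LO (src T m))" by (rule fibre_acyclic[OF tri])
  have mx: "m \<cdot> x = zero_arr T (src T x) Y" if x: "src T x \<in> K" "tgt T x = src T m" for x
  proof -
    obtain f c where f: "f \<in> J" "src T f = src T x" "src T c = tgt T f" "tgt T c = src T m" "c \<cdot> f = x"
      using acyclic_factor[OF acyc x] .
    have "(m \<cdot> c) \<cdot> f = zero_arr T (src T x) Y" using kills f m by simp
    then show ?thesis using f(2-5) by simp
  qed
  have "is_zero T (src T m)"
  proof (rule compacts_generate)
    fix C assume C: "C \<in> compacts T U"
    have "x = zero_arr T C (src T m)" if x: "src T x = C" "tgt T x = src T m" for x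
    proof -
      obtain f c where f: "f \<in> J" "src T f = src T x" "src T c = tgt T f" "tgt T c = src T m" "c \<cdot> f = x"
        using acyclic_factor[OF acyc, of x] x C by auto
      let ?n = "unshift_arr (neg_arr T k)"
      have "m \<cdot> c = zero_arr T (src T c) Y" using mx f by (simp add: J_def)
      then obtain l where l: "src T l = src T c" "tgt T l = unshift (LO Y)" "?n \<cdot> l = c"
        using tri_weak_ker[OF tri_unrotate[OF tri], of c] f(4) m by auto
      \<comment> \<open>Local objects admit no non-zero composite with an arrow that
        \<open>L\<close> kills; the statement is suspended because \<open>LO Y\<close> itself, not
        its desuspension, is known to be local.\<close>
      have "shift_arr T l \<cdot> shift_arr T f = zero_arr T (shift T C) (LO Y)"
        using local_kills[of "shift_arr T f" "shift_arr T l"] L_shift_zero[of f] f(1-3) l(1,2) x(1)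
        by (simp add: J_def)
      then have "shift_arr T (l \<cdot> f) = shift_arr T (zero_arr T C (unshift (LO Y)))" using l(1) f(3) by simp
      then have "l \<cdot> f = zero_arr T C (unshift (LO Y))" by (simp only: shift_arr_eq_iff)
      moreover have "?n \<cdot> l \<cdot> f = x" using cmp_reduce[OF l(3), of f] l(1,2) f(3,5) m(2) by simp
      ultimately show ?thesis using m(2,3) x f(3) by simp
    qed
    then show "Hom T C (src T m) = {zero_arr T C (src T m)}" by (auto simp: in_Hom)
  qed
  then show "is_iso T (\<eta> Y)" using tri_cone_zero_iso[OF tri_rotate[OF tri]] m(3) by simp
qed

text \<open>Vanishing of Hom(f, X) is turned into surjectivity of Hom(g, X) by taking for
  \<open>g\<close> the next arrow of a triangle on \<open>f\<close>.\<close>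

theorem local_definable: "definable T U (local_objects T \<eta>)"
proof -
  obtain G where G: "G \<prec> U" "G \<subseteq> K" "\<And>C. C \<in> K \<Longrightarrow> \<exists>C'\<in>G. isomorphic T C C'"
    using compacts_essentially_small by blast
  let ?surj = "\<lambda>g X. (\<lambda>h. h \<cdot> g) ` Hom T (tgt T g) X = Hom T (src T g) X"
  \<comment> \<open>Taking every arrow between representatives that is surjective on all local
    objects makes one inclusion immediate and the set small.\<close>
  define S where "S = {g. src T g \<in> G \<and> tgt T g \<in> G \<and> (\<forall>X\<in>local_objects T \<eta>. ?surj g X)}"
  have "S \<prec> U" by (rule small_subset[OF small_arrows2[OF G(1)]]) (auto simp: S_def)
  moreover have "\<forall>g\<in>S. src T g \<in> K \<and> tgt T g \<in> K" using G(2) by (auto simp: S_def)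
  moreover have "local_objects T \<eta> = {X. \<forall>g\<in>S. ?surj g X}"
  proof
    show "local_objects T \<eta> \<subseteq> {X. \<forall>g\<in>S. ?surj g X}" by (auto simp: S_def)
    show "{X. \<forall>g\<in>S. ?surj g X} \<subseteq> local_objects T \<eta>"
    proof
      fix Y assume Y: "Y \<in> {X. \<forall>g\<in>S. ?surj g X}"
      have "x \<cdot> f = zero_arr T (src T f) Y" if f: "f \<in> J" and x: "src T x = tgt T f" "tgt T x = Y" for f x
      proof -
        obtain g k where tri: "(f, g, k) \<in> triangles T" using triangle_exists by blast
        note [simp] = tri_arrows[OF tri]
        have fK: "src T f \<in> K" "tgt T f \<in> K" using f by (simp_all add: J_def)
        obtain i where i: "is_iso T i" "src T i = tgt T f" "tgt T i \<in> G"
          using G(3)[OF fK(2)] by (auto elim!: isomorphicE)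
        obtain j where j: "is_iso T j" "src T j = tgt T g" "tgt T j \<in> G"
          using G(3)[OF K_cone[OF tri fK]] by (auto elim!: isomorphicE)
        \<comment> \<open>This is \<open>g\<close> moved to the representatives in \<open>G\<close>;
          conjugating by isomorphisms does not affect surjectivity.\<close>
        let ?g = "j \<cdot> g \<cdot> inv_arr T i"
        have g: "src T ?g = tgt T i" "tgt T ?g = tgt T j" using i j by simp_all
        have "?surj ?g X" if X: "X \<in> local_objects T \<eta>" for X
        proof
          show "(\<lambda>h. h \<cdot> ?g) ` Hom T (tgt T ?g) X \<subseteq> Hom T (src T ?g) X" using i j by (auto simp: in_Hom)
          show "Hom T (src T ?g) X \<subseteq> (\<lambda>h. h \<cdot> ?g) ` Hom T (tgt T ?g) X"
          proof
            fix y assume "y \<in> Hom T (src T ?g) X"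
            then have y: "src T y = tgt T i" "tgt T y = X" using g by (simp_all add: in_Hom)
            have "(y \<cdot> i) \<cdot> f = zero_arr T (src T f) X"
              using local_iff[of X] X f y i by (simp add: local_objects_def del: cmp_assoc')
            then obtain z where z: "src T z = tgt T g" "tgt T z = X" "z \<cdot> g = y \<cdot> i"
              using tri_weak_coker[OF tri, of "y \<cdot> i"] y i by auto
            have "(z \<cdot> inv_arr T j) \<cdot> ?g = (z \<cdot> g) \<cdot> inv_arr T i" using z(1) i j by simp
            also have "\<dots> = y" unfolding z(3) using y i by simp
            finally have "y = (z \<cdot> inv_arr T j) \<cdot> ?g" ..
            moreover have "z \<cdot> inv_arr T j \<in> Hom T (tgt T ?g) X" using z j g by (simp add: in_Hom)
            ultimately show "y \<in> (\<lambda>h. h \<cdot> ?g) ` Hom T (tgt T ?g) X" by (rule image_eqI)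
          qed
        qed
        then have "?g \<in> S" using i j g by (simp add: S_def)
        then have "?surj ?g Y" using Y by blast
        moreover have "x \<cdot> inv_arr T i \<in> Hom T (src T ?g) Y" using x i g by (simp add: in_Hom)
        ultimately have "x \<cdot> inv_arr T i \<in> (\<lambda>h. h \<cdot> ?g) ` Hom T (tgt T ?g) Y" by simp
        then obtain y where "y \<in> Hom T (tgt T ?g) Y" and yg: "x \<cdot> inv_arr T i = y \<cdot> ?g" by (rule imageE)
        then have y: "src T y = tgt T j" "tgt T y = Y" using g by (simp_all add: in_Hom)
        have "x = (x \<cdot> inv_arr T i) \<cdot> i" using x i by simp
        also have "\<dots> = y \<cdot> j \<cdot> g" unfolding yg using y(1) i j by simp
        finally have "x \<cdot> f = y \<cdot> j \<cdot> g \<cdot> f" using y(1) j by simp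
        then show ?thesis using tri_cmp_zero[OF tri] y(1,2) j by simp
      qed
      then show "Y \<in> local_objects T \<eta>" using local_iff[of Y] by (simp add: local_objects_def)
    qed
  qed
  ultimately show ?thesis unfolding definable_def by blast
qed

end

section \<open>Rigid objects and duality\<close>

context closed_symmetric_monoidal
begin

abbreviation one :: 'a where "one \<equiv> unit_obj T"

abbreviation left_whisker :: "'a \<Rightarrow> 'b \<Rightarrow> 'b" (infixr "\<rtimes>" 75)
  where "X \<rtimes> f \<equiv> ident T X \<boxtimes>\<^sub>a f"

abbreviation right_whisker :: "'b \<Rightarrow> 'a \<Rightarrow> 'b" (infixl "\<ltimes>" 76)
  where "f \<ltimes> X \<equiv> f \<boxtimes>\<^sub>a ident T X"

abbreviation assoc_inv :: "'a \<Rightarrow> 'a \<Rightarrow> 'a \<Rightarrow> 'b"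
  where "assoc_inv X Y Z \<equiv> inv_arr T (assoc T X Y Z)"

lemma src_tensor [simp]: "src T (f \<boxtimes>\<^sub>a g) = src T f \<boxtimes> src T g"
  and tgt_tensor [simp]: "tgt T (f \<boxtimes>\<^sub>a g) = tgt T f \<boxtimes> tgt T g"
  using tensor_in[of f "src T f" "tgt T f" g "src T g" "tgt T g"] by (simp_all add: in_Hom)

lemma tensor_ident' [simp]: "X \<rtimes> ident T Y = ident T (X \<boxtimes> Y)"
  by (rule tensor_ident)

lemma tensor_cmp':
  "\<lbrakk>tgt T f = src T f'; tgt T g = src T g'\<rbrakk>
   \<Longrightarrow> (f' \<cdot> f) \<boxtimes>\<^sub>a (g' \<cdot> g) = (f' \<boxtimes>\<^sub>a g') \<cdot> (f \<boxtimes>\<^sub>a g)"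
  using tensor_cmp[of f "src T f" "src T f'" f' "tgt T f'" g "src T g" "src T g'" g' "tgt T g'"]
  by (simp add: in_Hom)

lemma left_whisker_cmp: "tgt T f = src T g \<Longrightarrow> X \<rtimes> (g \<cdot> f) = (X \<rtimes> g) \<cdot> (X \<rtimes> f)"
  using tensor_cmp'[of "ident T X" "ident T X" f g] by simp

lemma right_whisker_cmp: "tgt T f = src T g \<Longrightarrow> (g \<cdot> f) \<ltimes> X = (g \<ltimes> X) \<cdot> (f \<ltimes> X)"
  using tensor_cmp'[of f g "ident T X" "ident T X"] by simp

lemma whisker_exchange:
  "\<lbrakk>src T f = X; tgt T f = X'; src T g = Y; tgt T g = Y'\<rbrakk> \<Longrightarrow> (X' \<rtimes> g) \<cdot> (f \<ltimes> Y) = (f \<ltimes> Y') \<cdot> (X \<rtimes> g)"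
  using tensor_cmp'[of f "ident T X'" "ident T Y" g] tensor_cmp'[of "ident T X" f g "ident T Y'"] by simp

lemma is_iso_tensor [simp]: "\<lbrakk>is_iso T f; is_iso T g\<rbrakk> \<Longrightarrow> is_iso T (f \<boxtimes>\<^sub>a g)"
  by (rule is_isoI[of "inv_arr T f \<boxtimes>\<^sub>a inv_arr T g"]) (simp_all flip: tensor_cmp')

lemma src_assoc [simp]: "src T (assoc T X Y Z) = (X \<boxtimes> Y) \<boxtimes> Z"
  and tgt_assoc [simp]: "tgt T (assoc T X Y Z) = X \<boxtimes> (Y \<boxtimes> Z)"
  and src_lunit [simp]: "src T (lunit T X) = one \<boxtimes> X" and tgt_lunit [simp]: "tgt T (lunit T X) = X"
  and src_runit [simp]: "src T (runit T X) = X \<boxtimes> one" and tgt_runit [simp]: "tgt T (runit T X) = X"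
  and src_braid [simp]: "src T (braid T X Y) = X \<boxtimes> Y" and tgt_braid [simp]: "tgt T (braid T X Y) = Y \<boxtimes> X"
  and src_eval [simp]: "src T (eval T X Y) = ihom T X Y \<boxtimes> X" and tgt_eval [simp]: "tgt T (eval T X Y) = Y"
  using assoc_in[of X Y Z] lunit_in[of X] runit_in[of X] braid_in[of X Y] eval_in[of X Y]
  by (simp_all add: in_Hom)

declare assoc_iso [simp] lunit_iso [simp] runit_iso [simp]

lemma braid_iso [simp]: "is_iso T (braid T X Y)"
  by (rule is_isoI[of "braid T Y X"]) (simp_all add: braid_symmetric)

lemma assoc_nat:
  "assoc T (tgt T f) (tgt T g) (tgt T h) \<cdot> ((f \<boxtimes>\<^sub>a g) \<boxtimes>\<^sub>a h)
   = (f \<boxtimes>\<^sub>a (g \<boxtimes>\<^sub>a h)) \<cdot> assoc T (src T f) (src T g) (src T h)"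
  by (rule assoc_natural) (simp_all add: in_Hom)

lemma lunit_nat: "lunit T (tgt T f) \<cdot> (one \<rtimes> f) = f \<cdot> lunit T (src T f)"
  and runit_nat: "runit T (tgt T f) \<cdot> (f \<ltimes> one) = f \<cdot> runit T (src T f)"
  and braid_nat: "braid T (tgt T f) (tgt T g) \<cdot> (f \<boxtimes>\<^sub>a g) = (g \<boxtimes>\<^sub>a f) \<cdot> braid T (src T f) (src T g)"
  by (rule lunit_natural runit_natural braid_natural; simp add: in_Hom)+

lemma assoc_inv_nat:
  "assoc_inv (tgt T f) (tgt T g) (tgt T h) \<cdot> (f \<boxtimes>\<^sub>a (g \<boxtimes>\<^sub>a h))
   = ((f \<boxtimes>\<^sub>a g) \<boxtimes>\<^sub>a h) \<cdot> assoc_inv (src T f) (src T g) (src T h)" (is "?ai' \<cdot> ?r = ?l \<cdot> ?ai")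
proof -
  have "?ai' \<cdot> ?r = ?ai' \<cdot> (?r \<cdot> assoc T (src T f) (src T g) (src T h)) \<cdot> ?ai" by simp
  also have "\<dots> = ?l \<cdot> ?ai" by (simp flip: assoc_nat)
  finally show ?thesis .
qed

section \<open>Coherence of the units and the braiding\<close>

lemma one_whisker_inj:
  assumes "src T f = src T g" "tgt T f = tgt T g" "one \<rtimes> f = one \<rtimes> g" shows "f = g"
proof -
  have "f \<cdot> lunit T (src T g) = g \<cdot> lunit T (src T g)"
    using lunit_nat[of f] lunit_nat[of g] assms by simp
  then show ?thesis using iso_right_cancel[OF lunit_iso] assms by simp
qed

lemma whisker_one_inj:
  assumes "src T f = src T g" "tgt T f = tgt T g" "f \<ltimes> one = g \<ltimes> one" shows "f = g"
proof -
  have "f \<cdot> runit T (src T g) = g \<cdot> runit T (src T g)"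
    using runit_nat[of f] runit_nat[of g] assms by simp
  then show ?thesis using iso_right_cancel[OF runit_iso] assms by simp
qed

text \<open>Kelly's argument: tensoring with the unit is faithful, and after doing so the pentagon
  reduces the claim to triangle identities, up to the invertible \<open>?t\<close>.\<close>

lemma lunit_tensor: "lunit T (X \<boxtimes> Y) \<cdot> assoc T one X Y = lunit T X \<ltimes> Y"
proof (rule one_whisker_inj)
  let ?t = "assoc T one (one \<boxtimes> X) Y \<cdot> (assoc T one one X \<ltimes> Y)"
  have "(one \<rtimes> (lunit T (X \<boxtimes> Y) \<cdot> assoc T one X Y)) \<cdot> ?t
      = (one \<rtimes> lunit T (X \<boxtimes> Y)) \<cdot> (one \<rtimes> assoc T one X Y) \<cdot> ?t"
    by (simp add: left_whisker_cmp)
  also have "\<dots> = (one \<rtimes> lunit T (X \<boxtimes> Y)) \<cdot> assoc T one one (X \<boxtimes> Y) \<cdot> assoc T (one \<boxtimes> one) X Y"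
    by (simp only: pentagon)
  also have "\<dots> = (runit T one \<ltimes> (X \<boxtimes> Y)) \<cdot> assoc T (one \<boxtimes> one) X Y"
    using cmp_reduce[OF triangle_identity[of one "X \<boxtimes> Y"], of "assoc T (one \<boxtimes> one) X Y"] by simp
  also have "\<dots> = assoc T one X Y \<cdot> ((runit T one \<ltimes> X) \<ltimes> Y)"
    using assoc_nat[of "runit T one" "ident T X" "ident T Y"] by simp
  also have "(runit T one \<ltimes> X) \<ltimes> Y = ((one \<rtimes> lunit T X) \<ltimes> Y) \<cdot> (assoc T one one X \<ltimes> Y)"
    by (simp flip: triangle_identity add: right_whisker_cmp)
  also have "assoc T one X Y \<cdot> \<dots> = (one \<rtimes> (lunit T X \<ltimes> Y)) \<cdot> ?t"
    using cmp_reduce[OF assoc_nat[of "ident T one" "lunit T X" "ident T Y"], of "assoc T one one X \<ltimes> Y"]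
    by simp
  finally show "one \<rtimes> (lunit T (X \<boxtimes> Y) \<cdot> assoc T one X Y) = one \<rtimes> (lunit T X \<ltimes> Y)"
    by (subst (asm) iso_right_cancel) simp_all
qed simp_all

lemma runit_tensor: "(X \<rtimes> runit T Y) \<cdot> assoc T X Y one = runit T (X \<boxtimes> Y)"
proof (rule whisker_one_inj)
  have "assoc T X Y one \<cdot> (runit T (X \<boxtimes> Y) \<ltimes> one)
      = assoc T X Y one \<cdot> ((X \<boxtimes> Y) \<rtimes> lunit T one) \<cdot> assoc T (X \<boxtimes> Y) one one"
    by (simp only: triangle_identity)
  also have "\<dots> = (X \<rtimes> (Y \<rtimes> lunit T one)) \<cdot> assoc T X Y (one \<boxtimes> one) \<cdot> assoc T (X \<boxtimes> Y) one one"
    using cmp_reduce[OF assoc_nat[of "ident T X" "ident T Y" "lunit T one"], of "assoc T (X \<boxtimes> Y) one one"]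
    by simp
  also have "\<dots> = (X \<rtimes> (Y \<rtimes> lunit T one)) \<cdot> (X \<rtimes> assoc T Y one one) \<cdot> assoc T X (Y \<boxtimes> one) one \<cdot>
      (assoc T X Y one \<ltimes> one)"
    by (simp only: pentagon)
  also have "\<dots> = (X \<rtimes> (runit T Y \<ltimes> one)) \<cdot> assoc T X (Y \<boxtimes> one) one \<cdot> (assoc T X Y one \<ltimes> one)"
    by (simp flip: triangle_identity add: left_whisker_cmp)
  also have "\<dots> = assoc T X Y one \<cdot> ((X \<rtimes> runit T Y) \<ltimes> one) \<cdot> (assoc T X Y one \<ltimes> one)"
    using cmp_reduce[OF assoc_nat[of "ident T X" "runit T Y" "ident T one"], of "assoc T X Y one \<ltimes> one"]
    by simp
  finally have "runit T (X \<boxtimes> Y) \<ltimes> one = ((X \<rtimes> runit T Y) \<ltimes> one) \<cdot> (assoc T X Y one \<ltimes> one)"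
    by (subst (asm) iso_left_cancel) simp_all
  then show "((X \<rtimes> runit T Y) \<cdot> assoc T X Y one) \<ltimes> one = runit T (X \<boxtimes> Y) \<ltimes> one"
    by (simp add: right_whisker_cmp)
qed simp_all

text \<open>The triangle identity and \<open>runit_tensor\<close> express the same arrow through the
  left and through the right unit.\<close>

lemma lunit_one: "lunit T one = runit T one"
proof (rule one_whisker_inj)
  have "runit T one \<cdot> (runit T one \<ltimes> one) = runit T one \<cdot> runit T (one \<boxtimes> one)"
    using runit_nat[of "runit T one"] by simp
  then have "runit T one \<ltimes> one = runit T (one \<boxtimes> one)"
    by (subst (asm) iso_left_cancel) simp_all
  then have "(one \<rtimes> lunit T one) \<cdot> assoc T one one one = (one \<rtimes> runit T one) \<cdot> assoc T one one one"
    by (simp only: triangle_identity runit_tensor)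
  then show "one \<rtimes> lunit T one = one \<rtimes> runit T one"
    by (subst (asm) iso_right_cancel) simp_all
qed simp_all

text \<open>The hexagon for \<open>X\<close> and two copies of the unit, in which all other factors
  reduce to unit arrows.\<close>

lemma lunit_braid: "lunit T X \<cdot> braid T X one = runit T X"
proof (rule whisker_one_inj)
  let ?b = "braid T X one"
  have "(lunit T X \<cdot> ?b) \<cdot> (runit T X \<ltimes> one) = lunit T X \<cdot> ?b \<cdot> (X \<rtimes> lunit T one) \<cdot> assoc T X one one"
    by (simp add: triangle_identity)
  also have "\<dots> = lunit T X \<cdot> (lunit T one \<ltimes> X) \<cdot> braid T X (one \<boxtimes> one) \<cdot> assoc T X one one"
    using cmp_reduce[OF braid_nat[of "ident T X" "lunit T one"], of "assoc T X one one"] by simp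
  also have "\<dots> = lunit T X \<cdot> (one \<rtimes> lunit T X) \<cdot> assoc T one one X \<cdot> braid T X (one \<boxtimes> one) \<cdot> assoc T X one one"
    using cmp_reduce[OF triangle_identity[of one X], of "braid T X (one \<boxtimes> one) \<cdot> assoc T X one one"]
    by (simp add: lunit_one)
  also have "\<dots> = lunit T X \<cdot> (one \<rtimes> lunit T X) \<cdot> (one \<rtimes> ?b) \<cdot> assoc T one X one \<cdot> (?b \<ltimes> one)"
    by (simp only: hexagon)
  also have "\<dots> = lunit T X \<cdot> (one \<rtimes> (lunit T X \<cdot> ?b)) \<cdot> assoc T one X one \<cdot> (?b \<ltimes> one)"
    by (simp add: left_whisker_cmp)
  also have "\<dots> = (lunit T X \<cdot> ?b) \<cdot> lunit T (X \<boxtimes> one) \<cdot> assoc T one X one \<cdot> (?b \<ltimes> one)"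
    using cmp_reduce[OF lunit_nat[of "lunit T X \<cdot> ?b"], of "assoc T one X one \<cdot> (?b \<ltimes> one)"] by simp
  also have "\<dots> = (lunit T X \<cdot> ?b) \<cdot> (lunit T X \<ltimes> one) \<cdot> (?b \<ltimes> one)"
    using cmp_reduce[OF lunit_tensor[of X one], of "?b \<ltimes> one"] by simp
  also have "\<dots> = (lunit T X \<cdot> ?b) \<cdot> ((lunit T X \<cdot> ?b) \<ltimes> one)"
    by (simp add: right_whisker_cmp)
  finally show "(lunit T X \<cdot> ?b) \<ltimes> one = runit T X \<ltimes> one"
    by (subst (asm) iso_left_cancel) simp_all
qed simp_all

section \<open>Internal homs, duals and double duals\<close>

lemma curry:
  assumes "src T f = Z \<boxtimes> X" "tgt T f = Y"
  shows src_curry [simp]: "src T (curry_arr T Z X Y f) = Z"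
    and tgt_curry [simp]: "tgt T (curry_arr T Z X Y f) = ihom T X Y"
    and eval_curry [simp]: "eval T X Y \<cdot> (curry_arr T Z X Y f \<ltimes> X) = f"
  using theI'[OF eval_universal[of f Z X Y]] assms by (simp_all add: curry_arr_def in_Hom)

lemma eval_inj:
  assumes "src T g = src T h" "tgt T g = ihom T X Y" "tgt T h = ihom T X Y"
    "eval T X Y \<cdot> (g \<ltimes> X) = eval T X Y \<cdot> (h \<ltimes> X)"
  shows "g = h"
proof -
  have "eval T X Y \<cdot> (h \<ltimes> X) \<in> Hom T (src T h \<boxtimes> X) Y" using assms by (simp add: in_Hom)
  from eval_universal[OF this] show ?thesis using assms unfolding in_Hom by blast
qed

text \<open>Uniqueness of a representing object: \<open>ex\<close>, applied to \<open>eval\<close>,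
  yields the inverse candidate, and \<open>inj\<close> shows that it is inverse on the side of
  \<open>P\<close>.\<close>

lemma curry_universal_iso:
  assumes q: "src T q = P \<boxtimes> X" "tgt T q = Y"
    and ex: "\<And>g. src T g = ihom T X Y \<boxtimes> X \<Longrightarrow> tgt T g = Y \<Longrightarrow> \<exists>g'. src T g' = ihom T X Y \<and> tgt T g' = P \<and> q \<cdot> (g' \<ltimes> X) = g"
    and inj: "\<And>g h. \<lbrakk>src T g = P; src T h = P; tgt T g = P; tgt T h = P; q \<cdot> (g \<ltimes> X) = q \<cdot> (h \<ltimes> X)\<rbrakk> \<Longrightarrow> g = h"
  shows "is_iso T (curry_arr T P X Y q)"
proof -
  let ?c = "curry_arr T P X Y q"
  note [simp] = q
  obtain d where d: "src T d = ihom T X Y" "tgt T d = P" "q \<cdot> (d \<ltimes> X) = eval T X Y"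
    using ex[of "eval T X Y"] by auto
  have "?c \<cdot> d = ident T (ihom T X Y)"
    by (rule eval_inj[where X = X and Y = Y])
      (use d cmp_reduce[OF eval_curry[OF q], of "d \<ltimes> X"] in \<open>simp_all add: right_whisker_cmp\<close>)
  moreover have "d \<cdot> ?c = ident T P"
    by (rule inj) (use d cmp_reduce[OF d(3), of "?c \<ltimes> X"] in \<open>simp_all add: right_whisker_cmp\<close>)
  ultimately show ?thesis using d by (intro is_isoI[of d]) simp_all
qed

abbreviation D :: "'a \<Rightarrow> 'a" where "D \<equiv> dual_obj T"

definition ev :: "'a \<Rightarrow> 'b" where "ev X = eval T X one"

definition pairing :: "'a \<Rightarrow> 'b" where "pairing X = ev X \<cdot> braid T X (D X)"

lemma src_ev [simp]: "src T (ev X) = D X \<boxtimes> X" and tgt_ev [simp]: "tgt T (ev X) = one"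
  by (simp_all add: ev_def dual_obj_def)

lemma src_pairing [simp]: "src T (pairing X) = X \<boxtimes> D X" and tgt_pairing [simp]: "tgt T (pairing X) = one"
  by (simp_all add: pairing_def)

lemma ev_inj:
  "\<lbrakk>src T g = src T h; tgt T g = D X; tgt T h = D X; ev X \<cdot> (g \<ltimes> X) = ev X \<cdot> (h \<ltimes> X)\<rbrakk> \<Longrightarrow> g = h"
  using eval_inj[of g h X one] by (simp add: ev_def dual_obj_def)

lemma ev_curry:
  assumes "src T f = Z \<boxtimes> X" "tgt T f = one"
  shows "src T (curry_arr T Z X one f) = Z" "tgt T (curry_arr T Z X one f) = D X"
    "ev X \<cdot> (curry_arr T Z X one f \<ltimes> X) = f"
  using assms by (simp_all add: ev_def dual_obj_def)

lemma dual_arr: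
  shows src_dual [simp]: "src T (dual_arr T f) = D (tgt T f)" and tgt_dual [simp]: "tgt T (dual_arr T f) = D (src T f)"
    and ev_dual: "ev (src T f) \<cdot> (dual_arr T f \<ltimes> src T f) = ev (tgt T f) \<cdot> (D (tgt T f) \<rtimes> f)"
  by (simp_all add: dual_arr_def ihom_arr_def ev_def dual_obj_def)

lemma dual_ident [simp]: "dual_arr T (ident T X) = ident T (D X)"
  by (rule ev_inj[where X = X]) (use ev_dual[of "ident T X"] in simp_all)

lemma dual_cmp [simp]:
  assumes [simp]: "tgt T f = src T g"
  shows "dual_arr T (g \<cdot> f) = dual_arr T f \<cdot> dual_arr T g"
proof (rule ev_inj[where X = "src T f"])
  have "ev (src T f) \<cdot> (dual_arr T (g \<cdot> f) \<ltimes> src T f) = ev (tgt T g) \<cdot> (D (tgt T g) \<rtimes> g) \<cdot> (D (tgt T g) \<rtimes> f)"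
    using ev_dual[of "g \<cdot> f"] by (simp add: left_whisker_cmp)
  also have "\<dots> = ev (src T g) \<cdot> (dual_arr T g \<ltimes> src T g) \<cdot> (D (tgt T g) \<rtimes> f)"
    using cmp_reduce[OF ev_dual[of g], of "D (tgt T g) \<rtimes> f"] by simp
  also have "\<dots> = ev (src T g) \<cdot> (D (src T g) \<rtimes> f) \<cdot> (dual_arr T g \<ltimes> src T f)"
    by (subst whisker_exchange[of "dual_arr T g"]) simp_all
  also have "\<dots> = ev (src T f) \<cdot> (dual_arr T f \<ltimes> src T f) \<cdot> (dual_arr T g \<ltimes> src T f)"
    using cmp_reduce[OF ev_dual[of f], of "dual_arr T g \<ltimes> src T f"] by simp
  finally show "ev (src T f) \<cdot> (dual_arr T (g \<cdot> f) \<ltimes> src T f) =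
      ev (src T f) \<cdot> ((dual_arr T f \<cdot> dual_arr T g) \<ltimes> src T f)"
    by (simp add: right_whisker_cmp)
qed simp_all

definition bidual :: "'a \<Rightarrow> 'b" where
  "bidual X = curry_arr T X (D X) one (pairing X)"

lemma src_bidual [simp]: "src T (bidual X) = X" and tgt_bidual [simp]: "tgt T (bidual X) = D (D X)"
  and ev_bidual: "ev (D X) \<cdot> (bidual X \<ltimes> D X) = pairing X"
  using ev_curry[of "pairing X" X "D X"] by (simp_all add: bidual_def)

lemma bidual_natural: "dual_arr T (dual_arr T f) \<cdot> bidual (src T f) = bidual (tgt T f) \<cdot> f"
proof (rule ev_inj[where X = "D (tgt T f)"])
  let ?A = "src T f" and ?B = "tgt T f" and ?Df = "dual_arr T f"
  have "ev (D ?B) \<cdot> ((dual_arr T ?Df \<cdot> bidual ?A) \<ltimes> D ?B)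
      = ev (D ?B) \<cdot> (dual_arr T ?Df \<ltimes> D ?B) \<cdot> (bidual ?A \<ltimes> D ?B)"
    by (simp add: right_whisker_cmp)
  also have "\<dots> = ev (D ?A) \<cdot> (D (D ?A) \<rtimes> ?Df) \<cdot> (bidual ?A \<ltimes> D ?B)"
    using cmp_reduce[OF ev_dual[of ?Df], of "bidual ?A \<ltimes> D ?B"] by simp
  also have "\<dots> = ev (D ?A) \<cdot> (bidual ?A \<ltimes> D ?A) \<cdot> (?A \<rtimes> ?Df)"
    by (subst whisker_exchange[of "bidual ?A" ?A _ ?Df]) simp_all
  also have "\<dots> = ev ?A \<cdot> braid T ?A (D ?A) \<cdot> (?A \<rtimes> ?Df)"
    using cmp_reduce[OF ev_bidual[of ?A], of "?A \<rtimes> ?Df"] by (simp add: pairing_def)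
  also have "\<dots> = ev ?A \<cdot> (?Df \<ltimes> ?A) \<cdot> braid T ?A (D ?B)"
    using braid_nat[of "ident T ?A" ?Df] by simp
  also have "\<dots> = ev ?B \<cdot> (D ?B \<rtimes> f) \<cdot> braid T ?A (D ?B)"
    using cmp_reduce[OF ev_dual[of f], of "braid T ?A (D ?B)"] by simp
  also have "\<dots> = pairing ?B \<cdot> (f \<ltimes> D ?B)"
    using braid_nat[of f "ident T (D ?B)"] by (simp add: pairing_def)
  also have "\<dots> = ev (D ?B) \<cdot> (bidual ?B \<ltimes> D ?B) \<cdot> (f \<ltimes> D ?B)"
    using cmp_reduce[OF ev_bidual[of ?B], of "f \<ltimes> D ?B"] by simp
  finally show "ev (D ?B) \<cdot> ((dual_arr T ?Df \<cdot> bidual ?A) \<ltimes> D ?B) = ev (D ?B) \<cdot> ((bidual ?B \<cdot> f) \<ltimes> D ?B)"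
    by (simp add: right_whisker_cmp)
qed simp_all

text \<open>A triangle identity for the adjunction of \<open>D\<close> with itself. It holds for
  every \<open>X\<close>, as two braidings cancel, and identifies the inverse of a dualised
  \<open>bidual\<close>.\<close>

lemma dual_bidual: "dual_arr T (bidual X) \<cdot> bidual (D X) = ident T (D X)"
proof (rule ev_inj[where X = X])
  have "ev X \<cdot> ((dual_arr T (bidual X) \<cdot> bidual (D X)) \<ltimes> X)
      = ev X \<cdot> (dual_arr T (bidual X) \<ltimes> X) \<cdot> (bidual (D X) \<ltimes> X)"
    by (simp add: right_whisker_cmp)
  also have "\<dots> = ev (D (D X)) \<cdot> (D (D (D X)) \<rtimes> bidual X) \<cdot> (bidual (D X) \<ltimes> X)"
    using cmp_reduce[OF ev_dual[of "bidual X"], of "bidual (D X) \<ltimes> X"] by simp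
  also have "\<dots> = ev (D (D X)) \<cdot> (bidual (D X) \<ltimes> D (D X)) \<cdot> (D X \<rtimes> bidual X)"
    by (subst whisker_exchange[of "bidual (D X)" "D X"]) simp_all
  also have "\<dots> = ev (D X) \<cdot> braid T (D X) (D (D X)) \<cdot> (D X \<rtimes> bidual X)"
    using cmp_reduce[OF ev_bidual[of "D X"], of "D X \<rtimes> bidual X"] by (simp add: pairing_def)
  also have "\<dots> = ev (D X) \<cdot> (bidual X \<ltimes> D X) \<cdot> braid T (D X) X"
    using braid_nat[of "ident T (D X)" "bidual X"] by simp
  also have "\<dots> = ev X \<cdot> braid T X (D X) \<cdot> braid T (D X) X"
    using cmp_reduce[OF ev_bidual[of X], of "braid T (D X) X"] by (simp add: pairing_def)
  also have "\<dots> = ev X" by (simp add: braid_symmetric)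
  finally show "ev X \<cdot> ((dual_arr T (bidual X) \<cdot> bidual (D X)) \<ltimes> X) = ev X \<cdot> (ident T (D X) \<ltimes> X)"
    by simp
qed simp_all

text \<open>The uncurried form of \<open>rigid_map\<close>. For rigid \<open>X\<close> it has the
  universal property of \<open>eval\<close>, with \<open>D X \<boxtimes> Y\<close> as the internal
  hom.\<close>

definition rigid_eval :: "'a \<Rightarrow> 'a \<Rightarrow> 'b" where
  "rigid_eval X Y = lunit T Y \<cdot> (ev X \<ltimes> Y) \<cdot> assoc_inv (D X) X Y \<cdot>
      (D X \<rtimes> braid T Y X) \<cdot> assoc T (D X) Y X"

lemma src_rigid_eval [simp]: "src T (rigid_eval X Y) = (D X \<boxtimes> Y) \<boxtimes> X"
  and tgt_rigid_eval [simp]: "tgt T (rigid_eval X Y) = Y"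
  by (simp_all add: rigid_eval_def)

lemma rigid_map: "rigid_map T X Y = curry_arr T (D X \<boxtimes> Y) X Y (rigid_eval X Y)"
  by (simp add: rigid_map_def rigid_eval_def ev_def)

text \<open>The evaluation \<open>X \<boxtimes> (DX \<boxtimes> Y) \<rightarrow> Y\<close> with \<open>X\<close> on the other side, which needs no braiding of \<open>Y\<close>.\<close>

definition left_eval :: "'a \<Rightarrow> 'a \<Rightarrow> 'b" where
  "left_eval X Y = lunit T Y \<cdot> (pairing X \<ltimes> Y) \<cdot> assoc_inv X (D X) Y"

lemma src_left_eval [simp]: "src T (left_eval X Y) = X \<boxtimes> (D X \<boxtimes> Y)"
  and tgt_left_eval [simp]: "tgt T (left_eval X Y) = Y"
  by (simp_all add: left_eval_def)

text \<open>The hexagon splits the braiding past \<open>D X \<boxtimes> Y\<close>; its part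
  involving \<open>Y\<close> cancels against the braiding inside \<open>rigid_eval\<close>.\<close>

lemma rigid_eval_braid: "rigid_eval X Y \<cdot> braid T X (D X \<boxtimes> Y) = left_eval X Y"
proof -
  let ?ai = "assoc_inv (D X) X Y" and ?a = "assoc T X (D X) Y"
  have "(rigid_eval X Y \<cdot> braid T X (D X \<boxtimes> Y)) \<cdot> ?a
      = lunit T Y \<cdot> (ev X \<ltimes> Y) \<cdot> ?ai \<cdot> (D X \<rtimes> braid T Y X) \<cdot> (D X \<rtimes> braid T X Y) \<cdot>
        assoc T (D X) X Y \<cdot> (braid T X (D X) \<ltimes> Y)"
    by (simp add: rigid_eval_def hexagon)
  also have "\<dots> = lunit T Y \<cdot> (ev X \<ltimes> Y) \<cdot> ?ai \<cdot> (D X \<rtimes> (braid T Y X \<cdot> braid T X Y)) \<cdot>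
        assoc T (D X) X Y \<cdot> (braid T X (D X) \<ltimes> Y)"
    by (simp add: left_whisker_cmp)
  also have "\<dots> = lunit T Y \<cdot> (pairing X \<ltimes> Y)"
    by (simp add: braid_symmetric pairing_def right_whisker_cmp)
  also have "\<dots> = left_eval X Y \<cdot> ?a" by (simp add: left_eval_def)
  finally show ?thesis by (subst (asm) iso_right_cancel) simp_all
qed

lemma left_eval_natural: "f \<cdot> left_eval X (src T f) = left_eval X (tgt T f) \<cdot> (X \<rtimes> (D X \<rtimes> f))"
proof -
  let ?Y = "src T f" and ?Z = "tgt T f"
  have "left_eval X ?Z \<cdot> (X \<rtimes> (D X \<rtimes> f))
      = lunit T ?Z \<cdot> (pairing X \<ltimes> ?Z) \<cdot> ((X \<boxtimes> D X) \<rtimes> f) \<cdot> assoc_inv X (D X) ?Y"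
    using assoc_inv_nat[of "ident T X" "ident T (D X)" f] by (simp add: left_eval_def)
  also have "\<dots> = lunit T ?Z \<cdot> (one \<rtimes> f) \<cdot> (pairing X \<ltimes> ?Y) \<cdot> assoc_inv X (D X) ?Y"
    using cmp_reduce[OF whisker_exchange[of "pairing X" "X \<boxtimes> D X" one f ?Y ?Z],
        of "assoc_inv X (D X) ?Y"] by simp
  also have "\<dots> = f \<cdot> left_eval X ?Y"
    using cmp_reduce[OF lunit_nat[of f], of "(pairing X \<ltimes> ?Y) \<cdot> assoc_inv X (D X) ?Y"]
    by (simp add: left_eval_def)
  finally show ?thesis ..
qed

lemma left_eval_assoc:
  "left_eval X (Y \<boxtimes> V) \<cdot> (X \<rtimes> assoc T (D X) Y V) \<cdot> assoc T X (D X \<boxtimes> Y) V = left_eval X Y \<ltimes> V"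
proof -
  let ?a = "assoc T X (D X) Y \<ltimes> V" and ?p = "pairing X"
  have "(left_eval X (Y \<boxtimes> V) \<cdot> (X \<rtimes> assoc T (D X) Y V) \<cdot> assoc T X (D X \<boxtimes> Y) V) \<cdot> ?a
      = left_eval X (Y \<boxtimes> V) \<cdot> assoc T X (D X) (Y \<boxtimes> V) \<cdot> assoc T (X \<boxtimes> D X) Y V"
    by (simp add: pentagon)
  also have "\<dots> = lunit T (Y \<boxtimes> V) \<cdot> (?p \<ltimes> (Y \<boxtimes> V)) \<cdot> assoc T (X \<boxtimes> D X) Y V"
    by (simp add: left_eval_def)
  also have "\<dots> = lunit T (Y \<boxtimes> V) \<cdot> assoc T one Y V \<cdot> ((?p \<ltimes> Y) \<ltimes> V)"
    using assoc_nat[of ?p "ident T Y" "ident T V"] by simp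
  also have "\<dots> = (lunit T Y \<ltimes> V) \<cdot> ((?p \<ltimes> Y) \<ltimes> V)"
    using cmp_reduce[OF lunit_tensor[of Y V], of "(?p \<ltimes> Y) \<ltimes> V"] by simp
  also have "\<dots> = (left_eval X Y \<cdot> assoc T X (D X) Y) \<ltimes> V"
    by (simp add: left_eval_def right_whisker_cmp)
  also have "\<dots> = (left_eval X Y \<ltimes> V) \<cdot> ?a" by (simp add: right_whisker_cmp)
  finally show ?thesis by (subst (asm) iso_right_cancel) simp_all
qed

lemma left_eval_one: "left_eval X one = pairing X \<cdot> (X \<rtimes> runit T (D X))"
proof -
  let ?a = "assoc T X (D X) one" and ?p = "pairing X"
  have "left_eval X one \<cdot> ?a = runit T one \<cdot> (?p \<ltimes> one)" by (simp add: left_eval_def lunit_one)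
  also have "\<dots> = ?p \<cdot> runit T (X \<boxtimes> D X)" using runit_nat[of ?p] by simp
  also have "\<dots> = (?p \<cdot> (X \<rtimes> runit T (D X))) \<cdot> ?a" by (simp add: runit_tensor)
  finally show ?thesis by (subst (asm) iso_right_cancel) simp_all
qed

lemma rigid_eval_one: "rigid_eval X one = ev X \<cdot> (runit T (D X) \<ltimes> X)"
proof -
  let ?b = "braid T X (D X \<boxtimes> one)"
  have "rigid_eval X one \<cdot> ?b = ev X \<cdot> braid T X (D X) \<cdot> (X \<rtimes> runit T (D X))"
    by (simp add: rigid_eval_braid left_eval_one pairing_def)
  also have "\<dots> = (ev X \<cdot> (runit T (D X) \<ltimes> X)) \<cdot> ?b"
    using braid_nat[of "ident T X" "runit T (D X)"] by simp
  finally show ?thesis by (subst (asm) iso_right_cancel) simp_all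
qed

lemma rigid_eval_natural: "f \<cdot> rigid_eval X (src T f) = rigid_eval X (tgt T f) \<cdot> ((D X \<rtimes> f) \<ltimes> X)"
proof -
  let ?b = "braid T X (D X \<boxtimes> src T f)"
  have "(f \<cdot> rigid_eval X (src T f)) \<cdot> ?b = left_eval X (tgt T f) \<cdot> (X \<rtimes> (D X \<rtimes> f))"
    by (simp add: rigid_eval_braid left_eval_natural)
  also have "\<dots> = rigid_eval X (tgt T f) \<cdot> braid T X (D X \<boxtimes> tgt T f) \<cdot> (X \<rtimes> (D X \<rtimes> f))"
    using cmp_reduce[OF rigid_eval_braid[of X "tgt T f"], of "X \<rtimes> (D X \<rtimes> f)"] by simp
  also have "\<dots> = (rigid_eval X (tgt T f) \<cdot> ((D X \<rtimes> f) \<ltimes> X)) \<cdot> ?b"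
    using braid_nat[of "ident T X" "D X \<rtimes> f"] by simp
  finally show ?thesis by (subst (asm) iso_right_cancel) simp_all
qed

section \<open>Universal properties attached to a rigid object\<close>

lemma rigid_eval_universal:
  assumes X: "rigid T X" and g: "src T g = W \<boxtimes> X" "tgt T g = Y"
  obtains g' where "src T g' = W" "tgt T g' = D X \<boxtimes> Y" "rigid_eval X Y \<cdot> (g' \<ltimes> X) = g"
proof -
  have iso: "is_iso T (rigid_map T X Y)" using X by (simp add: rigid_def)
  let ?c = "curry_arr T W X Y g"
  have r: "src T (rigid_map T X Y) = D X \<boxtimes> Y" "tgt T (rigid_map T X Y) = ihom T X Y"
    "eval T X Y \<cdot> (rigid_map T X Y \<ltimes> X) = rigid_eval X Y"
    by (simp_all add: rigid_map)
  let ?g = "inv_arr T (rigid_map T X Y) \<cdot> ?c"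
  have "rigid_eval X Y \<cdot> (?g \<ltimes> X) = eval T X Y \<cdot> (rigid_map T X Y \<ltimes> X) \<cdot> (?g \<ltimes> X)"
    using cmp_reduce[OF r(3), of "?g \<ltimes> X"] r g iso by simp
  also have "\<dots> = eval T X Y \<cdot> ((rigid_map T X Y \<cdot> ?g) \<ltimes> X)"
    using r g iso by (subst right_whisker_cmp) simp_all
  also have "\<dots> = g" using r g iso by simp
  finally show ?thesis using r g iso by (intro that[of ?g]) simp_all
qed

lemma rigid_eval_inj:
  assumes X: "rigid T X" and g: "src T g = src T h" "tgt T g = D X \<boxtimes> Y" "tgt T h = D X \<boxtimes> Y"
    and eq: "rigid_eval X Y \<cdot> (g \<ltimes> X) = rigid_eval X Y \<cdot> (h \<ltimes> X)"
  shows "g = h"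
proof -
  have iso: "is_iso T (rigid_map T X Y)" using X by (simp add: rigid_def)
  have r: "src T (rigid_map T X Y) = D X \<boxtimes> Y" "tgt T (rigid_map T X Y) = ihom T X Y"
    "eval T X Y \<cdot> (rigid_map T X Y \<ltimes> X) = rigid_eval X Y"
    by (simp_all add: rigid_map)
  have *: "eval T X Y \<cdot> ((rigid_map T X Y \<cdot> g) \<ltimes> X) = rigid_eval X Y \<cdot> (g \<ltimes> X)" if "tgt T g = D X \<boxtimes> Y" for g
    using cmp_reduce[OF r(3), of "g \<ltimes> X"] r that by (simp add: right_whisker_cmp)
  have "rigid_map T X Y \<cdot> g = rigid_map T X Y \<cdot> h"
    by (rule eval_inj[where X = X and Y = Y]) (use r g eq * in simp_all)
  then show ?thesis using iso r g by (subst (asm) iso_left_cancel) simp_all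
qed

lemma left_eval_universal:
  assumes X: "rigid T X" and g: "src T g = X \<boxtimes> W" "tgt T g = Y"
  obtains g' where "src T g' = W" "tgt T g' = D X \<boxtimes> Y" "left_eval X Y \<cdot> (X \<rtimes> g') = g"
proof -
  obtain g' where g': "src T g' = W" "tgt T g' = D X \<boxtimes> Y" "rigid_eval X Y \<cdot> (g' \<ltimes> X) = g \<cdot> braid T W X"
    using rigid_eval_universal[OF X, of "g \<cdot> braid T W X" W Y] g by auto
  have "left_eval X Y \<cdot> (X \<rtimes> g') = rigid_eval X Y \<cdot> (g' \<ltimes> X) \<cdot> braid T X W"
    using cmp_reduce[OF rigid_eval_braid[of X Y], of "X \<rtimes> g'"] braid_nat[of "ident T X" g'] g' by simp
  also have "\<dots> = g" using cmp_reduce[OF g'(3), of "braid T X W"] g g' by (simp add: braid_symmetric)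
  finally show ?thesis using g' that by blast
qed

lemma left_eval_inj:
  assumes X: "rigid T X" and g: "src T g = src T h" "tgt T g = D X \<boxtimes> Y" "tgt T h = D X \<boxtimes> Y"
    and eq: "left_eval X Y \<cdot> (X \<rtimes> g) = left_eval X Y \<cdot> (X \<rtimes> h)"
  shows "g = h"
proof (rule rigid_eval_inj[OF X g])
  have *: "(rigid_eval X Y \<cdot> (g \<ltimes> X)) \<cdot> braid T X (src T g) = left_eval X Y \<cdot> (X \<rtimes> g)" if "tgt T g = D X \<boxtimes> Y" for g
    using cmp_reduce[OF rigid_eval_braid[of X Y], of "X \<rtimes> g"] braid_nat[of "ident T X" g] that by simp
  have "(rigid_eval X Y \<cdot> (g \<ltimes> X)) \<cdot> braid T X (src T h) = (rigid_eval X Y \<cdot> (h \<ltimes> X)) \<cdot> braid T X (src T h)"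
    using *[of g] *[of h] g eq by simp
  then show "rigid_eval X Y \<cdot> (g \<ltimes> X) = rigid_eval X Y \<cdot> (h \<ltimes> X)"
    by (subst (asm) iso_right_cancel) (use g in simp_all)
qed

text \<open>The coevaluation \<open>\<one> \<rightarrow> DX \<boxtimes> X\<close> of a rigid object is defined by one of the two zigzag identities.
  The other one holds because both of its sides have the same image under the universal arrow.\<close>

lemma coevaluation:
  assumes X: "rigid T X"
  obtains c where "src T c = one" "tgt T c = D X \<boxtimes> X" "left_eval X X \<cdot> (X \<rtimes> c) = runit T X"
    "runit T (D X) \<cdot> (D X \<rtimes> pairing X) \<cdot> assoc T (D X) X (D X) \<cdot> (c \<ltimes> D X) = lunit T (D X)"
proof -
  obtain c where c: "src T c = one" "tgt T c = D X \<boxtimes> X" "left_eval X X \<cdot> (X \<rtimes> c) = runit T X"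
    using left_eval_universal[OF X, of "runit T X" one X] by auto
  let ?p = "pairing X" and ?D = "D X"
  let ?z = "(?D \<rtimes> ?p) \<cdot> assoc T ?D X ?D \<cdot> (c \<ltimes> ?D)"
  have "left_eval X one \<cdot> (X \<rtimes> ?z) =
      left_eval X one \<cdot> (X \<rtimes> (?D \<rtimes> ?p)) \<cdot> (X \<rtimes> assoc T ?D X ?D) \<cdot> (X \<rtimes> (c \<ltimes> ?D))"
    using c by (simp add: left_whisker_cmp)
  also have "\<dots> = ?p \<cdot> left_eval X (X \<boxtimes> ?D) \<cdot> (X \<rtimes> assoc T ?D X ?D) \<cdot> (X \<rtimes> (c \<ltimes> ?D))"
    using cmp_reduce[OF left_eval_natural[of ?p X, symmetric], of "(X \<rtimes> assoc T ?D X ?D) \<cdot> (X \<rtimes> (c \<ltimes> ?D))"] c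
    by simp
  finally have "(left_eval X one \<cdot> (X \<rtimes> ?z)) \<cdot> assoc T X one ?D =
      ?p \<cdot> left_eval X (X \<boxtimes> ?D) \<cdot> (X \<rtimes> assoc T ?D X ?D) \<cdot> (X \<rtimes> (c \<ltimes> ?D)) \<cdot> assoc T X one ?D"
    using c by simp
  also have "\<dots> = ?p \<cdot> left_eval X (X \<boxtimes> ?D) \<cdot> (X \<rtimes> assoc T ?D X ?D) \<cdot> assoc T X (?D \<boxtimes> X) ?D \<cdot> ((X \<rtimes> c) \<ltimes> ?D)"
    using assoc_nat[of "ident T X" c "ident T ?D"] c by simp
  also have "\<dots> = ?p \<cdot> (left_eval X X \<ltimes> ?D) \<cdot> ((X \<rtimes> c) \<ltimes> ?D)"
    using cmp_reduce3[OF left_eval_assoc[of X X ?D], of "(X \<rtimes> c) \<ltimes> ?D"] c by simp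
  also have "\<dots> = ?p \<cdot> (runit T X \<ltimes> ?D)"
    using c right_whisker_cmp[of "X \<rtimes> c" "left_eval X X" ?D] by simp
  also have "\<dots> = (?p \<cdot> (X \<rtimes> lunit T ?D)) \<cdot> assoc T X one ?D"
    by (simp add: triangle_identity)
  finally have 1: "left_eval X one \<cdot> (X \<rtimes> ?z) = ?p \<cdot> (X \<rtimes> lunit T ?D)"
    by (subst (asm) iso_right_cancel) (use c in simp_all)
  have "left_eval X one \<cdot> (X \<rtimes> (inv_arr T (runit T ?D) \<cdot> lunit T ?D)) =
      ?p \<cdot> (X \<rtimes> runit T ?D) \<cdot> (X \<rtimes> (inv_arr T (runit T ?D) \<cdot> lunit T ?D))"
    by (simp add: left_eval_one)
  also have "\<dots> = ?p \<cdot> (X \<rtimes> (runit T ?D \<cdot> inv_arr T (runit T ?D) \<cdot> lunit T ?D))"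
    by (subst left_whisker_cmp) simp_all
  also have "\<dots> = ?p \<cdot> (X \<rtimes> lunit T ?D)" by simp
  finally have 2: "left_eval X one \<cdot> (X \<rtimes> (inv_arr T (runit T ?D) \<cdot> lunit T ?D)) = ?p \<cdot> (X \<rtimes> lunit T ?D)" .
  have "?z = inv_arr T (runit T ?D) \<cdot> lunit T ?D"
  proof (rule left_eval_inj[OF X])
    show "left_eval X one \<cdot> (X \<rtimes> ?z) = left_eval X one \<cdot> (X \<rtimes> (inv_arr T (runit T ?D) \<cdot> lunit T ?D))"
      by (simp only: 1 2)
  qed (simp_all add: c(1,2))
  then have "runit T ?D \<cdot> ?z = runit T ?D \<cdot> inv_arr T (runit T ?D) \<cdot> lunit T ?D" by (rule arg_cong)
  then show ?thesis using c by (intro that[of c]) simp_all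
qed

text \<open>For rigid \<open>X\<close> this makes \<open>Y \<boxtimes> X\<close> an internal hom
  from \<open>D X\<close> to \<open>Y\<close>, the source of both reflexivity and the rigidity of
  \<open>D X\<close>.\<close>

definition right_eval :: "'a \<Rightarrow> 'a \<Rightarrow> 'b" where
  "right_eval X Y = runit T Y \<cdot> (Y \<rtimes> pairing X) \<cdot> assoc T Y X (D X)"

lemma src_right_eval [simp]: "src T (right_eval X Y) = (Y \<boxtimes> X) \<boxtimes> D X"
  and tgt_right_eval [simp]: "tgt T (right_eval X Y) = Y"
  by (simp_all add: right_eval_def)

lemma right_eval_natural: "right_eval X (tgt T f) \<cdot> ((f \<ltimes> X) \<ltimes> D X) = f \<cdot> right_eval X (src T f)"
proof -
  let ?Y = "src T f" and ?Z = "tgt T f"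
  have "right_eval X ?Z \<cdot> ((f \<ltimes> X) \<ltimes> D X)
      = runit T ?Z \<cdot> (?Z \<rtimes> pairing X) \<cdot> (f \<ltimes> (X \<boxtimes> D X)) \<cdot> assoc T ?Y X (D X)"
    using assoc_nat[of f "ident T X" "ident T (D X)"] by (simp add: right_eval_def)
  also have "\<dots> = runit T ?Z \<cdot> (f \<ltimes> one) \<cdot> (?Y \<rtimes> pairing X) \<cdot> assoc T ?Y X (D X)"
    using cmp_reduce[OF whisker_exchange[of f ?Y ?Z "pairing X" "X \<boxtimes> D X" one], of "assoc T ?Y X (D X)"]
    by simp
  also have "\<dots> = f \<cdot> right_eval X ?Y"
    using cmp_reduce[OF runit_nat[of f], of "(?Y \<rtimes> pairing X) \<cdot> assoc T ?Y X (D X)"]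
    by (simp add: right_eval_def)
  finally show ?thesis .
qed

text \<open>The first zigzag identity tensored with \<open>Y\<close>; the pentagon rearranges the
  associators so that it can be applied.\<close>

lemma right_eval_coev:
  assumes c: "src T c = one" "tgt T c = D X \<boxtimes> X" "left_eval X X \<cdot> (X \<rtimes> c) = runit T X"
  shows "(right_eval X Y \<ltimes> X) \<cdot> assoc_inv (Y \<boxtimes> X) (D X) X \<cdot> ((Y \<boxtimes> X) \<rtimes> c) = runit T (Y \<boxtimes> X)"
proof -
  let ?p = "pairing X" and ?D = "D X"
  have pent: "(assoc T Y X ?D \<ltimes> X) \<cdot> assoc_inv (Y \<boxtimes> X) ?D X
      = assoc_inv Y (X \<boxtimes> ?D) X \<cdot> (Y \<rtimes> assoc_inv X ?D X) \<cdot> assoc T Y X (?D \<boxtimes> X)"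
  proof -
    have "(Y \<rtimes> assoc T X ?D X) \<cdot> assoc T Y (X \<boxtimes> ?D) X \<cdot> (assoc T Y X ?D \<ltimes> X) \<cdot> assoc_inv (Y \<boxtimes> X) ?D X
       = assoc T Y X (?D \<boxtimes> X)"
      using cmp_reduce3[OF pentagon[of Y X ?D X], of "assoc_inv (Y \<boxtimes> X) ?D X"] by simp
    then have "(Y \<rtimes> assoc_inv X ?D X) \<cdot> assoc T Y X (?D \<boxtimes> X) =
       (Y \<rtimes> assoc_inv X ?D X) \<cdot> (Y \<rtimes> assoc T X ?D X) \<cdot> assoc T Y (X \<boxtimes> ?D) X \<cdot> (assoc T Y X ?D \<ltimes> X) \<cdot> assoc_inv (Y \<boxtimes> X) ?D X"
      by simp
    also have "\<dots> = assoc T Y (X \<boxtimes> ?D) X \<cdot> (assoc T Y X ?D \<ltimes> X) \<cdot> assoc_inv (Y \<boxtimes> X) ?D X"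
      using cmp_reduce[OF left_whisker_cmp[of "assoc T X ?D X" "assoc_inv X ?D X" Y, symmetric],
          of "assoc T Y (X \<boxtimes> ?D) X \<cdot> (assoc T Y X ?D \<ltimes> X) \<cdot> assoc_inv (Y \<boxtimes> X) ?D X"] by simp
    finally show ?thesis by simp
  qed
  have zig: "lunit T X \<cdot> (?p \<ltimes> X) \<cdot> assoc_inv X ?D X \<cdot> (X \<rtimes> c) = runit T X"
    using c by (simp add: left_eval_def)
  have "(right_eval X Y \<ltimes> X) \<cdot> assoc_inv (Y \<boxtimes> X) ?D X \<cdot> ((Y \<boxtimes> X) \<rtimes> c)
     = (runit T Y \<ltimes> X) \<cdot> ((Y \<rtimes> ?p) \<ltimes> X) \<cdot> (assoc T Y X ?D \<ltimes> X) \<cdot> assoc_inv (Y \<boxtimes> X) ?D X \<cdot> ((Y \<boxtimes> X) \<rtimes> c)"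
    using c by (simp add: right_eval_def right_whisker_cmp)
  also have "\<dots> = (runit T Y \<ltimes> X) \<cdot> ((Y \<rtimes> ?p) \<ltimes> X) \<cdot> assoc_inv Y (X \<boxtimes> ?D) X \<cdot>
      (Y \<rtimes> assoc_inv X ?D X) \<cdot> assoc T Y X (?D \<boxtimes> X) \<cdot> ((Y \<boxtimes> X) \<rtimes> c)"
    using cmp_reduce[OF pent, of "(Y \<boxtimes> X) \<rtimes> c"] c by simp
  also have "\<dots> = (runit T Y \<ltimes> X) \<cdot> ((Y \<rtimes> ?p) \<ltimes> X) \<cdot> assoc_inv Y (X \<boxtimes> ?D) X \<cdot>
      (Y \<rtimes> assoc_inv X ?D X) \<cdot> (Y \<rtimes> (X \<rtimes> c)) \<cdot> assoc T Y X one"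
    using assoc_nat[of "ident T Y" "ident T X" c] c by simp
  also have "\<dots> = (runit T Y \<ltimes> X) \<cdot> assoc_inv Y one X \<cdot> (Y \<rtimes> (?p \<ltimes> X)) \<cdot>
      (Y \<rtimes> assoc_inv X ?D X) \<cdot> (Y \<rtimes> (X \<rtimes> c)) \<cdot> assoc T Y X one"
    using cmp_reduce[OF assoc_inv_nat[of "ident T Y" ?p "ident T X", symmetric],
       of "(Y \<rtimes> assoc_inv X ?D X) \<cdot> (Y \<rtimes> (X \<rtimes> c)) \<cdot> assoc T Y X one"] c by simp
  also have "(runit T Y \<ltimes> X) = (Y \<rtimes> lunit T X) \<cdot> assoc T Y one X" by (simp add: triangle_identity)
  also have "((Y \<rtimes> lunit T X) \<cdot> assoc T Y one X) \<cdot> assoc_inv Y one X \<cdot> (Y \<rtimes> (?p \<ltimes> X)) \<cdot>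
      (Y \<rtimes> assoc_inv X ?D X) \<cdot> (Y \<rtimes> (X \<rtimes> c)) \<cdot> assoc T Y X one =
      (Y \<rtimes> (lunit T X \<cdot> (?p \<ltimes> X) \<cdot> assoc_inv X ?D X \<cdot> (X \<rtimes> c))) \<cdot> assoc T Y X one"
    using c by (simp add: left_whisker_cmp)
  also have "\<dots> = runit T (Y \<boxtimes> X)" unfolding zig by (rule runit_tensor)
  finally show ?thesis .
qed

text \<open>The same with the second zigzag identity, tensored with \<open>W\<close>.\<close>

lemma right_eval_coev2:
  assumes c: "src T c = one" "tgt T c = D X \<boxtimes> X"
    "runit T (D X) \<cdot> (D X \<rtimes> pairing X) \<cdot> assoc T (D X) X (D X) \<cdot> (c \<ltimes> D X) = lunit T (D X)"
  shows "right_eval X (W \<boxtimes> D X) \<cdot> (assoc_inv W (D X) X \<ltimes> D X) \<cdot> ((W \<rtimes> c) \<ltimes> D X) = runit T W \<ltimes> D X"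
proof -
  let ?p = "pairing X" and ?D = "D X"
  have pent: "assoc T (W \<boxtimes> ?D) X ?D \<cdot> (assoc_inv W ?D X \<ltimes> ?D)
     = assoc_inv W ?D (X \<boxtimes> ?D) \<cdot> (W \<rtimes> assoc T ?D X ?D) \<cdot> assoc T W (?D \<boxtimes> X) ?D"
  proof -
    have "assoc T W ?D (X \<boxtimes> ?D) \<cdot> assoc T (W \<boxtimes> ?D) X ?D \<cdot> (assoc_inv W ?D X \<ltimes> ?D) =
      (W \<rtimes> assoc T ?D X ?D) \<cdot> assoc T W (?D \<boxtimes> X) ?D \<cdot> (assoc T W ?D X \<ltimes> ?D) \<cdot> (assoc_inv W ?D X \<ltimes> ?D)"
      using cmp_reduce3[OF pentagon[of W ?D X ?D], of "assoc_inv W ?D X \<ltimes> ?D"] by simp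
    also have "(assoc T W ?D X \<ltimes> ?D) \<cdot> (assoc_inv W ?D X \<ltimes> ?D) = ident T ((W \<boxtimes> (?D \<boxtimes> X)) \<boxtimes> ?D)"
      by (simp flip: right_whisker_cmp)
    finally have *: "assoc T W ?D (X \<boxtimes> ?D) \<cdot> assoc T (W \<boxtimes> ?D) X ?D \<cdot> (assoc_inv W ?D X \<ltimes> ?D) =
      (W \<rtimes> assoc T ?D X ?D) \<cdot> assoc T W (?D \<boxtimes> X) ?D" by simp
    show ?thesis
      by (subst *[symmetric]) simp
  qed
  have "right_eval X (W \<boxtimes> ?D) \<cdot> (assoc_inv W ?D X \<ltimes> ?D) \<cdot> ((W \<rtimes> c) \<ltimes> ?D)
     = runit T (W \<boxtimes> ?D) \<cdot> ((W \<boxtimes> ?D) \<rtimes> ?p) \<cdot> assoc_inv W ?D (X \<boxtimes> ?D) \<cdot> (W \<rtimes> assoc T ?D X ?D) \<cdot>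
       assoc T W (?D \<boxtimes> X) ?D \<cdot> ((W \<rtimes> c) \<ltimes> ?D)"
    using cmp_reduce[OF pent, of "(W \<rtimes> c) \<ltimes> ?D"] c by (simp add: right_eval_def)
  also have "\<dots> = runit T (W \<boxtimes> ?D) \<cdot> ((W \<boxtimes> ?D) \<rtimes> ?p) \<cdot> assoc_inv W ?D (X \<boxtimes> ?D) \<cdot> (W \<rtimes> assoc T ?D X ?D) \<cdot>
       (W \<rtimes> (c \<ltimes> ?D)) \<cdot> assoc T W one ?D"
    using assoc_nat[of "ident T W" c "ident T ?D"] c by simp
  also have "\<dots> = runit T (W \<boxtimes> ?D) \<cdot> assoc_inv W ?D one \<cdot> (W \<rtimes> (?D \<rtimes> ?p)) \<cdot> (W \<rtimes> assoc T ?D X ?D) \<cdot>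
       (W \<rtimes> (c \<ltimes> ?D)) \<cdot> assoc T W one ?D"
    using cmp_reduce[OF assoc_inv_nat[of "ident T W" "ident T ?D" ?p, symmetric],
       of "(W \<rtimes> assoc T ?D X ?D) \<cdot> (W \<rtimes> (c \<ltimes> ?D)) \<cdot> assoc T W one ?D"] c by simp
  also have "runit T (W \<boxtimes> ?D) = (W \<rtimes> runit T ?D) \<cdot> assoc T W ?D one" by (simp add: runit_tensor)
  also have "((W \<rtimes> runit T ?D) \<cdot> assoc T W ?D one) \<cdot> assoc_inv W ?D one \<cdot> (W \<rtimes> (?D \<rtimes> ?p)) \<cdot>
       (W \<rtimes> assoc T ?D X ?D) \<cdot> (W \<rtimes> (c \<ltimes> ?D)) \<cdot> assoc T W one ?D
     = (W \<rtimes> (runit T ?D \<cdot> (?D \<rtimes> ?p) \<cdot> assoc T ?D X ?D \<cdot> (c \<ltimes> ?D))) \<cdot> assoc T W one ?D"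
    using c(1,2) by (simp add: left_whisker_cmp)
  also have "\<dots> = runit T W \<ltimes> ?D" unfolding c(3) by (rule triangle_identity)
  finally show ?thesis .
qed

lemma right_eval_universal:
  assumes X: "rigid T X" and g: "src T g = W \<boxtimes> D X" "tgt T g = Y"
  obtains g' where "src T g' = W" "tgt T g' = Y \<boxtimes> X" "right_eval X Y \<cdot> (g' \<ltimes> D X) = g"
proof -
  obtain c where c: "src T c = one" "tgt T c = D X \<boxtimes> X"
    "runit T (D X) \<cdot> (D X \<rtimes> pairing X) \<cdot> assoc T (D X) X (D X) \<cdot> (c \<ltimes> D X) = lunit T (D X)"
    using coevaluation[OF X] by metis
  let ?ai = "assoc_inv W (D X) X" and ?ri = "inv_arr T (runit T W)"
  \<comment> \<open>The candidate inserts the coevaluation to the right of \<open>W\<close> and then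
    applies \<open>g\<close>.\<close>
  let ?g = "(g \<ltimes> X) \<cdot> ?ai \<cdot> (W \<rtimes> c) \<cdot> ?ri"
  have "right_eval X Y \<cdot> (?g \<ltimes> D X)
     = right_eval X Y \<cdot> ((g \<ltimes> X) \<ltimes> D X) \<cdot> (?ai \<ltimes> D X) \<cdot> ((W \<rtimes> c) \<ltimes> D X) \<cdot> (?ri \<ltimes> D X)"
    using c g by (simp add: right_whisker_cmp)
  also have "\<dots> = g \<cdot> right_eval X (W \<boxtimes> D X) \<cdot> (?ai \<ltimes> D X) \<cdot> ((W \<rtimes> c) \<ltimes> D X) \<cdot> (?ri \<ltimes> D X)"
    using cmp_reduce[OF right_eval_natural[of X g], of "(?ai \<ltimes> D X) \<cdot> ((W \<rtimes> c) \<ltimes> D X) \<cdot> (?ri \<ltimes> D X)"] c g by simp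
  also have "\<dots> = g \<cdot> (runit T W \<ltimes> D X) \<cdot> (?ri \<ltimes> D X)"
    using cmp_reduce3[OF right_eval_coev2[OF c, of W], of "?ri \<ltimes> D X"] c by simp
  also have "\<dots> = g" using g by (simp flip: right_whisker_cmp)
  finally show ?thesis using c g by (intro that[of ?g]) simp_all
qed

text \<open>Inserting the coevaluation recovers \<open>g\<close> from its composite with
  \<open>right_eval\<close>.\<close>

lemma right_eval_inj:
  assumes X: "rigid T X" and g: "src T g = src T h" "tgt T g = Y \<boxtimes> X" "tgt T h = Y \<boxtimes> X"
    and eq: "right_eval X Y \<cdot> (g \<ltimes> D X) = right_eval X Y \<cdot> (h \<ltimes> D X)"
  shows "g = h"
proof -
  obtain c where c: "src T c = one" "tgt T c = D X \<boxtimes> X" "left_eval X X \<cdot> (X \<rtimes> c) = runit T X"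
    using coevaluation[OF X] by metis
  have retract: "((right_eval X Y \<cdot> (g \<ltimes> D X)) \<ltimes> X) \<cdot> assoc_inv (src T g) (D X) X \<cdot> (src T g \<rtimes> c)
      = g \<cdot> runit T (src T g)" if g: "tgt T g = Y \<boxtimes> X" for g
  proof -
    let ?W = "src T g"
    have "((right_eval X Y \<cdot> (g \<ltimes> D X)) \<ltimes> X) \<cdot> assoc_inv ?W (D X) X \<cdot> (?W \<rtimes> c)
       = (right_eval X Y \<ltimes> X) \<cdot> ((g \<ltimes> D X) \<ltimes> X) \<cdot> assoc_inv ?W (D X) X \<cdot> (?W \<rtimes> c)"
      using c g by (simp add: right_whisker_cmp)
    also have "\<dots> = (right_eval X Y \<ltimes> X) \<cdot> assoc_inv (Y \<boxtimes> X) (D X) X \<cdot> (g \<ltimes> (D X \<boxtimes> X)) \<cdot> (?W \<rtimes> c)"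
      using cmp_reduce[OF assoc_inv_nat[of g "ident T (D X)" "ident T X", symmetric], of "?W \<rtimes> c"] c g by simp
    also have "\<dots> = (right_eval X Y \<ltimes> X) \<cdot> assoc_inv (Y \<boxtimes> X) (D X) X \<cdot> ((Y \<boxtimes> X) \<rtimes> c) \<cdot> (g \<ltimes> one)"
      using whisker_exchange[of g ?W "Y \<boxtimes> X" c one "D X \<boxtimes> X"] c g by simp
    also have "\<dots> = runit T (Y \<boxtimes> X) \<cdot> (g \<ltimes> one)"
      using cmp_reduce3[OF right_eval_coev[OF c, of Y], of "g \<ltimes> one"] c g by simp
    also have "\<dots> = g \<cdot> runit T ?W" using runit_nat[of g] g by simp
    finally show ?thesis .
  qed
  have "g \<cdot> runit T (src T h) = h \<cdot> runit T (src T h)" using retract[of g] retract[of h] g eq by simp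
  then show ?thesis using g by (subst (asm) iso_right_cancel) simp_all
qed

lemma right_eval_one: "right_eval X one \<cdot> (inv_arr T (lunit T X) \<ltimes> D X) = pairing X"
proof -
  have "lunit T (X \<boxtimes> D X) \<cdot> assoc T one X (D X) \<cdot> (inv_arr T (lunit T X) \<ltimes> D X) = ident T (X \<boxtimes> D X)"
    using cmp_reduce[OF lunit_tensor[of X "D X"], of "inv_arr T (lunit T X) \<ltimes> D X"]
    by (simp flip: right_whisker_cmp)
  moreover have "runit T one \<cdot> (one \<rtimes> pairing X) = pairing X \<cdot> lunit T (X \<boxtimes> D X)"
    using lunit_nat[of "pairing X"] by (simp add: lunit_one)
  ultimately show ?thesis
    using cmp_reduce[of "runit T one" "one \<rtimes> pairing X" _ "assoc T one X (D X) \<cdot> (inv_arr T (lunit T X) \<ltimes> D X)"]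
    by (simp add: right_eval_def)
qed

text \<open>At the unit object \<open>right_eval\<close> becomes the pairing, which thereby exhibits
  \<open>X\<close> as an internal hom from \<open>D X\<close> to the unit; the comparison with the
  double dual is \<open>bidual\<close>.\<close>

lemma bidual_iso:
  assumes X: "rigid T X" shows "is_iso T (bidual X)"
  unfolding bidual_def
proof (rule curry_universal_iso)
  let ?l = "inv_arr T (lunit T X)"
  have *: "right_eval X one \<cdot> ((?l \<cdot> g) \<ltimes> D X) = pairing X \<cdot> (g \<ltimes> D X)" if "tgt T g = X" for g
    using cmp_reduce[OF right_eval_one[of X], of "g \<ltimes> D X"] that by (simp add: right_whisker_cmp)
  show "\<exists>g'. src T g' = ihom T (D X) one \<and> tgt T g' = X \<and> pairing X \<cdot> (g' \<ltimes> D X) = g"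
    if g: "src T g = ihom T (D X) one \<boxtimes> D X" "tgt T g = one" for g
  proof -
    obtain g' where g': "src T g' = ihom T (D X) one" "tgt T g' = one \<boxtimes> X" "right_eval X one \<cdot> (g' \<ltimes> D X) = g"
      using right_eval_universal[OF X g] .
    then show ?thesis using *[of "lunit T X \<cdot> g'"] by (intro exI[of _ "lunit T X \<cdot> g'"]) simp
  qed
  show "g = h" if "src T g = X" "src T h = X" "tgt T g = X" "tgt T h = X"
    "pairing X \<cdot> (g \<ltimes> D X) = pairing X \<cdot> (h \<ltimes> D X)" for g h
  proof -
    have "?l \<cdot> g = ?l \<cdot> h"
      by (rule right_eval_inj[OF X, of _ _ one]) (use that * in simp_all)
    then show ?thesis using that by (subst (asm) iso_left_cancel) simp_all
  qed
qed simp_all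

lemma rigid_eval_dual:
  "rigid_eval (D X) Y \<cdot> (((bidual X \<ltimes> Y) \<cdot> braid T Y X) \<ltimes> D X) = right_eval X Y"
proof -
  let ?D = "D X" and ?p = "pairing X" and ?b = "braid T Y X"
  have "rigid_eval ?D Y \<cdot> (((bidual X \<ltimes> Y) \<cdot> ?b) \<ltimes> ?D)
     = lunit T Y \<cdot> (ev ?D \<ltimes> Y) \<cdot> assoc_inv (D ?D) ?D Y \<cdot> (D ?D \<rtimes> braid T Y ?D) \<cdot>
       assoc T (D ?D) Y ?D \<cdot> ((bidual X \<ltimes> Y) \<ltimes> ?D) \<cdot> (?b \<ltimes> ?D)"
    by (simp add: rigid_eval_def right_whisker_cmp)
  also have "\<dots> = lunit T Y \<cdot> (ev ?D \<ltimes> Y) \<cdot> assoc_inv (D ?D) ?D Y \<cdot> (D ?D \<rtimes> braid T Y ?D) \<cdot>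
       (bidual X \<ltimes> (Y \<boxtimes> ?D)) \<cdot> assoc T X Y ?D \<cdot> (?b \<ltimes> ?D)"
    using cmp_reduce[OF assoc_nat[of "bidual X" "ident T Y" "ident T ?D"], of "?b \<ltimes> ?D"] by simp
  also have "\<dots> = lunit T Y \<cdot> (ev ?D \<ltimes> Y) \<cdot> assoc_inv (D ?D) ?D Y \<cdot> (bidual X \<ltimes> (?D \<boxtimes> Y)) \<cdot>
       (X \<rtimes> braid T Y ?D) \<cdot> assoc T X Y ?D \<cdot> (?b \<ltimes> ?D)"
    using cmp_reduce[OF whisker_exchange[of "bidual X" X "D ?D" "braid T Y ?D" "Y \<boxtimes> ?D" "?D \<boxtimes> Y"],
        of "assoc T X Y ?D \<cdot> (?b \<ltimes> ?D)"] by simp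
  also have "\<dots> = lunit T Y \<cdot> (ev ?D \<ltimes> Y) \<cdot> ((bidual X \<ltimes> ?D) \<ltimes> Y) \<cdot> assoc_inv X ?D Y \<cdot>
       (X \<rtimes> braid T Y ?D) \<cdot> assoc T X Y ?D \<cdot> (?b \<ltimes> ?D)"
    using cmp_reduce[OF assoc_inv_nat[of "bidual X" "ident T ?D" "ident T Y"],
       of "(X \<rtimes> braid T Y ?D) \<cdot> assoc T X Y ?D \<cdot> (?b \<ltimes> ?D)"] by simp
  also have "\<dots> = lunit T Y \<cdot> (?p \<ltimes> Y) \<cdot> assoc_inv X ?D Y \<cdot>
       (X \<rtimes> braid T Y ?D) \<cdot> assoc T X Y ?D \<cdot> (?b \<ltimes> ?D)"
    using cmp_reduce[OF right_whisker_cmp[of "bidual X \<ltimes> ?D" "ev ?D" Y, symmetric],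
       of "assoc_inv X ?D Y \<cdot> (X \<rtimes> braid T Y ?D) \<cdot> assoc T X Y ?D \<cdot> (?b \<ltimes> ?D)"]
    by (simp add: ev_bidual)
  also have "\<dots> = lunit T Y \<cdot> (?p \<ltimes> Y) \<cdot> braid T Y (X \<boxtimes> ?D) \<cdot> assoc T Y X ?D"
    by (simp flip: hexagon)
  also have "\<dots> = lunit T Y \<cdot> braid T Y one \<cdot> (Y \<rtimes> ?p) \<cdot> assoc T Y X ?D"
    using cmp_reduce[OF braid_nat[of "ident T Y" ?p, symmetric], of "assoc T Y X ?D"] by simp
  also have "\<dots> = right_eval X Y"
    using cmp_reduce[OF lunit_braid[of Y], of "(Y \<rtimes> ?p) \<cdot> assoc T Y X ?D"] by (simp add: right_eval_def)
  finally show ?thesis .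
qed

text \<open>By \<open>rigid_eval_dual\<close> the canonical arrow of \<open>D X\<close>, composed
  with the isomorphism \<open>?m\<close>, is adjoint to \<open>right_eval\<close> and hence
  invertible.\<close>

lemma rigid_dual:
  assumes X: "rigid T X" shows "rigid T (D X)"
  unfolding rigid_def
proof
  fix Y
  let ?m = "(bidual X \<ltimes> Y) \<cdot> braid T Y X"
  have m: "is_iso T ?m" using bidual_iso[OF X] by simp
  let ?c = "curry_arr T (Y \<boxtimes> X) (D X) Y (right_eval X Y)"
  have c: "is_iso T ?c"
  proof (rule curry_universal_iso)
    show "\<exists>g'. src T g' = ihom T (D X) Y \<and> tgt T g' = Y \<boxtimes> X \<and> right_eval X Y \<cdot> (g' \<ltimes> D X) = g"
      if "src T g = ihom T (D X) Y \<boxtimes> D X" "tgt T g = Y" for g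
      using right_eval_universal[OF X that] by metis
    show "g = h" if "src T g = Y \<boxtimes> X" "src T h = Y \<boxtimes> X" "tgt T g = Y \<boxtimes> X" "tgt T h = Y \<boxtimes> X"
      "right_eval X Y \<cdot> (g \<ltimes> D X) = right_eval X Y \<cdot> (h \<ltimes> D X)" for g h
      by (rule right_eval_inj[OF X]) (use that in simp_all)
  qed simp_all
  have r: "src T (rigid_map T (D X) Y) = D (D X) \<boxtimes> Y" "tgt T (rigid_map T (D X) Y) = ihom T (D X) Y"
    "eval T (D X) Y \<cdot> (rigid_map T (D X) Y \<ltimes> D X) = rigid_eval (D X) Y"
    by (simp_all add: rigid_map)
  have "rigid_map T (D X) Y \<cdot> ?m = ?c"
  proof (rule eval_inj[where X = "D X" and Y = Y])
    show "eval T (D X) Y \<cdot> ((rigid_map T (D X) Y \<cdot> ?m) \<ltimes> D X) = eval T (D X) Y \<cdot> (?c \<ltimes> D X)"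
      using cmp_reduce[OF r(3), of "?m \<ltimes> D X"] r rigid_eval_dual[of X Y]
      by (subst right_whisker_cmp) simp_all
  qed (simp_all add: r)
  then have "is_iso T (rigid_map T (D X) Y \<cdot> ?m)" using c by (simp only:)
  then show "is_iso T (rigid_map T (D X) Y)" by (rule is_iso_cmpD[OF _ m]) (simp add: r)
qed

text \<open>\<open>k\<close> is adjoint to \<open>D B \<rtimes> p\<close>, with \<open>B\<close> the
  target of \<open>q\<close>. Rigidity is applied to the source of \<open>p\<close>, so the middle
  object may be arbitrary; it survives as a tensor factor, which keeps acyclicity.\<close>

lemma dual_factor:
  assumes A: "rigid T (src T p)" and pq: "tgt T p = src T q"
  obtains k l where "dual_arr T (q \<cdot> p) = l \<cdot> k" "src T l = tgt T k" "tgt T k = D (src T p) \<boxtimes> (D (tgt T q) \<boxtimes> src T q)"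
    "src T k = D (tgt T q)" "tgt T l = D (src T p)"
proof -
  let ?A = "src T p" and ?B = "tgt T q"
  let ?V = "D ?B \<boxtimes> src T q"
  note [simp] = pq
  obtain k where k: "src T k = D ?B" "tgt T k = D ?A \<boxtimes> ?V" "rigid_eval ?A ?V \<cdot> (k \<ltimes> ?A) = D ?B \<rtimes> p"
    using rigid_eval_universal[OF A, of "D ?B \<rtimes> p" "D ?B" ?V] by auto
  let ?v = "ev ?B \<cdot> (D ?B \<rtimes> q)"
  let ?l = "runit T (D ?A) \<cdot> (D ?A \<rtimes> ?v)"
  have "ev ?A \<cdot> ((?l \<cdot> k) \<ltimes> ?A) = ev ?A \<cdot> (runit T (D ?A) \<ltimes> ?A) \<cdot> ((D ?A \<rtimes> ?v) \<ltimes> ?A) \<cdot> (k \<ltimes> ?A)"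
    using k by (simp add: right_whisker_cmp)
  also have "\<dots> = rigid_eval ?A one \<cdot> ((D ?A \<rtimes> ?v) \<ltimes> ?A) \<cdot> (k \<ltimes> ?A)"
    using k by (simp add: rigid_eval_one)
  also have "\<dots> = ?v \<cdot> rigid_eval ?A ?V \<cdot> (k \<ltimes> ?A)"
    using cmp_reduce[OF rigid_eval_natural[of ?v ?A, symmetric], of "k \<ltimes> ?A"] k by simp
  also have "\<dots> = ev ?B \<cdot> (D ?B \<rtimes> (q \<cdot> p))" using k by (simp add: left_whisker_cmp)
  also have "\<dots> = ev ?A \<cdot> (dual_arr T (q \<cdot> p) \<ltimes> ?A)" using ev_dual[of "q \<cdot> p"] by (simp del: dual_cmp)
  finally have eq: "ev ?A \<cdot> ((?l \<cdot> k) \<ltimes> ?A) = ev ?A \<cdot> (dual_arr T (q \<cdot> p) \<ltimes> ?A)" .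
  have "dual_arr T (q \<cdot> p) = ?l \<cdot> k"
    by (rule ev_inj[OF _ _ _ eq[symmetric]]) (simp_all add: k(1,2) del: dual_cmp)
  then show ?thesis using k by (intro that[of ?l k]) simp_all
qed

end

section \<open>Finitely presented functors\<close>

context additive_category
begin

section \<open>Cokernels of representable functors\<close>

abbreviation cls :: "'m \<Rightarrow> 'o \<Rightarrow> 'm \<Rightarrow> 'm set" where
  "cls f X x \<equiv> im_hom T f X #>\<^bsub>homgrp T (src T f) X\<^esub> x"

lemma in_im_hom: "y \<in> im_hom T f X \<longleftrightarrow> (\<exists>h. src T h = tgt T f \<and> tgt T h = X \<and> y = h \<cdot> f)"
  by (auto simp: im_hom_def in_Hom)

lemma im_homI: "src T h = tgt T f \<Longrightarrow> h \<cdot> f \<in> im_hom T f (tgt T h)"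
  by (auto simp: in_im_hom)

lemma homgrp_inv: "\<lbrakk>src T f = X; tgt T f = Y\<rbrakk> \<Longrightarrow> inv\<^bsub>homgrp T X Y\<^esub> f = neg_arr T f"
  by (simp add: neg_arr_def)

lemma im_hom_subgroup: "subgroup (im_hom T f X) (homgrp T (src T f) X)"
proof
  show "im_hom T f X \<subseteq> carrier (homgrp T (src T f) X)" by (auto simp: in_im_hom in_Hom)
  show "\<one>\<^bsub>homgrp T (src T f) X\<^esub> \<in> im_hom T f X"
    using im_homI[of "zero_arr T (tgt T f) X" f] by simp
next
  fix x y assume "x \<in> im_hom T f X" "y \<in> im_hom T f X"
  then obtain h k where h: "src T h = tgt T f" "tgt T h = X" "x = h \<cdot> f"
    and k: "src T k = tgt T f" "tgt T k = X" "y = k \<cdot> f" unfolding in_im_hom by blast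
  then show "x \<otimes>\<^bsub>homgrp T (src T f) X\<^esub> y \<in> im_hom T f X"
    using im_homI[of "h \<boxplus> k" f] by simp
next
  fix x assume "x \<in> im_hom T f X"
  then obtain h where h: "src T h = tgt T f" "tgt T h = X" "x = h \<cdot> f" unfolding in_im_hom by blast
  then show "inv\<^bsub>homgrp T (src T f) X\<^esub> x \<in> im_hom T f X"
    using im_homI[of "neg_arr T h" f] by (simp add: homgrp_inv)
qed

lemma im_hom_normal: "im_hom T f X \<lhd> homgrp T (src T f) X"
  using comm_group.normal_iff_subgroup[OF comm_group_homgrp] im_hom_subgroup by blast

lemma val_coker: "val (coker_functor T f) X = homgrp T (src T f) X Mod im_hom T f X"
  by (simp add: coker_functor_def)

lemma coker_group: "comm_group (val (coker_functor T f) X)"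
  unfolding val_coker by (rule comm_group.abelian_FactGroup[OF comm_group_homgrp im_hom_subgroup])

lemma coker_carrier: "carrier (val (coker_functor T f) X) = cls f X ` Hom T (src T f) X"
  by (auto simp: val_coker FactGroup_def RCOSETS_def)

lemma coker_one: "\<one>\<^bsub>val (coker_functor T f) X\<^esub> = im_hom T f X"
  by (simp add: val_coker FactGroup_def)

lemma clsI: "\<lbrakk>src T x = src T f; tgt T x = X\<rbrakk> \<Longrightarrow> cls f X x \<in> carrier (val (coker_functor T f) X)"
  by (simp add: coker_carrier in_Hom)

lemma clsE:
  assumes "c \<in> carrier (val (coker_functor T f) X)"
  obtains x where "src T x = src T f" "tgt T x = X" "c = cls f X x"
  using assms by (auto simp: coker_carrier in_Hom)

lemma cls_plus:
  "\<lbrakk>src T x = src T f; tgt T x = X; src T y = src T f; tgt T y = X\<rbrakk>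
   \<Longrightarrow> cls f X x \<otimes>\<^bsub>val (coker_functor T f) X\<^esub> cls f X y = cls f X (x \<boxplus> y)"
  using normal.rcos_sum[OF im_hom_normal, of x f X y] by (simp add: val_coker FactGroup_def in_Hom)

lemma cls_eq_iff:
  assumes "src T x = src T f" "tgt T x = X" "src T y = src T f" "tgt T y = X"
  shows "cls f X x = cls f X y \<longleftrightarrow> x \<boxplus> neg_arr T y \<in> im_hom T f X"
proof -
  interpret group "homgrp T (src T f) X" using comm_group_homgrp comm_group.axioms(2) by blast
  have "cls f X x = cls f X y \<longleftrightarrow> x \<in> cls f X y"
    using repr_independence[of x _ y, OF _ _ im_hom_subgroup] rcos_self[of x, OF _ im_hom_subgroup] assms
    by (auto simp: in_Hom)
  also have "\<dots> \<longleftrightarrow> x \<boxplus> neg_arr T y \<in> im_hom T f X"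
    using subgroup.rcos_module[OF im_hom_subgroup group_axioms, of y x] assms
    by (simp add: in_Hom homgrp_inv)
  finally show ?thesis .
qed

lemma cls_zero: "cls f X (zero_arr T (src T f) X) = \<one>\<^bsub>val (coker_functor T f) X\<^esub>"
proof -
  interpret group "homgrp T (src T f) X" using comm_group_homgrp comm_group.axioms(2) by blast
  have "im_hom T f X \<subseteq> carrier (homgrp T (src T f) X)" by (rule subgroup.subset[OF im_hom_subgroup])
  from coset_mult_one[OF this] show ?thesis by (simp add: coker_one)
qed

lemma coker_trivial_iff:
  "trivial_group (val (coker_functor T f) X) \<longleftrightarrow> (\<forall>x. src T x = src T f \<and> tgt T x = X \<longrightarrow> x \<in> im_hom T f X)"
proof -
  interpret comm_group "val (coker_functor T f) X" by (rule coker_group)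
  have "trivial_group (val (coker_functor T f) X) \<longleftrightarrow>
      (\<forall>x. src T x = src T f \<and> tgt T x = X \<longrightarrow> cls f X x = cls f X (zero_arr T (src T f) X))"
    unfolding trivial_group_subset coker_carrier cls_zero by (simp add: image_subset_iff in_Hom Ball_def)
  then show ?thesis using cls_eq_iff[of _ f X "zero_arr T (src T f) X"] by simp
qed

text \<open>Postcomposing a coset with \<open>g\<close> gives only part of a coset; the set product
  with the subgroup in \<open>map_arr\<close> completes it.\<close>

lemma map_cls:
  assumes x: "src T x = src T f" "tgt T x = src T g"
  shows "map_arr (coker_functor T f) g (cls f (src T g) x) = cls f (tgt T g) (g \<cdot> x)"
proof -
  let ?Y = "tgt T g"
  have "im_hom T f ?Y <#>\<^bsub>homgrp T (src T f) ?Y\<^esub> ((\<lambda>x. g \<cdot> x) ` cls f (src T g) x) = cls f ?Y (g \<cdot> x)" (is "?l = ?r")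
  proof
    show "?l \<subseteq> ?r"
    proof
      fix y assume "y \<in> ?l"
      then obtain h k where h: "src T h = tgt T f" "tgt T h = ?Y" and k: "src T k = tgt T f" "tgt T k = src T g"
        and y: "y = h \<cdot> f \<boxplus> g \<cdot> (k \<cdot> f \<boxplus> x)"
        by (auto simp: set_mult_def r_coset_def in_im_hom)
      have "y = (h \<boxplus> g \<cdot> k) \<cdot> f \<boxplus> g \<cdot> x" using h k x y by (simp add: plus_assoc)
      then show "y \<in> ?r" using im_homI[of "h \<boxplus> g \<cdot> k" f] h k by (auto simp: r_coset_def)
    qed
    show "?r \<subseteq> ?l"
    proof
      fix y assume "y \<in> ?r"
      then obtain h where h: "src T h = tgt T f" "tgt T h = ?Y" and y: "y = h \<cdot> f \<boxplus> g \<cdot> x"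
        by (auto simp: r_coset_def in_im_hom)
      have "x \<in> cls f (src T g) x"
        using x im_homI[of "zero_arr T (tgt T f) (src T g)" f]
        by (auto simp: r_coset_def intro!: bexI[of _ "zero_arr T (src T f) (src T g)"])
      then show "y \<in> ?l" using y im_homI[of h f] h by (auto simp: set_mult_def)
    qed
  qed
  then show ?thesis by (simp add: coker_functor_def)
qed

lemma coker_ab_functor: "ab_functor_on T K (coker_functor T f)"
  unfolding ab_functor_on_def
proof (intro conjI ballI)
  fix X show "comm_group (val (coker_functor T f) X)" by (rule coker_group)
next
  fix X Y g assume "g \<in> Hom T X Y"
  then have g: "src T g = X" "tgt T g = Y" by (simp_all add: in_Hom)
  show "map_arr (coker_functor T f) g \<in> hom (val (coker_functor T f) X) (val (coker_functor T f) Y)"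
  proof (rule homI)
    fix c assume "c \<in> carrier (val (coker_functor T f) X)"
    then obtain x where "src T x = src T f" "tgt T x = X" "c = cls f X x" by (rule clsE)
    then show "map_arr (coker_functor T f) g c \<in> carrier (val (coker_functor T f) Y)"
      using map_cls[of x f g] g clsI[of "g \<cdot> x" f Y] by simp
  next
    fix c d assume "c \<in> carrier (val (coker_functor T f) X)" "d \<in> carrier (val (coker_functor T f) X)"
    then obtain x y where x: "src T x = src T f" "tgt T x = X" "c = cls f X x"
      and y: "src T y = src T f" "tgt T y = X" "d = cls f X y" by (metis clsE)
    show "map_arr (coker_functor T f) g (c \<otimes>\<^bsub>val (coker_functor T f) X\<^esub> d) =
        map_arr (coker_functor T f) g c \<otimes>\<^bsub>val (coker_functor T f) Y\<^esub> map_arr (coker_functor T f) g d"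
      using x y g map_cls[of x f g] map_cls[of y f g] map_cls[of "x \<boxplus> y" f g]
        cls_plus[of x f X y] cls_plus[of "g \<cdot> x" f Y "g \<cdot> y"] by simp
  qed
next
  fix X c assume "c \<in> carrier (val (coker_functor T f) X)"
  then obtain x where "src T x = src T f" "tgt T x = X" "c = cls f X x" by (rule clsE)
  then show "map_arr (coker_functor T f) (ident T X) c = c" using map_cls[of x f "ident T X"] by simp
next
  fix X Y Z g h c assume g: "g \<in> Hom T X Y" "h \<in> Hom T Y Z" and "c \<in> carrier (val (coker_functor T f) X)"
  then obtain x where "src T x = src T f" "tgt T x = X" "c = cls f X x" by (metis clsE)
  then show "map_arr (coker_functor T f) (h \<cdot> g) c = map_arr (coker_functor T f) h (map_arr (coker_functor T f) g c)"
    using map_cls[of x f g] map_cls[of "g \<cdot> x" f h] map_cls[of x f "h \<cdot> g"] g by (simp add: in_Hom)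
qed

lemma coker_presents: "\<lbrakk>src T f \<in> K; tgt T f \<in> K\<rbrakk> \<Longrightarrow> presents T K f (coker_functor T f)"
  unfolding presents_def nat_isomorphic_def nat_transf_def
  by (intro conjI exI[of _ "\<lambda>X x. x"]) (auto simp: iso_def hom_def bij_betw_def)

section \<open>Independence of the presentation\<close>

lemma nat_transf_cls:
  assumes \<tau>: "nat_transf T K (coker_functor T f) G \<tau>" and "X \<in> K" "src T g \<in> K" "tgt T g = X"
    and x: "src T x = src T f" "tgt T x = src T g"
  shows "\<tau> X (cls f X (g \<cdot> x)) = map_arr G g (\<tau> (src T g) (cls f (src T g) x))"
proof -
  have "\<tau> X (map_arr (coker_functor T f) g (cls f (src T g) x)) = map_arr G g (\<tau> (src T g) (cls f (src T g) x))"
    using \<tau> assms(2-4) clsI[OF x] unfolding nat_transf_def by (auto simp: in_Hom)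
  then show ?thesis using map_cls[OF x] assms(4) by simp
qed

text \<open>A Yoneda argument: \<open>a\<close> represents, in the second presentation, the class of
  the identity of \<open>src T f\<close>. As \<open>f\<close> itself has class zero, so has
  \<open>f \<cdot> a\<close> in the second presentation.\<close>

lemma presentations_compare:
  assumes \<tau>: "nat_transf T K (coker_functor T f) G \<tau>" and \<sigma>: "nat_transf T K (coker_functor T f') G \<sigma>"
    and iso\<tau>: "\<And>X. X \<in> K \<Longrightarrow> \<tau> X \<in> iso (val (coker_functor T f) X) (val G X)"
    and iso: "\<And>X. X \<in> K \<Longrightarrow> \<sigma> X \<in> iso (val (coker_functor T f') X) (val G X)"
    and K: "src T f \<in> K" "tgt T f \<in> K"
  obtains a where "src T a = src T f'" "tgt T a = src T f" "f \<cdot> a \<in> im_hom T f' (tgt T f)"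
    "\<And>x. \<lbrakk>src T x = src T f; tgt T x \<in> K\<rbrakk> \<Longrightarrow> \<tau> (tgt T x) (cls f (tgt T x) x) = \<sigma> (tgt T x) (cls f' (tgt T x) (x \<cdot> a))"
proof -
  let ?A = "src T f"
  have "\<tau> ?A (cls f ?A (ident T ?A)) \<in> carrier (val G ?A)"
    using iso\<tau>[OF K(1)] clsI[of "ident T ?A" f] by (auto simp: iso_def hom_def)
  also have "carrier (val G ?A) = \<sigma> ?A ` carrier (val (coker_functor T f') ?A)"
    using iso[OF K(1)] by (auto simp: iso_def bij_betw_def)
  finally obtain a where a: "src T a = src T f'" "tgt T a = ?A"
    "\<tau> ?A (cls f ?A (ident T ?A)) = \<sigma> ?A (cls f' ?A a)"
    by (auto simp: coker_carrier in_Hom)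
  have eq: "\<tau> (tgt T x) (cls f (tgt T x) x) = \<sigma> (tgt T x) (cls f' (tgt T x) (x \<cdot> a))"
    if x: "src T x = ?A" "tgt T x \<in> K" for x
    using nat_transf_cls[OF \<tau>, of "tgt T x" x "ident T ?A"] nat_transf_cls[OF \<sigma>, of "tgt T x" x a] x a K by simp
  let ?B = "tgt T f"
  have "cls f ?B f = cls f ?B (zero_arr T ?A ?B)"
    using im_homI[of "ident T ?B" f] by (subst cls_eq_iff) simp_all
  then have "\<sigma> ?B (cls f' ?B (f \<cdot> a)) = \<sigma> ?B (cls f' ?B (zero_arr T (src T f') ?B))"
    using eq[of f] eq[of "zero_arr T ?A ?B"] K a by simp
  then have "cls f' ?B (f \<cdot> a) = cls f' ?B (zero_arr T (src T f') ?B)"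
    using iso[OF K(2)] clsI[of "f \<cdot> a" f' ?B] clsI[of "zero_arr T (src T f') ?B" f' ?B] a
    by (auto simp: iso_def bij_betw_def dest: inj_onD)
  then have "f \<cdot> a \<in> im_hom T f' ?B" using a by (subst (asm) cls_eq_iff) simp_all
  with a eq show ?thesis by (intro that[of a]) simp_all
qed

text \<open>\<open>X\<close> need not be compact, so the isomorphisms of functors do not reach it.
  Instead \<open>a\<close> and \<open>b\<close> are inverse up to a multiple of \<open>f\<close>,
  and \<open>f' \<cdot> b\<close> is a multiple of \<open>f\<close>. These are relations between
  compact arrows and can be composed with any arrow to \<open>X\<close>.\<close>

lemma presentations_equiv:
  assumes p: "presents T K f G" "presents T K f' G"
    and surj: "\<And>y. \<lbrakk>src T y = src T f'; tgt T y = X\<rbrakk> \<Longrightarrow> y \<in> im_hom T f' X"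
    and x: "src T x = src T f" "tgt T x = X"
  shows "x \<in> im_hom T f X"
proof -
  obtain \<tau> where \<tau>: "nat_transf T K (coker_functor T f) G \<tau>"
    "\<And>X. X \<in> K \<Longrightarrow> \<tau> X \<in> iso (val (coker_functor T f) X) (val G X)"
    and K: "src T f \<in> K" "tgt T f \<in> K"
    using p(1) unfolding presents_def nat_isomorphic_def by blast
  obtain \<sigma> where \<sigma>: "nat_transf T K (coker_functor T f') G \<sigma>"
    "\<And>X. X \<in> K \<Longrightarrow> \<sigma> X \<in> iso (val (coker_functor T f') X) (val G X)"
    and K': "src T f' \<in> K" "tgt T f' \<in> K"
    using p(2) unfolding presents_def nat_isomorphic_def by blast
  obtain a where a: "src T a = src T f'" "tgt T a = src T f" "f \<cdot> a \<in> im_hom T f' (tgt T f)"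
    and eq: "\<And>x. \<lbrakk>src T x = src T f; tgt T x \<in> K\<rbrakk> \<Longrightarrow> \<tau> (tgt T x) (cls f (tgt T x) x) = \<sigma> (tgt T x) (cls f' (tgt T x) (x \<cdot> a))"
    using presentations_compare[OF \<tau>(1) \<sigma>(1) \<tau>(2) \<sigma>(2) K] by metis
  obtain b where b: "src T b = src T f" "tgt T b = src T f'" "f' \<cdot> b \<in> im_hom T f (tgt T f')"
    and eq': "\<And>x. \<lbrakk>src T x = src T f'; tgt T x \<in> K\<rbrakk> \<Longrightarrow> \<sigma> (tgt T x) (cls f' (tgt T x) x) = \<tau> (tgt T x) (cls f (tgt T x) (x \<cdot> b))"
    using presentations_compare[OF \<sigma>(1) \<tau>(1) \<sigma>(2) \<tau>(2) K'] by metis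
  let ?A = "src T f"
  have "\<tau> ?A (cls f ?A (ident T ?A)) = \<tau> ?A (cls f ?A (a \<cdot> b))"
    using eq[of "ident T ?A"] eq'[of a] a b K by simp
  then have "cls f ?A (ident T ?A) = cls f ?A (a \<cdot> b)"
    using \<tau>(2)[OF K(1)] clsI[of "ident T ?A" f ?A] clsI[of "a \<cdot> b" f ?A] a b
    by (auto simp: iso_def bij_betw_def dest: inj_onD)
  then have "ident T ?A \<boxplus> neg_arr T (a \<cdot> b) \<in> im_hom T f ?A" using a b by (subst (asm) cls_eq_iff) simp_all
  then obtain c where c: "src T c = tgt T f" "tgt T c = ?A" "ident T ?A \<boxplus> neg_arr T (a \<cdot> b) = c \<cdot> f"
    unfolding in_im_hom by blast
  obtain b' where b': "src T b' = tgt T f" "tgt T b' = tgt T f'" "f' \<cdot> b = b' \<cdot> f"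
    using b(3) unfolding in_im_hom by blast
  have "x \<cdot> a \<in> im_hom T f' X" using surj x a by simp
  then obtain y where y: "src T y = tgt T f'" "tgt T y = X" "x \<cdot> a = y \<cdot> f'"
    unfolding in_im_hom by blast
  have "x = x \<cdot> (ident T ?A \<boxplus> neg_arr T (a \<cdot> b)) \<boxplus> (x \<cdot> a) \<cdot> b"
    using x a b by simp
  also have "\<dots> = x \<cdot> c \<cdot> f \<boxplus> y \<cdot> f' \<cdot> b" unfolding c(3) y(3) using y(1) b by simp
  also have "\<dots> = (x \<cdot> c \<boxplus> y \<cdot> b') \<cdot> f" unfolding b'(3) using x c(1,2) y(1,2) b'(1,2) by simp
  finally show ?thesis using im_homI[of "x \<cdot> c \<boxplus> y \<cdot> b'" f] x c(1,2) y(1,2) b'(1,2) by simp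
qed

text \<open>Frees vanishing statements from the presentation chosen inside
  \<open>tilde\<close>.\<close>

lemma tilde_trivial_iff:
  assumes "presents T K f G"
  shows "trivial_group (val (tilde T K G) X) \<longleftrightarrow> (\<forall>x. src T x = src T f \<and> tgt T x = X \<longrightarrow> x \<in> im_hom T f X)"
proof -
  let ?f = "SOME f. presents T K f G"
  have "presents T K ?f G" using assms by (rule someI)
  then show ?thesis
    unfolding tilde_def coker_trivial_iff
    using presentations_equiv[of K f G ?f X] presentations_equiv[of K ?f G f X] assms by blast
qed

end

context closed_symmetric_monoidal
begin

section \<open>Additivity of the dual and transposition\<close>

lemma dual_plus [simp]:
  assumes "src T f = src T g" "tgt T f = tgt T g"
  shows "dual_arr T (f \<boxplus> g) = dual_arr T f \<boxplus> dual_arr T g"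
proof (rule ev_inj[where X = "src T g"])
  let ?B = "tgt T g"
  have "ev (src T g) \<cdot> (dual_arr T (f \<boxplus> g) \<ltimes> src T g) = ev ?B \<cdot> (D ?B \<rtimes> (f \<boxplus> g))"
    using ev_dual[of "f \<boxplus> g"] assms by simp
  also have "D ?B \<rtimes> (f \<boxplus> g) = (D ?B \<rtimes> f) \<boxplus> (D ?B \<rtimes> g)"
    using assms by (intro tensor_plus_right[of _ "D ?B" "D ?B" _ "src T g" ?B]) (simp_all add: in_Hom)
  also have "ev ?B \<cdot> \<dots> = ev (src T g) \<cdot> ((dual_arr T f \<ltimes> src T g) \<boxplus> (dual_arr T g \<ltimes> src T g))"
    using ev_dual[of f] ev_dual[of g] assms by simp
  also have "(dual_arr T f \<ltimes> src T g) \<boxplus> (dual_arr T g \<ltimes> src T g) = (dual_arr T f \<boxplus> dual_arr T g) \<ltimes> src T g"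
    using assms by (intro tensor_plus_left[symmetric, of _ "D ?B" "D (src T g)" _ _ "src T g" "src T g"]) (simp_all add: in_Hom)
  finally show "ev (src T g) \<cdot> (dual_arr T (f \<boxplus> g) \<ltimes> src T g) =
      ev (src T g) \<cdot> ((dual_arr T f \<boxplus> dual_arr T g) \<ltimes> src T g)" .
qed (use assms in simp_all)

lemma dual_zero: "dual_arr T (zero_arr T X Y) = zero_arr T (D Y) (D X)"
proof -
  let ?z = "dual_arr T (zero_arr T X Y)"
  have "?z \<boxplus> ?z = zero_arr T (D Y) (D X) \<boxplus> ?z"
    by (simp flip: dual_plus)
  then show ?thesis by (intro plus_right_cancel[of ?z ?z]) simp_all
qed

lemma dual_inj:
  assumes "rigid T (tgt T f)" "src T f = src T g" "tgt T f = tgt T g" "dual_arr T f = dual_arr T g"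
  shows "f = g"
proof -
  have "bidual (tgt T g) \<cdot> f = bidual (tgt T g) \<cdot> g"
    using bidual_natural[of f] bidual_natural[of g] assms by simp
  then show ?thesis using assms bidual_iso by (subst (asm) iso_left_cancel) simp_all
qed

text \<open>The preimage is obtained by dualising \<open>s\<close> and passing through the double
  duals; naturality of \<open>bidual\<close> and the identity \<open>dual_bidual\<close> give back
  \<open>s\<close>.\<close>

lemma dual_surj:
  assumes Y: "rigid T Y" and s: "src T s = D Y" "tgt T s = D (D Z)"
  obtains z where "src T z = D Z" "tgt T z = Y" "dual_arr T z = s"
proof -
  let ?z = "inv_arr T (bidual Y) \<cdot> dual_arr T s \<cdot> bidual (D Z)"
  note [simp] = bidual_iso[OF Y]
  have "dual_arr T (inv_arr T (bidual Y)) \<cdot> dual_arr T (bidual Y) = ident T (D (D (D Y)))"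
    by (subst dual_cmp[symmetric]) simp_all
  then have "bidual (D Y) = dual_arr T (inv_arr T (bidual Y)) \<cdot> dual_arr T (bidual Y) \<cdot> bidual (D Y)"
    using cmp_reduce[of "dual_arr T (inv_arr T (bidual Y))" "dual_arr T (bidual Y)" _ "bidual (D Y)"] by simp
  then have inv: "dual_arr T (inv_arr T (bidual Y)) = bidual (D Y)" by (simp add: dual_bidual)
  have "dual_arr T ?z = dual_arr T (bidual (D Z)) \<cdot> dual_arr T (dual_arr T s) \<cdot> bidual (D Y)"
    using s inv by simp
  also have "\<dots> = dual_arr T (bidual (D Z)) \<cdot> bidual (D (D Z)) \<cdot> s"
    using bidual_natural[of s] s by simp
  also have "\<dots> = s" using cmp_reduce[OF dual_bidual[of "D Z"], of s] s by simp
  finally show ?thesis using s by (intro that[of ?z]) simp_all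
qed

text \<open>The bijection \<open>Hom(DZ,Y) \<rightarrow> Hom(DY,Z)\<close> for rigid \<open>Y\<close> and \<open>Z\<close>.\<close>

definition transpose :: "'a \<Rightarrow> 'b \<Rightarrow> 'b" where
  "transpose Z z = inv_arr T (bidual Z) \<cdot> dual_arr T z"

lemma transpose_arr:
  assumes "rigid T Z" "src T z = D Z"
  shows "src T (transpose Z z) = D (tgt T z)" "tgt T (transpose Z z) = Z"
  using assms bidual_iso by (simp_all add: transpose_def)

lemma transpose_cmp:
  "\<lbrakk>rigid T Z; src T z = D Z; tgt T z = src T h\<rbrakk> \<Longrightarrow> transpose Z (h \<cdot> z) = transpose Z z \<cdot> dual_arr T h"
  using bidual_iso by (simp add: transpose_def)

lemma transpose_dual:
  assumes "rigid T (src T n)" "rigid T (tgt T n)" "src T w = D (src T n)"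
  shows "transpose (tgt T n) (w \<cdot> dual_arr T n) = n \<cdot> transpose (src T n) w"
proof -
  note [simp] = bidual_iso[OF assms(1)] bidual_iso[OF assms(2)]
  have "dual_arr T (dual_arr T n) = dual_arr T (dual_arr T n) \<cdot> bidual (src T n) \<cdot> inv_arr T (bidual (src T n))"
    by simp
  also have "\<dots> = bidual (tgt T n) \<cdot> n \<cdot> inv_arr T (bidual (src T n))"
    using cmp_reduce[OF bidual_natural[of n], of "inv_arr T (bidual (src T n))"] by simp
  finally have "dual_arr T (dual_arr T n) \<cdot> dual_arr T w = bidual (tgt T n) \<cdot> n \<cdot> inv_arr T (bidual (src T n)) \<cdot> dual_arr T w"
    using assms(3) by simp
  then show ?thesis using assms(3) by (simp add: transpose_def)
qed

lemma transpose_plus: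
  "\<lbrakk>rigid T Z; src T z = D Z; src T z' = D Z; tgt T z = tgt T z'\<rbrakk>
   \<Longrightarrow> transpose Z (z \<boxplus> z') = transpose Z z \<boxplus> transpose Z z'"
  using bidual_iso by (simp add: transpose_def)

lemma transpose_inj:
  assumes "rigid T Z" "rigid T (tgt T z)" "src T z = D Z" "src T z' = D Z" "tgt T z = tgt T z'"
    "transpose Z z = transpose Z z'"
  shows "z = z'"
proof (rule dual_inj)
  show "dual_arr T z = dual_arr T z'"
    using assms(6) unfolding transpose_def
    by (subst (asm) iso_left_cancel) (use assms bidual_iso in simp_all)
qed (use assms in simp_all)

lemma transpose_surj:
  assumes "rigid T Z" "rigid T Y" "src T t = D Y" "tgt T t = Z"
  obtains z where "src T z = D Z" "tgt T z = Y" "transpose Z z = t"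
proof -
  obtain z where z: "src T z = D Z" "tgt T z = Y" "dual_arr T z = bidual Z \<cdot> t"
    using dual_surj[OF assms(2), of "bidual Z \<cdot> t" Z] assms by auto
  then show ?thesis using assms bidual_iso[OF assms(1)] by (intro that[of z]) (simp_all add: transpose_def)
qed

end

context big_tt_category
begin

section \<open>The dual of a finitely presented functor\<close>

lemma K_rigid: "X \<in> K \<longleftrightarrow> rigid T X"
  by (simp add: compacts_def compact_iff_rigid)

lemma K_dual: "X \<in> K \<Longrightarrow> D X \<in> K"
  by (simp add: K_rigid rigid_dual)

text \<open>A natural transformation from \<open>coker Hom(f,-)\<close> to \<open>Hom(C,-)\<close> is composition with an arrow \<open>s\<close>
  such that \<open>f \<cdot> s = 0\<close>. Such arrows factor through the fibre \<open>m : Z \<rightarrow> A\<close> of \<open>f\<close>, so transposition turns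
  \<open>\<delta>\<close> of the cokernel into the cokernel of the dual of the next arrow \<open>n : N \<rightarrow> Z\<close> of the triangle.\<close>

lemma delta_presents:
  assumes tri: "(n, m, f) \<in> triangles T" and nK: "src T n \<in> K" "tgt T n \<in> K" and G: "presents T K f G"
  shows "presents T K (dual_arr T n) (delta T K G)"
proof -
  note [simp] = tri_arrows[OF tri]
  let ?N = "src T n" and ?Z = "tgt T n" and ?A = "tgt T m" and ?B = "tgt T f"
  have rigid [simp]: "rigid T ?N" "rigid T ?Z" using nK by (simp_all add: K_rigid)
  have fK: "?A \<in> K" "tgt T f \<in> K" using G by (simp_all add: presents_def)
  obtain \<tau> where \<tau>: "nat_transf T K (coker_functor T f) G \<tau>"
    and iso: "\<And>X. X \<in> K \<Longrightarrow> \<tau> X \<in> iso (val (coker_functor T f) X) (val G X)"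
    using G unfolding presents_def nat_isomorphic_def by blast
  have val_in: "\<tau> X (cls f X a) \<in> carrier (val G X)" if "X \<in> K" "src T a = ?A" "tgt T a = X" for X a
    using iso[OF that(1)] clsI[of a f X] that by (auto simp: iso_def hom_def)
  have val_ex: "\<exists>a. src T a = ?A \<and> tgt T a = X \<and> x = \<tau> X (cls f X a)"
    if "X \<in> K" "x \<in> carrier (val G X)" for X x
  proof -
    have "x \<in> \<tau> X ` carrier (val (coker_functor T f) X)"
      using iso[OF that(1)] that(2) by (auto simp: iso_def bij_betw_def)
    then show ?thesis by (auto simp: coker_carrier in_Hom)
  qed
  have val_eq: "\<tau> X (cls f X a) = \<tau> X (cls f X b) \<longleftrightarrow> a \<boxplus> neg_arr T b \<in> im_hom T f X"
    if "X \<in> K" "src T a = ?A" "tgt T a = X" "src T b = ?A" "tgt T b = X" for X a b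
  proof -
    have "\<tau> X (cls f X a) = \<tau> X (cls f X b) \<longleftrightarrow> cls f X a = cls f X b"
      using iso[OF that(1)] clsI[of a f X] clsI[of b f X] that
      by (auto simp: iso_def bij_betw_def dest: inj_onD)
    then show ?thesis using cls_eq_iff[of a f X b] that by simp
  qed
  have map_val: "map_arr G g (\<tau> X (cls f X a)) = \<tau> Y (cls f Y (g \<cdot> a))"
    if "X \<in> K" "Y \<in> K" "src T a = ?A" "tgt T a = X" "src T g = X" "tgt T g = Y" for X Y a g
    using nat_transf_cls[OF \<tau>, of Y g a] that by simp
  have val_plus: "\<tau> X (cls f X a) \<otimes>\<^bsub>val G X\<^esub> \<tau> X (cls f X b) = \<tau> X (cls f X (a \<boxplus> b))"
    if "X \<in> K" "src T a = ?A" "tgt T a = X" "src T b = ?A" "tgt T b = X" for X a b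
    using hom_mult[of "\<tau> X" "val (coker_functor T f) X" "val G X" "cls f X a" "cls f X b"]
      iso[OF that(1)] clsI[of a f X] clsI[of b f X] cls_plus[of a f X b] that
    by (simp add: iso_def)
  define rep where "rep X x = (SOME a. src T a = ?A \<and> tgt T a = X \<and> x = \<tau> X (cls f X a))" for X x
  have rep: "src T (rep X x) = ?A" "tgt T (rep X x) = X" "\<tau> X (cls f X (rep X x)) = x"
    if "X \<in> K" "x \<in> carrier (val G X)" for X x
    using someI_ex[OF val_ex[OF that]] by (simp_all add: rep_def)
  \<comment> \<open>Composition with \<open>s\<close> on chosen representatives. The condition that
    \<open>f\<close> kills \<open>s\<close> makes it independent of the choice, and
    \<open>undefined\<close> matches the normalisation in \<open>nat_group\<close>.\<close>
  define \<Phi> where "\<Phi> s X x = (if X \<in> K \<and> x \<in> carrier (val G X) then rep X x \<cdot> s else undefined)" for s X x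
  have \<Phi>: "\<Phi> s X (\<tau> X (cls f X a)) = a \<cdot> s"
    if "X \<in> K" "src T a = ?A" "tgt T a = X" "tgt T s = ?A" "f \<cdot> s = zero_arr T (src T s) ?B" for s X a
  proof -
    let ?r = "rep X (\<tau> X (cls f X a))"
    note r = rep[OF that(1) val_in[OF that(1-3)]]
    have "?r \<boxplus> neg_arr T a \<in> im_hom T f X"
      using r that by (subst val_eq[symmetric]) simp_all
    then obtain h where h: "src T h = ?B" "tgt T h = X" "?r \<boxplus> neg_arr T a = h \<cdot> f"
      unfolding in_im_hom by blast
    have "?r \<cdot> s \<boxplus> neg_arr T (a \<cdot> s) = (?r \<boxplus> neg_arr T a) \<cdot> s" using r that by simp
    also have "\<dots> = zero_arr T (src T s) X" unfolding h(3) using h that by simp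
    finally have "?r \<cdot> s = a \<cdot> s" using r that by (subst eq_iff_diff_zero) simp_all
    then show ?thesis using val_in[OF that(1-3)] that(1) by (simp add: \<Phi>_def)
  qed
  let ?H = "\<lambda>Y. nat_group T K G (hom_functor T (D Y))"
  have H_carrier: "\<sigma> \<in> carrier (?H Y) \<longleftrightarrow> (\<forall>X\<in>K. \<sigma> X \<in> hom (val G X) (homgrp T (D Y) X)) \<and>
        (\<forall>X\<in>K. \<forall>X'\<in>K. \<forall>g\<in>Hom T X X'. \<forall>x\<in>carrier (val G X). \<sigma> X' (map_arr G g x) = g \<cdot> \<sigma> X x) \<and>
        (\<forall>X x. \<not> (X \<in> K \<and> x \<in> carrier (val G X)) \<longrightarrow> \<sigma> X x = undefined)" for \<sigma> Y
    by (simp add: nat_group_def nat_transf_def hom_functor_def)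
  have \<Phi>_in: "\<Phi> s \<in> carrier (?H Y)"
    if s: "src T s = D Y" "tgt T s = ?A" "f \<cdot> s = zero_arr T (D Y) ?B" for s Y
  proof -
    have "\<Phi> s X \<in> hom (val G X) (homgrp T (D Y) X)" if X: "X \<in> K" for X
    proof (rule homI)
      fix x assume "x \<in> carrier (val G X)"
      then obtain a where "src T a = ?A" "tgt T a = X" "x = \<tau> X (cls f X a)" using val_ex[OF X] by blast
      then show "\<Phi> s X x \<in> carrier (homgrp T (D Y) X)" using \<Phi>[OF X, of a s] s by (simp add: in_Hom)
    next
      fix x y assume "x \<in> carrier (val G X)" "y \<in> carrier (val G X)"
      then obtain a b where a: "src T a = ?A" "tgt T a = X" "x = \<tau> X (cls f X a)"
        and b: "src T b = ?A" "tgt T b = X" "y = \<tau> X (cls f X b)" using val_ex[OF X] by meson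
      show "\<Phi> s X (x \<otimes>\<^bsub>val G X\<^esub> y) = \<Phi> s X x \<otimes>\<^bsub>homgrp T (D Y) X\<^esub> \<Phi> s X y"
        using val_plus[OF X a(1,2) b(1,2)] \<Phi>[OF X a(1,2), of s] \<Phi>[OF X b(1,2), of s] \<Phi>[OF X, of "a \<boxplus> b" s] a b s
        by simp
    qed
    moreover have "\<Phi> s Y' (map_arr G g x) = g \<cdot> \<Phi> s X x"
      if X: "X \<in> K" "Y' \<in> K" "src T g = X" "tgt T g = Y'" "x \<in> carrier (val G X)" for X Y' g x
    proof -
      obtain a where a: "src T a = ?A" "tgt T a = X" "x = \<tau> X (cls f X a)" using val_ex[OF X(1,5)] by blast
      then show ?thesis
        using map_val[of X Y' a g] X \<Phi>[of X a s] \<Phi>[of Y' "g \<cdot> a" s] s by simp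
    qed
    moreover have "\<Phi> s X x = undefined" if "\<not> (X \<in> K \<and> x \<in> carrier (val G X))" for X x
      using that by (auto simp: \<Phi>_def)
    ultimately show ?thesis unfolding H_carrier by (auto simp: in_Hom)
  qed
  \<comment> \<open>By Yoneda a transformation is determined by its value at the class of the
    identity, and the class of \<open>f\<close> being zero forces \<open>f\<close> to kill that
    value.\<close>
  have \<Phi>_surj: "\<exists>s. src T s = D Y \<and> tgt T s = ?A \<and> f \<cdot> s = zero_arr T (D Y) ?B \<and> \<sigma> = \<Phi> s"
    if \<sigma>: "\<sigma> \<in> carrier (?H Y)" for \<sigma> Y
  proof -
    let ?id = "\<tau> ?A (cls f ?A (ident T ?A))"
    let ?s = "\<sigma> ?A ?id"
    have hom: "\<sigma> X \<in> hom (val G X) (homgrp T (D Y) X)" if "X \<in> K" for X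
      using \<sigma> that unfolding H_carrier by blast
    have nat: "\<sigma> X (map_arr G g ?id) = g \<cdot> ?s" if "X \<in> K" "src T g = ?A" "tgt T g = X" for X g
      using \<sigma> that fK val_in[OF fK(1), of "ident T ?A"] unfolding H_carrier by (simp add: in_Hom)
    have s: "src T ?s = D Y" "tgt T ?s = ?A"
      using hom[OF fK(1)] val_in[OF fK(1), of "ident T ?A"] by (auto simp: hom_def in_Hom)
    have \<sigma>_val: "\<sigma> X (\<tau> X (cls f X a)) = a \<cdot> ?s" if "X \<in> K" "src T a = ?A" "tgt T a = X" for X a
      using nat[OF that] map_val[of ?A X "ident T ?A" a] fK that by simp
    have "\<tau> ?B (cls f ?B f) = \<tau> ?B (cls f ?B (zero_arr T ?A ?B))"
      using im_homI[of "ident T ?B" f] fK by (subst val_eq) simp_all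
    then have fs: "f \<cdot> ?s = zero_arr T (D Y) ?B"
      using \<sigma>_val[of ?B f] \<sigma>_val[of ?B "zero_arr T ?A ?B"] fK s by simp
    have "\<sigma> X x = \<Phi> ?s X x" for X x
    proof (cases "X \<in> K \<and> x \<in> carrier (val G X)")
      case True
      then obtain a where a: "src T a = ?A" "tgt T a = X" "x = \<tau> X (cls f X a)" using val_ex by blast
      then show ?thesis using \<sigma>_val[of X a] \<Phi>[of X a ?s] True s fs by simp
    next
      case False
      then have "\<sigma> X x = undefined" using \<sigma> unfolding H_carrier by blast
      then show ?thesis using False by (auto simp: \<Phi>_def)
    qed
    then have "\<sigma> = \<Phi> ?s" by blast
    then show ?thesis using s fs by blast
  qed
  have \<Phi>_inj: "s = s'" if s: "tgt T s = ?A" "f \<cdot> s = zero_arr T (src T s) ?B" "tgt T s' = ?A" "f \<cdot> s' = zero_arr T (src T s') ?B"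
    and eq: "\<Phi> s = \<Phi> s'" for s s'
    using \<Phi>[OF fK(1), of "ident T ?A" s] \<Phi>[OF fK(1), of "ident T ?A" s'] s eq by simp
  have \<Phi>_plus: "\<Phi> s \<otimes>\<^bsub>?H Y\<^esub> \<Phi> s' = \<Phi> (s \<boxplus> s')"
    if s: "src T s = D Y" "tgt T s = ?A" "src T s' = D Y" "tgt T s' = ?A" for s s' Y
    using s rep by (intro ext) (simp add: nat_group_def hom_functor_def \<Phi>_def)
  have \<Phi>_map: "map_arr (delta T K G) h (\<Phi> s) = \<Phi> (s \<cdot> dual_arr T h)"
    if "tgt T s = ?A" "src T s = D (src T h)" for h s
    using that rep by (intro ext) (simp add: delta_def \<Phi>_def)
  let ?n = "dual_arr T n"
  have mn: "m \<cdot> n = zero_arr T ?N ?A" and fm: "f \<cdot> m = zero_arr T ?Z ?B"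
    using tri_cmp_zero[OF tri] tri_cmp_zero[OF tri_rotate[OF tri]] by simp_all
  \<comment> \<open>An arrow \<open>z\<close> from the dual of \<open>?Z\<close> to \<open>Y\<close>
    becomes, by transposition and composition with \<open>m\<close>, an arrow from
    \<open>D Y\<close> that \<open>f\<close> kills.\<close>
  define S where "S z = m \<cdot> transpose ?Z z" for z
  have S: "src T (S z) = D (tgt T z)" "tgt T (S z) = ?A" "f \<cdot> S z = zero_arr T (D (tgt T z)) ?B"
    if "src T z = D ?Z" for z
    using transpose_arr[of ?Z z] that cmp_reduce[OF fm, of "transpose ?Z z"] by (simp_all add: S_def)
  have S_plus: "S (z \<boxplus> z') = S z \<boxplus> S z'" if "src T z = D ?Z" "src T z' = D ?Z" "tgt T z = tgt T z'" for z z'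
    using that transpose_plus[of ?Z z z'] transpose_arr[of ?Z z] transpose_arr[of ?Z z'] by (simp add: S_def)
  have S_dual: "S (w \<cdot> ?n) = zero_arr T (D (tgt T w)) ?A" if "src T w = D ?N" for w
    using that transpose_dual[of n w] transpose_arr[of ?N w] cmp_reduce[OF mn, of "transpose ?N w"]
    by (simp add: S_def)
  have S_map: "S (h \<cdot> z) = S z \<cdot> dual_arr T h" if "src T z = D ?Z" "tgt T z = src T h" for h z
    using that transpose_cmp[of ?Z z h] transpose_arr[of ?Z z] by (simp add: S_def)
  \<comment> \<open>The transpose is killed by \<open>m\<close> exactly when it factors through
    \<open>n\<close>, and transposition turns this into a factorisation of \<open>z\<close> through
    the dual of \<open>n\<close>.\<close>
  have S_zero_iff: "S z = zero_arr T (D Y) ?A \<longleftrightarrow> z \<in> im_hom T ?n Y"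
    if Y: "Y \<in> K" and z: "src T z = D ?Z" "tgt T z = Y" for Y z
  proof
    have rY: "rigid T Y" using Y by (simp add: K_rigid)
    assume "S z = zero_arr T (D Y) ?A"
    then obtain t where t: "src T t = D Y" "tgt T t = ?N" "n \<cdot> t = transpose ?Z z"
      using tri_weak_ker[OF tri, of "transpose ?Z z"] transpose_arr[of ?Z z] z by (auto simp: S_def)
    obtain w where w: "src T w = D ?N" "tgt T w = Y" "transpose ?N w = t"
      using transpose_surj[OF rigid(1) rY t(1,2)] .
    have "z = w \<cdot> ?n"
      by (rule transpose_inj[of ?Z]) (use z w t rY transpose_dual[of n w] in simp_all)
    then show "z \<in> im_hom T ?n Y" using im_homI[of w ?n] w by simp
  next
    assume "z \<in> im_hom T ?n Y"
    then obtain w where "src T w = D ?N" "tgt T w = Y" "z = w \<cdot> ?n" unfolding in_im_hom by auto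
    then show "S z = zero_arr T (D Y) ?A" using S_dual[of w] by simp
  qed
  have S_neg: "S (neg_arr T z) = neg_arr T (S z)" if "src T z = D ?Z" "tgt T z \<in> K" for z
  proof (rule neg_unique)
    have "S (neg_arr T z \<boxplus> z) = zero_arr T (D (tgt T z)) ?A"
      using S_zero_iff[OF that(2), of "zero_arr T (D ?Z) (tgt T z)"]
        im_homI[of "zero_arr T (D ?N) (tgt T z)" ?n] that by simp
    then show "S (neg_arr T z) \<boxplus> S z = zero_arr T (src T (S z)) (tgt T (S z))"
      using S_plus[of "neg_arr T z" z] S[of z] that by simp
  qed (use S that in simp_all)
  have S_eq_iff: "S z = S z' \<longleftrightarrow> cls ?n Y z = cls ?n Y z'"
    if Y: "Y \<in> K" and z: "src T z = D ?Z" "tgt T z = Y" "src T z' = D ?Z" "tgt T z' = Y" for Y z z'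
  proof -
    have "S z = S z' \<longleftrightarrow> S (z \<boxplus> neg_arr T z') = zero_arr T (D Y) ?A"
      using eq_iff_diff_zero[of "S z" "S z'"] S[of z] S[of z'] S_plus[of z "neg_arr T z'"] S_neg[of z'] z Y by simp
    also have "\<dots> \<longleftrightarrow> cls ?n Y z = cls ?n Y z'"
      using cls_eq_iff[of z ?n Y z'] S_zero_iff[OF Y, of "z \<boxplus> neg_arr T z'"] z by simp
    finally show ?thesis .
  qed
  have S_surj: "\<exists>z. src T z = D ?Z \<and> tgt T z = Y \<and> S z = s"
    if Y: "Y \<in> K" and s: "src T s = D Y" "tgt T s = ?A" "f \<cdot> s = zero_arr T (D Y) ?B" for Y s
  proof -
    have rY: "rigid T Y" using Y by (simp add: K_rigid)
    obtain t where t: "src T t = D Y" "tgt T t = ?Z" "m \<cdot> t = s"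
      using tri_weak_ker2[OF tri, of s] tri_weak_ker[OF tri_rotate[OF tri], of s] s by auto
    obtain z where "src T z = D ?Z" "tgt T z = Y" "transpose ?Z z = t"
      using transpose_surj[OF rigid(2) rY t(1,2)] .
    then show ?thesis using t by (auto simp: S_def)
  qed
  \<comment> \<open>A representative of the coset is chosen; \<open>S_eq_iff\<close> shows both that
    the choice does not matter and that the map is injective.\<close>
  define \<theta> where "\<theta> Y c = \<Phi> (S (SOME z. src T z = D ?Z \<and> tgt T z = Y \<and> cls ?n Y z = c))" for Y c
  have \<theta>: "\<theta> Y (cls ?n Y z) = \<Phi> (S z)" if Y: "Y \<in> K" and z: "src T z = D ?Z" "tgt T z = Y" for Y z
  proof -
    let ?z = "SOME z'. src T z' = D ?Z \<and> tgt T z' = Y \<and> cls ?n Y z' = cls ?n Y z"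
    have "src T ?z = D ?Z \<and> tgt T ?z = Y \<and> cls ?n Y ?z = cls ?n Y z"
      by (rule someI[of _ z]) (use z in simp)
    then have "S ?z = S z" using S_eq_iff[OF Y, of ?z z] z by simp
    then show ?thesis by (simp add: \<theta>_def)
  qed
  have cE: "\<exists>z. src T z = D ?Z \<and> tgt T z = Y \<and> c = cls ?n Y z" if "c \<in> carrier (val (coker_functor T ?n) Y)" for c Y
    using clsE[OF that] by (metis src_dual)
  have delta_val: "val (delta T K G) Y = ?H Y" for Y by (simp add: delta_def)
  have "\<theta> Y \<in> iso (val (coker_functor T ?n) Y) (val (delta T K G) Y)" if Y: "Y \<in> K" for Y
    unfolding delta_val iso_def bij_betw_def
  proof (intro CollectI conjI)
    show "\<theta> Y \<in> hom (val (coker_functor T ?n) Y) (?H Y)"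
    proof (rule homI)
      fix c assume "c \<in> carrier (val (coker_functor T ?n) Y)"
      then obtain z where "src T z = D ?Z" "tgt T z = Y" "c = cls ?n Y z" using cE by blast
      then show "\<theta> Y c \<in> carrier (?H Y)" using \<theta>[OF Y] \<Phi>_in[of "S z" Y] S[of z] by simp
    next
      fix c d assume "c \<in> carrier (val (coker_functor T ?n) Y)" "d \<in> carrier (val (coker_functor T ?n) Y)"
      then obtain z z' where z: "src T z = D ?Z" "tgt T z = Y" "c = cls ?n Y z"
        and z': "src T z' = D ?Z" "tgt T z' = Y" "d = cls ?n Y z'" using cE by meson
      show "\<theta> Y (c \<otimes>\<^bsub>val (coker_functor T ?n) Y\<^esub> d) = \<theta> Y c \<otimes>\<^bsub>?H Y\<^esub> \<theta> Y d"
        using z z' cls_plus[of z ?n Y z'] \<theta>[OF Y z(1,2)] \<theta>[OF Y z'(1,2)] \<theta>[OF Y, of "z \<boxplus> z'"]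
          S_plus[of z z'] \<Phi>_plus[of "S z" Y "S z'"] S[of z] S[of z'] by simp
    qed
    show "inj_on (\<theta> Y) (carrier (val (coker_functor T ?n) Y))"
    proof (rule inj_onI)
      fix c d assume "c \<in> carrier (val (coker_functor T ?n) Y)" "d \<in> carrier (val (coker_functor T ?n) Y)"
        and eq: "\<theta> Y c = \<theta> Y d"
      then obtain z z' where z: "src T z = D ?Z" "tgt T z = Y" "c = cls ?n Y z"
        and z': "src T z' = D ?Z" "tgt T z' = Y" "d = cls ?n Y z'" using cE by meson
      have "\<Phi> (S z) = \<Phi> (S z')" using eq \<theta>[OF Y z(1,2)] \<theta>[OF Y z'(1,2)] z z' by simp
      then have "S z = S z'" using \<Phi>_inj[of "S z" "S z'"] S[OF z(1)] S[OF z'(1)] z z' by simp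
      then show "c = d" using S_eq_iff[OF Y z(1,2) z'(1,2)] z z' by simp
    qed
    show "\<theta> Y ` carrier (val (coker_functor T ?n) Y) = carrier (?H Y)"
    proof
      show "\<theta> Y ` carrier (val (coker_functor T ?n) Y) \<subseteq> carrier (?H Y)"
      proof safe
        fix c assume "c \<in> carrier (val (coker_functor T ?n) Y)"
        then obtain z where "src T z = D ?Z" "tgt T z = Y" "c = cls ?n Y z" using cE by blast
        then show "\<theta> Y c \<in> carrier (?H Y)" using \<theta>[OF Y] \<Phi>_in[of "S z" Y] S[of z] by simp
      qed
      show "carrier (?H Y) \<subseteq> \<theta> Y ` carrier (val (coker_functor T ?n) Y)"
      proof
        fix \<sigma> assume "\<sigma> \<in> carrier (?H Y)"
        then obtain s where s: "src T s = D Y" "tgt T s = ?A" "f \<cdot> s = zero_arr T (D Y) ?B" "\<sigma> = \<Phi> s"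
          using \<Phi>_surj by blast
        obtain z where z: "src T z = D ?Z" "tgt T z = Y" "S z = s" using S_surj[OF Y s(1-3)] by blast
        then have "\<sigma> = \<theta> Y (cls ?n Y z)" using \<theta>[OF Y z(1,2)] s by simp
        then show "\<sigma> \<in> \<theta> Y ` carrier (val (coker_functor T ?n) Y)" using clsI[of z ?n Y] z by simp
      qed
    qed
  qed
  moreover have "nat_transf T K (coker_functor T ?n) (delta T K G) \<theta>"
    unfolding nat_transf_def
  proof (intro conjI ballI)
    show "\<theta> Y \<in> hom (val (coker_functor T ?n) Y) (val (delta T K G) Y)" if "Y \<in> K" for Y
      using calculation[OF that] by (simp add: iso_def)
    fix Y Y' h c assume Y: "Y \<in> K" "Y' \<in> K" and h: "h \<in> Hom T Y Y'" and "c \<in> carrier (val (coker_functor T ?n) Y)"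
    then obtain z where z: "src T z = D ?Z" "tgt T z = Y" "c = cls ?n Y z" using cE by blast
    have h': "src T h = Y" "tgt T h = Y'" using h by (simp_all add: in_Hom)
    show "\<theta> Y' (map_arr (coker_functor T ?n) h c) = map_arr (delta T K G) h (\<theta> Y c)"
      using map_cls[of z ?n h] z h' \<theta>[OF Y(1) z(1,2)] \<theta>[OF Y(2), of "h \<cdot> z"] S_map[of z h]
        \<Phi>_map[of "S z" h] S[of z] by simp
  qed
  ultimately show ?thesis
    using nK K_dual unfolding presents_def nat_isomorphic_def by auto
qed

text \<open>Duality carries triangles to triangles up to a sign on the third arrow, so either case
  of \<open>ihom_exact\<close> gives the same weak cokernel.\<close>

lemma dual_weak_coker:
  assumes tri: "(n, m, f) \<in> triangles T" and z: "src T z = D (tgt T n)" "z \<cdot> dual_arr T m = zero_arr T (D (tgt T m)) (tgt T z)"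
  obtains w where "src T w = D (src T n)" "tgt T w = tgt T z" "w \<cdot> dual_arr T n = z"
proof -
  obtain k where "(dual_arr T m, dual_arr T n, k) \<in> triangles T"
    using ihom_exact[OF tri, of one] unfolding dual_arr_def by blast
  from tri_weak_coker[OF this, of z] show ?thesis using z that tri_arrows[OF tri] by auto
qed

end

section \<open>The dual definable category of the local objects\<close>

context smashing_tt_category
begin

lemma J_dual:
  assumes "f \<in> J" shows "dual_arr T f \<in> J"
proof -
  have f: "src T f \<in> K" "tgt T f \<in> K" "\<eta> (tgt T f) \<cdot> f = zero_arr T (src T f) (LO (tgt T f))"
    using assms L_zero_iff[of f] by (simp_all add: J_def)
  obtain q k where tri: "(q, \<eta> (tgt T f), k) \<in> triangles T" using fibre_exists .
  have q: "tgt T q = tgt T f" using tri_arrows(1)[OF tri] by simp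
  obtain p where p: "src T p = src T f" "tgt T p = src T q" "q \<cdot> p = f"
    using tri_weak_ker[OF tri, of f] f q by auto
  obtain k l where kl: "dual_arr T (q \<cdot> p) = l \<cdot> k" "src T l = tgt T k"
    "tgt T k = D (src T p) \<boxtimes> (D (tgt T q) \<boxtimes> src T q)" "src T k = D (tgt T q)" "tgt T l = D (src T p)"
    by (rule dual_factor[of p q]) (use p f(1) in \<open>simp_all add: K_rigid\<close>)
  have "is_zero T (LO (tgt T k))"
    unfolding kl(3) by (intro acyclic_tensor fibre_acyclic[OF tri])
  from L_zero_factor[OF this, of l k]
  show ?thesis using kl p q f by (simp add: J_def K_dual del: dual_cmp)
qed

text \<open>Naturality of \<open>bidual\<close>, invertible at the compact target of
  \<open>f\<close>, turns a vanishing statement about the double dual of \<open>f\<close> into one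
  about \<open>f\<close>.\<close>

lemma bidual_J:
  assumes f: "f \<in> J" and Y: "\<And>h. \<lbrakk>src T h = D (D (tgt T f)); tgt T h = Y\<rbrakk> \<Longrightarrow>
      h \<cdot> dual_arr T (dual_arr T f) = zero_arr T (D (D (src T f))) Y"
    and x: "src T x = tgt T f" "tgt T x = Y"
  shows "x \<cdot> f = zero_arr T (src T f) Y"
proof -
  let ?b = "bidual (tgt T f)"
  have b: "is_iso T ?b" using f bidual_iso by (simp add: J_def K_rigid)
  have "x \<cdot> f = (x \<cdot> inv_arr T ?b) \<cdot> ?b \<cdot> f" using x b by simp
  also have "\<dots> = ((x \<cdot> inv_arr T ?b) \<cdot> dual_arr T (dual_arr T f)) \<cdot> bidual (src T f)"
    using x b by (simp flip: bidual_natural)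
  also have "(x \<cdot> inv_arr T ?b) \<cdot> dual_arr T (dual_arr T f) = zero_arr T (D (D (src T f))) Y"
    by (rule Y) (use x b in simp_all)
  finally show ?thesis by simp
qed

theorem local_dual_definable: "dual_definable T U (local_objects T \<eta>) = local_objects T \<eta>"
proof
  show "local_objects T \<eta> \<subseteq> dual_definable T U (local_objects T \<eta>)"
  proof
    fix Y assume "Y \<in> local_objects T \<eta>"
    then have Y: "is_iso T (\<eta> Y)" by (simp add: local_objects_def)
    have "trivial_group (val (tilde T K (delta T K G)) Y)" if G: "G \<in> annihilator T K (local_objects T \<eta>)" for G
    proof -
      obtain f where f: "presents T K f G" using G by (auto simp: annihilator_def fp_functor_def)
      have fK: "src T f \<in> K" "tgt T f \<in> K" using f by (simp_all add: presents_def)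
      have surj: "x \<in> im_hom T f X" if "is_iso T (\<eta> X)" "src T x = src T f" "tgt T x = X" for x X
        using G tilde_trivial_iff[OF f, of X] that by (simp add: annihilator_def local_objects_def)
      obtain m k where tri: "(m, f, k) \<in> triangles T" using fibre_exists .
      note [simp] = tri_arrows[OF tri]
      have mK: "src T m \<in> K" using K_fibre[OF tri] fK by simp
      have tri': "(unshift_arr (neg_arr T k), m, f) \<in> triangles T" (is "(?n, _, _) \<in> _") by (rule tri_unrotate[OF tri])
      have nK: "src T ?n \<in> K" "tgt T ?n \<in> K" using fK mK by simp_all
      \<comment> \<open>The local object \<open>LO (src T f)\<close> is the universal test:
        surjectivity there extends \<open>\<eta>\<close> along \<open>f\<close>, so its composite
        with the fibre \<open>m\<close> vanishes.\<close>
      obtain r where r: "src T r = tgt T f" "tgt T r = LO (src T f)" "\<eta> (src T f) = r \<cdot> f"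
        using surj[of "LO (src T f)" "\<eta> (src T f)"] by (auto simp: in_im_hom)
      have "\<eta> (tgt T m) \<cdot> m = r \<cdot> f \<cdot> m" using r by simp
      also have "\<dots> = zero_arr T (src T m) (LO (tgt T m))"
        using tri_cmp_zero[OF tri] r(1,2) by simp
      finally have mJ: "m \<in> J" using mK fK by (simp add: J_def L_zero_iff)
      have "z \<in> im_hom T (dual_arr T ?n) Y" if z: "src T z = D (tgt T ?n)" "tgt T z = Y" for z
      proof -
        have "z \<cdot> dual_arr T m = zero_arr T (D (tgt T m)) Y"
          using local_iff[of Y] Y J_dual[OF mJ] z by simp
        then obtain w where "src T w = D (src T ?n)" "tgt T w = Y" "w \<cdot> dual_arr T ?n = z"
          using dual_weak_coker[OF tri' z(1)] z(2) by auto
        then show ?thesis using im_homI[of w "dual_arr T ?n"] by auto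
      qed
      then show ?thesis using tilde_trivial_iff[OF delta_presents[OF tri' nK f], of Y] by simp
    qed
    then show "Y \<in> dual_definable T U (local_objects T \<eta>)" by (auto simp: dual_definable_def)
  qed
  show "dual_definable T U (local_objects T \<eta>) \<subseteq> local_objects T \<eta>"
  proof
    fix Y assume Y: "Y \<in> dual_definable T U (local_objects T \<eta>)"
    have "x \<cdot> j = zero_arr T (src T j) Y" if j: "j \<in> J" and x: "src T x = tgt T j" "tgt T x = Y" for j x
    proof (rule bidual_J[OF j _ x])
      fix h assume h: "src T h = D (D (tgt T j))" "tgt T h = Y"
      \<comment> \<open>The argument is run on the dual of \<open>j\<close>, which is again in
        \<open>J\<close>, placed as the fibre of a compact arrow \<open>f\<close>. It yields a
        statement about the double dual of \<open>j\<close>, which \<open>bidual_J\<close> brings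
        back to \<open>j\<close>.\<close>
      let ?m = "dual_arr T j"
      have mJ: "?m \<in> J" by (rule J_dual[OF j])
      then have mK: "src T ?m \<in> K" "tgt T ?m \<in> K" by (simp_all only: J_def mem_Collect_eq)
      obtain f k where tri: "(?m, f, k) \<in> triangles T" using triangle_exists by blast
      note f = tri_arrows[OF tri]
      have fK: "src T f \<in> K" "tgt T f \<in> K" using K_cone[OF tri mK] f mK by simp_all
      have tri': "(unshift_arr (neg_arr T k), ?m, f) \<in> triangles T" (is "(?n, _, _) \<in> _") by (rule tri_unrotate[OF tri])
      have nK: "src T ?n \<in> K" "tgt T ?n \<in> K" using fK mK f by simp_all
      have p: "presents T K f (coker_functor T f)" by (rule coker_presents[OF fK])
      have "x \<in> im_hom T f X" if X: "is_iso T (\<eta> X)" and x: "src T x = src T f" "tgt T x = X" for x X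
      proof -
        have "x \<cdot> ?m = zero_arr T (src T ?m) X"
          using local_iff[of X] X mJ x f by (simp del: src_dual tgt_dual)
        then obtain y where "src T y = tgt T f" "tgt T y = X" "y \<cdot> f = x"
          using tri_weak_coker[OF tri, of x] x f by auto
        then show ?thesis using im_homI[of y f] by auto
      qed
      then have "coker_functor T f \<in> annihilator T K (local_objects T \<eta>)"
        using p coker_ab_functor[of K f] tilde_trivial_iff[OF p]
        by (auto simp: annihilator_def fp_functor_def local_objects_def)
      then have "trivial_group (val (tilde T K (delta T K (coker_functor T f))) Y)"
        using Y by (auto simp: dual_definable_def)
      then have "h \<in> im_hom T (dual_arr T ?n) Y"
        using tilde_trivial_iff[OF delta_presents[OF tri' nK p], of Y] h f by simp
      then obtain w where w: "src T w = D (src T ?n)" "tgt T w = Y" "h = w \<cdot> dual_arr T ?n"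
        unfolding in_im_hom by auto
      \<comment> \<open>Since \<open>h\<close> factors through the dual of \<open>?n\<close>, it
        remains to use that consecutive arrows of a triangle compose to zero, also after
        dualising.\<close>
      have "dual_arr T ?n \<cdot> dual_arr T ?m = dual_arr T (?m \<cdot> ?n)" using f by simp
      also have "\<dots> = dual_arr T (zero_arr T (src T ?n) (tgt T ?m))"
        using tri_cmp_zero[OF tri'] by simp
      also have "\<dots> = zero_arr T (D (tgt T ?m)) (D (src T ?n))" by (rule dual_zero)
      finally have "dual_arr T ?n \<cdot> dual_arr T ?m = zero_arr T (D (tgt T ?m)) (D (src T ?n))" .
      then show "h \<cdot> dual_arr T ?m = zero_arr T (D (D (src T j))) Y"
        using w f by simp
    qed
    then show "Y \<in> local_objects T \<eta>" using local_iff[of Y] by (simp add: local_objects_def)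
  qed
qed

end

theorem corollary8p6:
  fixes U :: "'u set"
    and T :: "('o, 'm) tt_data"
    and R :: "'r ring"
    and gr :: "int \<Rightarrow> 'r set"
    and \<phi> :: "int \<Rightarrow> 'r \<Rightarrow> 'm"
    and L :: "('o, 'm) endofunctor"
    and \<eta> :: "'o \<Rightarrow> 'm"
  assumes "big_tt_category T U"
    and "graded_ring R gr" and "graded_commutative R gr" and "noetherian_ring R"
    and "canonically_stratified T R gr \<phi> U"
    and "smashing_localisation T U L \<eta>"
  shows "definable T U (local_objects T \<eta>) \<and>
         dual_definable T U (local_objects T \<eta>) = local_objects T \<eta>"
proof -
  interpret smashing_tt_category T U L \<eta>
    using assms(1,6) by (intro smashing_tt_category.intro smashing_tt_category_axioms.intro)
  show ?thesis using local_definable local_dual_definable by blast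
qed

end
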